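(* Let $\Gamma$ be a nonelementary subgroup of an irreducible arithmetic group $\Delta$ in $\mathrm{PSL}(2,\mathbb{R})^r$. Then $\Gamma$ is Zariski dense in $\mathrm{PSL}(2,\mathbb{R})^r$ if and only if the fields generated (over $\mathbb{Q}$) by $\mathrm{Tr}(p_i(\Gamma^{(2)}))$ and by $\mathrm{Tr}(p_i(\Delta^{(2)}))$ are equal for one and hence for all $i\in\{1,\dots,r\}$.
   Context: $p_i$ is the projection of $\mathrm{PSL}(2,\mathbb{R})^r$ to the $i$-th factor. For $g=\pm\begin{pmatrix}a&b\\c&d\end{pmatrix}\in\mathrm{PSL}(2,\mathbb{R})$ put $\mathrm{tr}(g)=|a+d|$. For a subgroup $H$ of $\mathrm{PSL}(2,\mathbb{R})$ put $\mathrm{Tr}(H)=\{\mathrm{tr}(g)\mid g\in H\}$. For a group $S$, $S^{(2)}$ is the subgroup generated by $\{g^2\mid g\in S\}$. A subset of $\mathrm{PSL}(2,\mathbb{R})^r$ is Zariski closed if its preimage in $\mathrm{SL}(2,\mathbb{R})^r$ is the zero set of real polynomials in the matrix entries. A subgroup of $\mathrm{PSL}(2,\mathbb{R})$ is elementary if it has a finite orbit in $\mathbb{H}^2\cup\partial\mathbb{H}^2$, and nonelementary otherwise. An element of $\mathrm{PSL}(2,\mathbb{R})^r$ is elliptic, parabolic or hyperbolic if all its components are elliptic, parabolic or hyperbolic respectively. In all other cases (apart from the identity) it is mixed. A subgroup $\Gamma$ of $\mathrm{PSL}(2,\mathbb{R})^r$ is nonelementary if $p_i(\Gamma)$ is nonelementary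 for all $i$ and every component of every mixed $g\in\Gamma$ is either hyperbolic or elliptic of infinite order. Irreducible arithmetic groups. Let $K\subset\mathbb{R}$ be a totally real number field of degree $n$ with embeddings $\phi_1=\mathrm{id},\phi_2,\dots,\phi_n$ into $\mathbb{R}$. Let $A$ be a quaternion algebra over $K$ that is unramified (isomorphic to $M(2,\mathbb{R})$) at $\phi_1,\dots,\phi_r$ and ramified (isomorphic to Hamilton's quaternions) at $\phi_{r+1},\dots,\phi_n$. Fix extensions of $\phi_1,\dots,\phi_r$ to embeddings $\phi_i:A\to M(2,\mathbb{R})$. For an order $\mathcal{O}$ of $A$ let $\mathcal{O}^1$ be its group of units (of reduced norm 1) and $\Gamma(A,\mathcal{O})=\phi_1(\mathcal{O}^1)$. Let $\Gamma(A,\mathcal{O})^*$ be the image in $\mathrm{PSL}(2,\mathbb{R})^r$ of $\{(\phi_1(\varepsilon),\dots,\phi_r(\varepsilon))\mid\varepsilon\in\mathcal{O}^1\}$. The irreducible arithmetic subgroups of $\mathrm{PSL}(2,\mathbb{R})^r$ are the subgroups commensurable to some $\Gamma(A,\mathcal{O})^*$. *)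

theory Defs
  imports
    "HOL-Analysis.Analysis"
    "HOL-Algebra.Algebra"
    "HOL-Algebra.Algebraic_Closure_Type"
begin

section \<open>The groups PSL(2,R) and their finite powers\<close>

type_synonym mat2 = "real^2^2"

definition SL2R :: "mat2 monoid" where
  "SL2R = \<lparr>carrier = {M. det M = 1}, monoid.mult = (**), one = mat 1\<rparr>"

text \<open>An element of PSL(2,R) is a two-element coset \<open>{M, -M}\<close>.\<close>

definition pm_one :: "mat2 set" where
  "pm_one = {mat 1, - mat 1}"

definition PSL2R :: "mat2 set monoid" where
  "PSL2R = SL2R Mod pm_one"

definition PSL2R_pow :: "nat \<Rightarrow> (nat \<Rightarrow> mat2 set) monoid" where
  "PSL2R_pow r = product_group {1..r} (\<lambda>_. PSL2R)"

definition SL2R_pow :: "nat \<Rightarrow> (nat \<Rightarrow> mat2) monoid" where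
  "SL2R_pow r = product_group {1..r} (\<lambda>_. SL2R)"

definition to_PSL2R_pow :: "nat \<Rightarrow> (nat \<Rightarrow> mat2) \<Rightarrow> (nat \<Rightarrow> mat2 set)" where
  "to_PSL2R_pow r x = (\<lambda>i\<in>{1..r}. pm_one #>\<^bsub>SL2R\<^esub> x i)"

definition proj_set :: "nat \<Rightarrow> (nat \<Rightarrow> mat2 set) set \<Rightarrow> mat2 set set" where
  "proj_set i H = (\<lambda>g. g i) ` H"

definition squares_subgroup :: "('a, 'b) monoid_scheme \<Rightarrow> 'a set \<Rightarrow> 'a set" where
  "squares_subgroup G S = generate G {g \<otimes>\<^bsub>G\<^esub> g | g. g \<in> S}"

definition commensurable :: "('a, 'b) monoid_scheme \<Rightarrow> 'a set \<Rightarrow> 'a set \<Rightarrow> bool" where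
  "commensurable G H H' \<longleftrightarrow>
     finite (rcosets\<^bsub>G\<lparr>carrier := H\<rparr>\<^esub> (H \<inter> H')) \<and>
     finite (rcosets\<^bsub>G\<lparr>carrier := H'\<rparr>\<^esub> (H \<inter> H'))"

section \<open>Traces and the fields they generate\<close>

text \<open>Functions on PSL(2,R) that are given by a formula in the matrix entries, invariant under
  \<open>M \<mapsto> -M\<close>, are the common value on the two representatives.\<close>

definition tr_abs :: "mat2 set \<Rightarrow> real" where
  "tr_abs g = the_elem ((\<lambda>M. \<bar>trace M\<bar>) ` g)"

definition Tr :: "mat2 set set \<Rightarrow> real set" where
  "Tr H = tr_abs ` H"

abbreviation real_ring :: "real ring" where
  "real_ring \<equiv> ring_of_type_algebra"

abbreviation complex_ring :: "complex ring" where
  "complex_ring \<equiv> ring_of_type_algebra"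

definition field_over_Q :: "real set \<Rightarrow> real set" where
  "field_over_Q S = generate_field real_ring (\<rat> \<union> S)"

section \<open>Zariski topology\<close>

inductive entry_polynomial :: "nat \<Rightarrow> ((nat \<Rightarrow> mat2) \<Rightarrow> real) \<Rightarrow> bool" for r where
  const: "entry_polynomial r (\<lambda>x. c)"
| entry: "i \<in> {1..r} \<Longrightarrow> entry_polynomial r (\<lambda>x. x i $ j $ k)"
| add: "entry_polynomial r f \<Longrightarrow> entry_polynomial r g \<Longrightarrow> entry_polynomial r (\<lambda>x. f x + g x)"
| mult: "entry_polynomial r f \<Longrightarrow> entry_polynomial r g \<Longrightarrow> entry_polynomial r (\<lambda>x. f x * g x)"

definition zariski_closed :: "nat \<Rightarrow> (nat \<Rightarrow> mat2 set) set \<Rightarrow> bool" where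
  "zariski_closed r Z \<longleftrightarrow> Z \<subseteq> carrier (PSL2R_pow r) \<and>
     (\<exists>P. (\<forall>f\<in>P. entry_polynomial r f) \<and>
        {x \<in> carrier (SL2R_pow r). to_PSL2R_pow r x \<in> Z} =
        {x \<in> carrier (SL2R_pow r). \<forall>f\<in>P. f x = 0})"

definition zariski_dense :: "nat \<Rightarrow> (nat \<Rightarrow> mat2 set) set \<Rightarrow> bool" where
  "zariski_dense r H \<longleftrightarrow>
     (\<forall>Z. zariski_closed r Z \<and> H \<subseteq> Z \<longrightarrow> Z = carrier (PSL2R_pow r))"

section \<open>Elementary and nonelementary subgroups\<close>

text \<open>The closed upper half plane together with the point \<open>\<infinity>\<close>, which is \<^term>\<open>None\<close>.\<close>

definition closed_half_plane :: "complex option set" where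
  "closed_half_plane = insert None (Some ` {z. Im z \<ge> 0})"

fun moebius :: "mat2 \<Rightarrow> complex option \<Rightarrow> complex option" where
  "moebius M None =
     (if M $ 2 $ 1 = 0 then None else Some (of_real (M $ 1 $ 1) / of_real (M $ 2 $ 1)))"
| "moebius M (Some z) =
     (if of_real (M $ 2 $ 1) * z + of_real (M $ 2 $ 2) = 0 then None
      else Some ((of_real (M $ 1 $ 1) * z + of_real (M $ 1 $ 2)) /
                 (of_real (M $ 2 $ 1) * z + of_real (M $ 2 $ 2))))"

definition act :: "mat2 set \<Rightarrow> complex option \<Rightarrow> complex option" where
  "act g z = the_elem ((\<lambda>M. moebius M z) ` g)"

definition elementary :: "mat2 set set \<Rightarrow> bool" where
  "elementary H \<longleftrightarrow> (\<exists>z\<in>closed_half_plane. finite ((\<lambda>g. act g z) ` H))"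

definition elliptic :: "mat2 set \<Rightarrow> bool" where
  "elliptic g \<longleftrightarrow> tr_abs g < 2"

definition parabolic :: "mat2 set \<Rightarrow> bool" where
  "parabolic g \<longleftrightarrow> tr_abs g = 2 \<and> g \<noteq> \<one>\<^bsub>PSL2R\<^esub>"

definition hyperbolic :: "mat2 set \<Rightarrow> bool" where
  "hyperbolic g \<longleftrightarrow> tr_abs g > 2"

definition mixed :: "nat \<Rightarrow> (nat \<Rightarrow> mat2 set) \<Rightarrow> bool" where
  "mixed r g \<longleftrightarrow> g \<noteq> \<one>\<^bsub>PSL2R_pow r\<^esub> \<and>
     \<not> (\<forall>i\<in>{1..r}. elliptic (g i)) \<and>
     \<not> (\<forall>i\<in>{1..r}. parabolic (g i)) \<and>
     \<not> (\<forall>i\<in>{1..r}. hyperbolic (g i))"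

definition infinite_order :: "('a, 'b) monoid_scheme \<Rightarrow> 'a \<Rightarrow> bool" where
  "infinite_order G g \<longleftrightarrow> (\<forall>n::nat. n > 0 \<longrightarrow> g [^]\<^bsub>G\<^esub> n \<noteq> \<one>\<^bsub>G\<^esub>)"

definition nonelementary :: "nat \<Rightarrow> (nat \<Rightarrow> mat2 set) set \<Rightarrow> bool" where
  "nonelementary r \<Gamma> \<longleftrightarrow>
     (\<forall>i\<in>{1..r}. \<not> elementary (proj_set i \<Gamma>)) \<and>
     (\<forall>g\<in>\<Gamma>. mixed r g \<longrightarrow>
        (\<forall>i\<in>{1..r}. hyperbolic (g i) \<or> (elliptic (g i) \<and> infinite_order PSL2R (g i))))"

section \<open>Quaternion algebras\<close>

text \<open>\<^term>\<open>(x0, x1, x2, x3)\<close> stands for \<open>x0 + x1 i + x2 j + x3 ij\<close>, where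
  \<open>i\<^sup>2 = a\<close>, \<open>j\<^sup>2 = b\<close> and \<open>ji = - ij\<close>.\<close>

type_synonym quat4 = "real \<times> real \<times> real \<times> real"

fun quat_mult :: "real \<Rightarrow> real \<Rightarrow> quat4 \<Rightarrow> quat4 \<Rightarrow> quat4" where
  "quat_mult a b (x0, x1, x2, x3) (y0, y1, y2, y3) =
     (x0 * y0 + a * x1 * y1 + b * x2 * y2 - a * b * x3 * y3,
      x0 * y1 + x1 * y0 - b * x2 * y3 + b * x3 * y2,
      x0 * y2 + x2 * y0 + a * x1 * y3 - a * x3 * y1,
      x0 * y3 + x3 * y0 + x1 * y2 - x2 * y1)"

definition quaternion_algebra :: "real set \<Rightarrow> real \<Rightarrow> real \<Rightarrow> quat4 ring" where
  "quaternion_algebra K a b =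
     \<lparr>carrier = K \<times> K \<times> K \<times> K, monoid.mult = quat_mult a b, one = (1, 0, 0, 0),
      ring.zero = 0, add = (+)\<rparr>"

fun reduced_norm :: "real \<Rightarrow> real \<Rightarrow> quat4 \<Rightarrow> real" where
  "reduced_norm a b (x0, x1, x2, x3) =
     x0\<^sup>2 - a * x1\<^sup>2 - b * x2\<^sup>2 + a * b * x3\<^sup>2"

definition M2R :: "mat2 ring" where
  "M2R = \<lparr>carrier = UNIV, monoid.mult = (**), one = mat 1, ring.zero = 0, add = (+)\<rparr>"

definition hamilton_quaternions :: "quat4 ring" where
  "hamilton_quaternions = quaternion_algebra UNIV (-1) (-1)"

definition R_algebra_isomorphic ::
    "('a::real_vector, 'c) ring_scheme \<Rightarrow> ('b::real_vector, 'd) ring_scheme \<Rightarrow> bool" where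
  "R_algebra_isomorphic A B \<longleftrightarrow> (\<exists>h \<in> ring_iso A B. linear h)"

text \<open>For \<open>A\<close> the algebra with parameters \<open>a, b\<close> over \<open>K\<close> and an embedding \<open>f\<close> of \<open>K\<close> into the
  reals, the completion of \<open>A\<close> at \<open>f\<close> (the tensor product of \<open>A\<close> with the reals along \<open>f\<close>) is
  the real quaternion algebra with parameters \<open>f a, f b\<close>.\<close>

definition unramified_at :: "real \<Rightarrow> real \<Rightarrow> (real \<Rightarrow> real) \<Rightarrow> bool" where
  "unramified_at a b f \<longleftrightarrow>
     R_algebra_isomorphic (quaternion_algebra UNIV (f a) (f b)) M2R"

definition ramified_at :: "real \<Rightarrow> real \<Rightarrow> (real \<Rightarrow> real) \<Rightarrow> bool" where
  "ramified_at a b f \<longleftrightarrow>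
     R_algebra_isomorphic (quaternion_algebra UNIV (f a) (f b)) hamilton_quaternions"

definition ring_of_integers :: "real set \<Rightarrow> real set" where
  "ring_of_integers K = {x \<in> K. algebraic_int x}"

definition span_over :: "real set \<Rightarrow> 'a::real_vector set \<Rightarrow> 'a set" where
  "span_over S Y = {(\<Sum>x\<in>B. c x *\<^sub>R x) | B c. finite B \<and> B \<subseteq> Y \<and> (\<forall>x\<in>B. c x \<in> S)}"

definition is_order :: "real set \<Rightarrow> real \<Rightarrow> real \<Rightarrow> quat4 set \<Rightarrow> bool" where
  "is_order K a b \<O> \<longleftrightarrow>
     subring \<O> (quaternion_algebra K a b) \<and>
     (\<exists>B. finite B \<and> \<O> = span_over (ring_of_integers K) B) \<and>
     span_over K \<O> = carrier (quaternion_algebra K a b)"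

section \<open>Irreducible arithmetic groups\<close>

definition totally_real_number_field ::
    "nat \<Rightarrow> real set \<Rightarrow> (nat \<Rightarrow> real \<Rightarrow> real) \<Rightarrow> bool" where
  "totally_real_number_field n K \<phi> \<longleftrightarrow>
     subfield K real_ring \<and> ring.dimension real_ring n \<rat> K \<and>
     (\<forall>f \<in> ring_hom (real_ring\<lparr>carrier := K\<rparr>) complex_ring. f ` K \<subseteq> \<real>) \<and>
     bij_betw \<phi> {1..n} (ring_hom (real_ring\<lparr>carrier := K\<rparr>) real_ring \<inter> extensional K) \<and>
     (\<forall>x\<in>K. \<phi> 1 x = x)"

definition extends_embedding ::
    "real set \<Rightarrow> real \<Rightarrow> real \<Rightarrow> (real \<Rightarrow> real) \<Rightarrow> (quat4 \<Rightarrow> mat2) \<Rightarrow> bool" where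
  "extends_embedding K a b f \<psi> \<longleftrightarrow>
     \<psi> \<in> ring_hom (quaternion_algebra K a b) M2R \<and>
     inj_on \<psi> (carrier (quaternion_algebra K a b)) \<and>
     (\<forall>c\<in>K. \<psi> (c, 0, 0, 0) = f c *\<^sub>R mat 1)"

definition norm_one_group ::
    "nat \<Rightarrow> real \<Rightarrow> real \<Rightarrow> (nat \<Rightarrow> quat4 \<Rightarrow> mat2) \<Rightarrow> quat4 set \<Rightarrow> (nat \<Rightarrow> mat2 set) set" where
  "norm_one_group r a b \<psi> \<O> =
     {to_PSL2R_pow r (\<lambda>i. \<psi> i \<epsilon>) | \<epsilon>. \<epsilon> \<in> \<O> \<and> reduced_norm a b \<epsilon> = 1}"

definition irreducible_arithmetic :: "nat \<Rightarrow> (nat \<Rightarrow> mat2 set) set \<Rightarrow> bool" where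
  "irreducible_arithmetic r \<Delta> \<longleftrightarrow>
     subgroup \<Delta> (PSL2R_pow r) \<and>
     (\<exists>n K \<phi> a b \<psi> \<O>.
        totally_real_number_field n K \<phi> \<and> r \<le> n \<and>
        a \<in> K - {0} \<and> b \<in> K - {0} \<and>
        (\<forall>i\<in>{1..r}. unramified_at a b (\<phi> i)) \<and>
        (\<forall>i\<in>{r+1..n}. ramified_at a b (\<phi> i)) \<and>
        (\<forall>i\<in>{1..r}. extends_embedding K a b (\<phi> i) (\<psi> i)) \<and>
        is_order K a b \<O> \<and>
        commensurable (PSL2R_pow r) \<Delta> (norm_one_group r a b \<psi> \<O>))"

definition same_trace_field ::
    "nat \<Rightarrow> nat \<Rightarrow> (nat \<Rightarrow> mat2 set) set \<Rightarrow> (nat \<Rightarrow> mat2 set) set \<Rightarrow> bool" where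
  "same_trace_field r i \<Gamma> \<Delta> \<longleftrightarrow>
     field_over_Q (Tr (proj_set i (squares_subgroup (PSL2R_pow r) \<Gamma>))) =
     field_over_Q (Tr (proj_set i (squares_subgroup (PSL2R_pow r) \<Delta>)))"

end

theory Submission
  imports Defs "Jordan_Normal_Form.Char_Poly"
begin

text \<open>
  Let \<open>K\<close> be the centre of the quaternion algebra \<open>A\<close>. Squares of elements of \<open>\<Delta>\<close> lift to elements of norm \<open>1\<close> of \<open>A\<close>,
  so the trace field of \<open>\<Gamma>\<^sup>(\<^sup>2\<^sup>)\<close> at the place \<open>i\<close> is the image under \<open>\<phi> i\<close> of a subfield \<open>L\<close> of \<open>K\<close>. For \<open>\<Delta>\<close> this subfield
  is \<open>K\<close>, because \<open>\<Delta>\<close> is commensurated by all of \<open>A\<close>.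

  If \<open>L \<noteq> K\<close>, some \<open>\<phi> j\<close> with \<open>j \<noteq> 1\<close> is the identity on \<open>L\<close>. It is not a ramified place, since traces of norm one
  elements are bounded by \<open>2\<close> there while \<open>\<Gamma>\<close> contains hyperbolic elements; hence \<open>tr(x\<^sub>1\<^sup>2)\<^sup>2 = tr(x\<^sub>j\<^sup>2)\<^sup>2\<close> on \<open>\<Gamma>\<close> and
  \<open>\<Gamma>\<close> is not dense.

  If \<open>\<Gamma>\<close> is not dense, its Zariski tangent space at the identity is a proper Lie subalgebra of \<open>sl(2,R)\<^sup>r\<close>. It projects onto
  every factor, because it contains the logarithms of the hyperbolic parts of elements without parabolic components. As
  \<open>sl(2,R)\<close> is simple, two components of \<open>\<Gamma>\<close> are related by an isomorphism up to sign, so \<open>\<phi> i = \<phi> j\<close> on \<open>L\<close> for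
  some \<open>i \<noteq> j\<close>, whence \<open>L \<noteq> K\<close>.
\<close>

text \<open>Membership in \<open>\<Delta>\<close> gives no element of \<open>A\<close> directly:
  only a power, up to a sign in each component, comes from \<open>\<O>\<close>. Conjugation by
  \<open>x\<close> in \<open>\<Delta>\<close> matches two elements of \<open>A\<close> with two
  others, and this yields \<open>G\<close> in \<open>A\<close> proportional to \<open>x\<close> at
  every place. The norm of \<open>G\<close> need not be 1, but \<open>G^2 / nrd G\<close> has norm 1
  and equals \<open>x^2\<close> without any sign; hence the squares. The commensuration by
  \<open>A\<close> is made explicit: a norm one element of \<open>A\<close> with integral trace has
  a power in \<open>\<O>\<close>, because the Chebyshev values in its powers become divisible by any
  given denominator. The Zariski closure is never treated as an algebraic group; its Lie algebra is
  read off from the vanishing ideal of the lifts. On powers \<open>g^n\<close> a polynomial is an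
  exponential sum, and this needs components with distinct eigenvalues, which the condition on mixed
  elements supplies. Elliptic components contribute 0 to the logarithm. All trace fields at the
  various places are images of one subfield of \<open>K\<close> under injective maps, so equality at
  one place is equality at all.\<close>

no_notation Matrix.vec_index (infixl "$" 100)
no_notation fps_nth (infixl "$" 75)
no_notation Polynomials.var ("X\<index>")
hide_const (open) Matrix.mat Determinant.det Matrix.vec Matrix.transpose_mat Matrix.row Matrix.col
  Polynomials.lead_coeff Polynomials.degree UnivPoly.coeff Ring_Hom.ring_hom
hide_type (open) Matrix.vec Matrix.mat

section \<open>Two-by-two matrices\<close>

lemma mat2_eq_iff:
  "(M::mat2) = N \<longleftrightarrow> M$1$1 = N$1$1 \<and> M$1$2 = N$1$2 \<and> M$2$1 = N$2$1 \<and> M$2$2 = N$2$2"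
  by (auto simp: Finite_Cartesian_Product.vec_eq_iff forall_2)

lemma mat2_mult_nth: "((A::mat2) ** B)$i$j = A$i$1 * B$1$j + A$i$2 * B$2$j"
  by (simp add: matrix_matrix_mult_def sum_2)

lemma mat2_one_nth [simp]: "(mat 1 :: mat2)$1$1 = 1" "(mat 1 :: mat2)$1$2 = 0" "(mat 1 :: mat2)$2$1 = 0" "(mat 1 :: mat2)$2$2 = 1"
  by (auto simp: Finite_Cartesian_Product.mat_def)

lemma trace2: "trace (M::mat2) = M$1$1 + M$2$2"
  by (simp add: trace_def sum_2)

definition mat2 :: "real \<Rightarrow> real \<Rightarrow> real \<Rightarrow> real \<Rightarrow> mat2" where
  "mat2 a b c d = vector [vector [a, b], vector [c, d]]"

lemma mat2_nth [simp]: "mat2 a b c d $1$1 = a" "mat2 a b c d $1$2 = b" "mat2 a b c d $2$1 = c" "mat2 a b c d $2$2 = d"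
  by (auto simp: mat2_def)

text \<open>The adjugate in its Cayley-Hamilton form, hence the inverse on determinant 1; it is
  linear in the entries.\<close>

definition adj2 :: "mat2 \<Rightarrow> mat2" where
  "adj2 M = trace M *\<^sub>R mat 1 - M"

lemmas mat2_simps = mat2_eq_iff mat2_mult_nth mat2_one_nth trace2 det_2 adj2_def

lemma adj2_mult [simp]: "M ** adj2 M = det M *\<^sub>R mat 1" "adj2 M ** M = det M *\<^sub>R mat 1"
  by (auto simp: mat2_simps algebra_simps)

lemma det2_mult: "det ((A::mat2) ** B) = det A * det B"
  by (rule det_mul)

lemma det2_adj2 [simp]: "det (adj2 M) = det M"
  by (simp add: mat2_simps algebra_simps)

lemma trace2_adj2 [simp]: "trace (adj2 M) = trace M"
  by (simp add: mat2_simps)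

lemma trace2_uminus [simp]: "trace (- (M::mat2)) = - trace M"
  by (simp add: mat2_simps)

lemma mat2_mult_uminus [simp]: "(- A) ** (B::mat2) = - (A ** B)" "(A::mat2) ** (- B) = - (A ** B)"
  by (auto simp: mat2_simps)

lemma mat2_mult_assoc: "(A::mat2) ** B ** C = A ** (B ** C)"
  by (simp add: matrix_mul_assoc)

lemma mat2_mult_scaleR [simp]: "(c *\<^sub>R A) ** (B::mat2) = c *\<^sub>R (A ** B)" "(A::mat2) ** (c *\<^sub>R B) = c *\<^sub>R (A ** B)"
  by (auto simp: mat2_simps algebra_simps)

lemma mat2_mult_distrib: "((A::mat2) + B) ** C = A ** C + B ** C" "(A::mat2) ** (B + C) = A ** B + A ** C"
  "((A::mat2) - B) ** C = A ** C - B ** C" "(A::mat2) ** (B - C) = A ** B - A ** C"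
  by (auto simp: mat2_simps algebra_simps)

lemma trace2_add [simp]: "trace ((A::mat2) + B) = trace A + trace B" "trace ((A::mat2) - B) = trace A - trace B" "trace (c *\<^sub>R (A::mat2)) = c * trace A" "trace (mat 1 :: mat2) = 2" "trace (0::mat2) = 0"
  by (auto simp: mat2_simps algebra_simps)

lemma mat2_mult_0 [simp]: "(A::mat2) ** 0 = 0"
  by (auto simp: mat2_simps)

lemma mat2_mult_sum: "(A::mat2) ** sum f S = (\<Sum>i\<in>S. A ** f i)"
  by (induction S rule: infinite_finite_induct) (auto simp: matrix_add_ldistrib)

lemma trace2_mult_commute: "trace ((A::mat2) ** B) = trace (B ** A)"
  by (simp add: mat2_simps algebra_simps)

lemma det2_scaleR [simp]: "det (c *\<^sub>R (A::mat2)) = c\<^sup>2 * det A"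
  by (simp add: mat2_simps algebra_simps power2_eq_square)

primrec mpow :: "mat2 \<Rightarrow> nat \<Rightarrow> mat2" where
  "mpow M 0 = mat 1"
| "mpow M (Suc n) = mpow M n ** M"

lemma det_mpow: "det M = 1 \<Longrightarrow> det (mpow M n) = 1"
  by (induction n) (auto simp: det2_mult)

lemma mpow_add: "mpow M (m + n) = mpow M m ** mpow M n"
  by (induction n) (auto simp: mat2_mult_assoc)

lemma mpow_mult: "mpow M (m * n) = mpow (mpow M m) n"
proof (induction n)
  case (Suc n)
  have "m * Suc n = m * n + m" by simp
  then show ?case using Suc by (simp only: mpow_add mpow.simps)
qed simp

lemma mpow_uminus: "mpow (- M) n = mpow M n \<or> mpow (- M) n = - mpow M n"
  by (induction n) auto

lemma mpow_conj: "Y ** M = N ** Y \<Longrightarrow> Y ** mpow M n = mpow N n ** Y"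
proof (induction n)
  case (Suc n)
  have "Y ** mpow M (Suc n) = (Y ** mpow M n) ** M" by (simp add: matrix_mul_assoc)
  also have "\<dots> = mpow N n ** (Y ** M)" by (simp only: Suc.IH[OF Suc.prems] matrix_mul_assoc)
  also have "\<dots> = mpow N (Suc n) ** Y" by (simp add: Suc.prems matrix_mul_assoc)
  finally show ?case .
qed simp

section \<open>Lifting from PSL(2,R) to SL(2,R)\<close>

lemma SL2R_simps [simp]: "carrier SL2R = {M. det M = 1}" "M \<otimes>\<^bsub>SL2R\<^esub> N = M ** N" "\<one>\<^bsub>SL2R\<^esub> = mat 1"
  by (auto simp: SL2R_def)

lemma group_SL2R: "group SL2R"
proof (rule groupI)
  fix x assume "x \<in> carrier SL2R"
  then show "\<exists>y\<in>carrier SL2R. y \<otimes>\<^bsub>SL2R\<^esub> x = \<one>\<^bsub>SL2R\<^esub>"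
    by (intro bexI[of _ "adj2 x"]) auto
qed (auto simp: det2_mult matrix_mul_assoc)

lemma inv_SL2R: "det M = 1 \<Longrightarrow> inv\<^bsub>SL2R\<^esub> M = adj2 M"
  by (rule group.inv_equality[OF group_SL2R]) auto

definition cls :: "mat2 \<Rightarrow> mat2 set" where
  "cls M = {M, - M}"

lemma cls_eq_iff: "cls M = cls N \<longleftrightarrow> M = N \<or> M = - N"
  by (auto simp: cls_def doubleton_eq_iff)

lemma pm_one_coset: "pm_one #>\<^bsub>SL2R\<^esub> M = cls M"
  by (auto simp: r_coset_def pm_one_def cls_def)

lemma normal_pm_one: "pm_one \<lhd> SL2R"
proof -
  have "subgroup pm_one SL2R"
    by (rule group.subgroupI[OF group_SL2R]) (auto simp: pm_one_def inv_SL2R mat2_simps)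
  then show ?thesis
    unfolding group.normal_inv_iff[OF group_SL2R]
    by (auto simp: pm_one_def inv_SL2R)
qed

lemma group_PSL2R: "group PSL2R"
  unfolding PSL2R_def by (rule normal.factorgroup_is_group[OF normal_pm_one])

lemma carrier_PSL2R: "carrier PSL2R = cls ` {M. det M = 1}"
  by (auto simp: PSL2R_def carrier_FactGroup pm_one_coset)

lemma cls_mult [simp]: "cls M \<otimes>\<^bsub>PSL2R\<^esub> cls N = cls (M ** N)"
  by (auto simp: PSL2R_def set_mult_def cls_def)

lemma one_PSL2R: "\<one>\<^bsub>PSL2R\<^esub> = cls (mat 1)"
  by (auto simp: PSL2R_def FactGroup_def pm_one_def cls_def)

lemma the_elem_const: "(\<And>x. x \<in> S \<Longrightarrow> f x = c) \<Longrightarrow> S \<noteq> {} \<Longrightarrow> the_elem (f ` S) = c"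
proof -
  assume "\<And>x. x \<in> S \<Longrightarrow> f x = c" "S \<noteq> {}"
  then have "f ` S = {c}" by auto
  then show ?thesis by simp
qed

lemma tr_abs_cls: "tr_abs (cls M) = \<bar>trace M\<bar>"
  unfolding tr_abs_def by (rule the_elem_const) (auto simp: cls_def)

lemma moebius_uminus: "moebius (- M) z = moebius M z"
proof (cases z)
  case (Some w)
  have 1: "of_real ((- M)$2$1) * w + of_real ((- M)$2$2) = - (of_real (M$2$1) * w + of_real (M$2$2))" by simp
  have 2: "of_real ((- M)$1$1) * w + of_real ((- M)$1$2) = - (of_real (M$1$1) * w + of_real (M$1$2))" by simp
  show ?thesis unfolding Some moebius.simps 1 2 by (simp only: neg_equal_0_iff_equal minus_divide_divide)
qed simp

lemma act_cls: "act (cls M) z = moebius M z"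
  unfolding act_def by (rule the_elem_const) (auto simp: cls_def moebius_uminus)

text \<open>No condition outside \<open>{1..r}\<close>, so that pointwise matrix operations need no
  restriction; extensionality returns only with \<open>SL2R_pow\<close> in the treatment of Zariski
  closed sets.\<close>

definition SLr :: "nat \<Rightarrow> (nat \<Rightarrow> mat2) set" where
  "SLr r = {x. \<forall>i\<in>{1..r}. det (x i) = 1}"

abbreviation pcls :: "nat \<Rightarrow> (nat \<Rightarrow> mat2) \<Rightarrow> (nat \<Rightarrow> mat2 set)" where
  "pcls \<equiv> to_PSL2R_pow"

lemma pcls_def: "pcls r x = (\<lambda>i\<in>{1..r}. cls (x i))"
  by (simp add: to_PSL2R_pow_def pm_one_coset)

lemma pcls_nth [simp]: "i \<in> {1..r} \<Longrightarrow> pcls r x i = cls (x i)"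
  by (simp add: pcls_def)

lemma pcls_eq_iff: "pcls r x = pcls r y \<longleftrightarrow> (\<forall>i\<in>{1..r}. x i = y i \<or> x i = - y i)"
  unfolding pcls_def restrict_def fun_eq_iff using cls_eq_iff by (metis (full_types))

lemma group_PSL2R_pow: "group (PSL2R_pow r)"
  unfolding PSL2R_pow_def using group_PSL2R by simp

lemma carrier_PSL2R_pow: "carrier (PSL2R_pow r) = pcls r ` SLr r"
proof
  show "pcls r ` SLr r \<subseteq> carrier (PSL2R_pow r)"
    by (auto simp: PSL2R_pow_def SLr_def pcls_def carrier_PSL2R)
  show "carrier (PSL2R_pow r) \<subseteq> pcls r ` SLr r"
  proof
    fix g assume g: "g \<in> carrier (PSL2R_pow r)"
    then have "\<forall>i\<in>{1..r}. \<exists>M. det M = 1 \<and> g i = cls M"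
      by (auto simp: PSL2R_pow_def carrier_PSL2R PiE_def Pi_def image_iff)
    then obtain x where x: "\<And>i. i \<in> {1..r} \<Longrightarrow> det (x i) = 1 \<and> g i = cls (x i)" by metis
    have "g \<in> extensional {1..r}" using g by (auto simp: PSL2R_pow_def PiE_def)
    then have "g = pcls r x" using x by (intro extensionalityI[of _ "{1..r}"]) (auto simp: pcls_def)
    then show "g \<in> pcls r ` SLr r" using x by (auto simp: SLr_def)
  qed
qed

lemma pcls_mult: "pcls r x \<otimes>\<^bsub>PSL2R_pow r\<^esub> pcls r y = pcls r (\<lambda>i. x i ** y i)"
  unfolding PSL2R_pow_def pcls_def mult_product_group by (rule restrict_ext) simp

lemma one_PSL2R_pow: "\<one>\<^bsub>PSL2R_pow r\<^esub> = pcls r (\<lambda>_. mat 1)"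
  by (auto simp: PSL2R_pow_def pcls_def one_PSL2R)

lemma inv_PSL2R_pow: "x \<in> SLr r \<Longrightarrow> inv\<^bsub>PSL2R_pow r\<^esub> (pcls r x) = pcls r (\<lambda>i. adj2 (x i))"
proof (rule group.inv_equality[OF group_PSL2R_pow])
  assume x: "x \<in> SLr r"
  show "pcls r (\<lambda>i. adj2 (x i)) \<otimes>\<^bsub>PSL2R_pow r\<^esub> pcls r x = \<one>\<^bsub>PSL2R_pow r\<^esub>"
    unfolding pcls_mult one_PSL2R_pow pcls_eq_iff using x by (auto simp: SLr_def)
qed (auto simp: carrier_PSL2R_pow SLr_def)

lemma pow_PSL2R_pow: "pcls r x [^]\<^bsub>PSL2R_pow r\<^esub> (n::nat) = pcls r (\<lambda>i. mpow (x i) n)"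
proof -
  interpret group "PSL2R_pow r" by (rule group_PSL2R_pow)
  show ?thesis
    by (induction n) (auto simp: one_PSL2R_pow pcls_mult)
qed

text \<open>The full preimage: the sign of each component may be chosen independently.\<close>

definition lifts :: "nat \<Rightarrow> (nat \<Rightarrow> mat2 set) set \<Rightarrow> (nat \<Rightarrow> mat2) set" where
  "lifts r H = {x \<in> SLr r. pcls r x \<in> H}"

lemma subgroup_eq_lifts: "H \<subseteq> carrier (PSL2R_pow r) \<Longrightarrow> H = pcls r ` lifts r H"
  unfolding lifts_def carrier_PSL2R_pow by blast

lemma lifts_mult:
  assumes "subgroup H (PSL2R_pow r)" "x \<in> lifts r H" "y \<in> lifts r H"
  shows "(\<lambda>i. x i ** y i) \<in> lifts r H"
  using assms subgroup.m_closed[OF assms(1), of "pcls r x" "pcls r y"]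
  by (auto simp: lifts_def SLr_def det2_mult pcls_mult)

lemma lifts_one:
  assumes "subgroup H (PSL2R_pow r)" shows "(\<lambda>i. mat 1) \<in> lifts r H"
  using subgroup.one_closed[OF assms] by (auto simp: lifts_def SLr_def one_PSL2R_pow)

lemma lifts_adj2:
  assumes "subgroup H (PSL2R_pow r)" "x \<in> lifts r H"
  shows "(\<lambda>i. adj2 (x i)) \<in> lifts r H"
  using assms subgroup.m_inv_closed[OF assms(1), of "pcls r x"]
  by (auto simp: lifts_def SLr_def inv_PSL2R_pow)

lemma lifts_mpow:
  assumes "subgroup H (PSL2R_pow r)" "x \<in> lifts r H"
  shows "(\<lambda>i. mpow (x i) n) \<in> lifts r H"
  by (induction n) (auto intro: lifts_one lifts_mult assms)

text \<open>Cosets of \<open>H \<inter> H'\<close> by the powers of an element of \<open>H\<close> repeat, since there are finitely many.\<close>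

lemma (in group) power_in_finite_index:
  fixes g :: 'a
  assumes H: "H \<subseteq> carrier G" "\<one> \<in> H" "\<And>x y. x \<in> H \<Longrightarrow> y \<in> H \<Longrightarrow> x \<otimes> y \<in> H" and H': "\<one> \<in> H'"
    and fin: "finite (rcosets\<^bsub>G\<lparr>carrier := H\<rparr>\<^esub> (H \<inter> H'))" and g: "g \<in> H"
  obtains k where "k > 0" "g [^] (k::nat) \<in> H'"
proof -
  let ?C = "\<lambda>k::nat. (H \<inter> H') #> (g [^] k)"
  have gk: "g [^] k \<in> H" for k :: nat
    by (induction k) (use g H in auto)
  have gc: "g [^] k \<in> carrier G" for k :: nat using gk H(1) by blast
  have "range ?C \<subseteq> rcosets\<^bsub>G\<lparr>carrier := H\<rparr>\<^esub> (H \<inter> H')"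
    using gk by (auto simp: RCOSETS_def r_coset_def)
  then have "finite (range ?C)" using fin finite_subset by blast
  then have "\<not> inj ?C" using finite_imageD infinite_UNIV_nat by blast
  then obtain k l where kl: "k < l" "?C k = ?C l" unfolding inj_def by (metis nat_neq_iff)
  have "\<one> \<in> H \<inter> H'" using H H' by blast
  then have "\<one> \<otimes> g [^] l \<in> ?C l" unfolding r_coset_def by blast
  then have "g [^] l \<in> ?C l" using gc by simp
  then obtain d where d: "d \<in> H \<inter> H'" "g [^] l = d \<otimes> g [^] k"
    unfolding kl(2)[symmetric] by (auto simp: r_coset_def)
  have dc: "d \<in> carrier G" using d(1) H(1) by blast
  have "g \<in> carrier G" using g H(1) by blast
  then have "g [^] (l - k) \<otimes> g [^] k = g [^] l"
    using kl(1) by (simp add: nat_pow_mult)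
  then have "g [^] (l - k) = d" using d(2) gc dc by simp
  then show ?thesis using that[of "l - k"] kl(1) d(1) by auto
qed

section \<open>Algebraic integers\<close>

text \<open>\<open>x\<close> is a root of the characteristic polynomial of an integer matrix, which
  is monic.\<close>

lemma algebraic_int_if_integer_eigenvalue:
  fixes x :: real and w :: "nat \<Rightarrow> real" and N :: "nat \<Rightarrow> nat \<Rightarrow> int"
  assumes eq: "\<And>i. i < n \<Longrightarrow> x * w i = (\<Sum>j<n. of_int (N i j) * w j)"
    and nz: "k < n" "w k \<noteq> 0"
  shows "algebraic_int x"
proof -
  define A where "A = Matrix.mat n n (\<lambda>(i,j). N i j)"
  define v where "v = Matrix.vec n w"
  have Ac: "A \<in> carrier_mat n n" by (simp add: A_def)
  let ?B = "map_mat real_of_int A"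
  have Bc: "?B \<in> carrier_mat n n" using Ac by simp
  have vk: "v \<noteq> 0\<^sub>v n"
  proof
    assume "v = 0\<^sub>v n"
    then have "vec_index v k = vec_index (0\<^sub>v n) k" by simp
    with nz show False by (simp add: v_def)
  qed
  have "?B *\<^sub>v v = x \<cdot>\<^sub>v v"
  proof (rule eq_vecI)
    fix i assume "i < dim_vec (x \<cdot>\<^sub>v v)"
    then have i: "i < n" by (simp add: v_def)
    show "vec_index (?B *\<^sub>v v) i = vec_index (x \<cdot>\<^sub>v v) i"
      using i eq[OF i] by (simp add: A_def v_def scalar_prod_def lessThan_atLeast0)
  qed (simp add: A_def v_def)
  then have "eigenvector ?B v x"
    using vk by (auto simp: eigenvector_def v_def A_def)
  then have "eigenvalue ?B x" by (auto simp: eigenvalue_def)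
  then have "poly (char_poly ?B) x = 0" using eigenvalue_root_char_poly[OF Bc] by simp
  then have "poly (map_poly of_int (char_poly A)) x = 0"
    using of_int_hom.char_poly_hom[OF Ac, where ?'a = real] by simp
  moreover have "lead_coeff (char_poly A) = 1" using degree_monic_char_poly[OF Ac] by simp
  ultimately show ?thesis unfolding algebraic_int_altdef_ipoly by blast
qed

definition zspan :: "real set \<Rightarrow> real set" where
  "zspan W = {(\<Sum>w\<in>W. of_int (c w) * w) | c. True}"

lemma zspanI: "x = (\<Sum>w\<in>W. of_int (c w) * w) \<Longrightarrow> x \<in> zspan W"
  unfolding zspan_def by blast

lemma zspan_add: "x \<in> zspan W \<Longrightarrow> y \<in> zspan W \<Longrightarrow> x + y \<in> zspan W"
proof -
  assume "x \<in> zspan W" "y \<in> zspan W"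
  then obtain c d where "x = (\<Sum>w\<in>W. of_int (c w) * w)" "y = (\<Sum>w\<in>W. of_int (d w) * w)"
    by (auto simp: zspan_def)
  then have "x + y = (\<Sum>w\<in>W. of_int (c w + d w) * w)"
    by (simp add: sum.distrib distrib_right)
  then show ?thesis by (rule zspanI)
qed

lemma zspan_int_mult: "x \<in> zspan W \<Longrightarrow> of_int n * x \<in> zspan W"
proof -
  assume "x \<in> zspan W"
  then obtain c where "x = (\<Sum>w\<in>W. of_int (c w) * w)" by (auto simp: zspan_def)
  then have "of_int n * x = (\<Sum>w\<in>W. of_int (n * c w) * w)"
    by (simp add: sum_distrib_left mult.assoc)
  then show ?thesis by (rule zspanI)
qed

lemma zspan_zero: "0 \<in> zspan W"
  by (auto simp: zspan_def intro!: exI[of _ "\<lambda>_. 0"])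

lemma zspan_minus: "x \<in> zspan W \<Longrightarrow> - x \<in> zspan W"
  using zspan_int_mult[of x W "-1"] by simp

lemma zspan_diff: "x \<in> zspan W \<Longrightarrow> y \<in> zspan W \<Longrightarrow> x - y \<in> zspan W"
  using zspan_add[of x W "-y"] zspan_minus by simp

lemma zspan_sum: "(\<And>i. i \<in> I \<Longrightarrow> f i \<in> zspan W) \<Longrightarrow> sum f I \<in> zspan W"
  by (induction I rule: infinite_finite_induct) (auto simp: zspan_zero intro: zspan_add)

lemma zspan_incl: "finite W \<Longrightarrow> w \<in> W \<Longrightarrow> w \<in> zspan W"
proof -
  assume W: "finite W" "w \<in> W"
  have "(\<Sum>v\<in>W. of_int (if v = w then 1 else 0) * v) = (\<Sum>v\<in>W. if v = w then v else 0)"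
    by (rule sum.cong) auto
  also have "\<dots> = w" using W by simp
  finally show ?thesis using zspanI by metis
qed

lemma zspan_mult:
  assumes "\<And>w. w \<in> W \<Longrightarrow> x * w \<in> zspan V" and "y \<in> zspan W"
  shows "x * y \<in> zspan V"
proof -
  obtain c where c: "y = (\<Sum>w\<in>W. of_int (c w) * w)" using assms(2) by (auto simp: zspan_def)
  have "x * y = (\<Sum>w\<in>W. of_int (c w) * (x * w))" unfolding c by (simp add: sum_distrib_left algebra_simps)
  also have "\<dots> \<in> zspan V" by (intro zspan_sum zspan_int_mult assms)
  finally show ?thesis .
qed

text \<open>The determinant trick: the elements of \<open>W\<close>, listed as a vector, form an
  eigenvector of an integer matrix with eigenvalue \<open>x\<close>.\<close>

lemma algebraic_int_if_zspan_stable: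
  assumes W: "finite W" "w0 \<in> W" "w0 \<noteq> 0" and st: "\<And>w. w \<in> W \<Longrightarrow> x * w \<in> zspan W"
  shows "algebraic_int x"
proof -
  obtain h where h: "bij_betw h {0..<card W} W" using ex_bij_betw_nat_finite[OF W(1)] by blast
  have "\<forall>w\<in>W. \<exists>c. x * w = (\<Sum>v\<in>W. of_int (c v) * v)" using st by (fastforce simp: zspan_def)
  then obtain c where c: "\<And>w. w \<in> W \<Longrightarrow> x * w = (\<Sum>v\<in>W. of_int (c w v) * v)" by metis
  obtain k where k: "k < card W" "h k = w0" using h W(2) by (auto simp: bij_betw_def image_iff) (metis W(2) atLeastLessThan_iff imageE)
  show ?thesis
  proof (rule algebraic_int_if_integer_eigenvalue[where n = "card W" and w = h and N = "\<lambda>i j. c (h i) (h j)"])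
    fix i assume "i < card W"
    then have "h i \<in> W" using h by (auto simp: bij_betw_def)
    from c[OF this] show "x * h i = (\<Sum>j<card W. of_int (c (h i) (h j)) * h j)"
      using sum.reindex_bij_betw[OF h, of "\<lambda>v. of_int (c (h i) v) * v"] by (simp add: lessThan_atLeast0)
  qed (use k W in auto)
qed

lemma algebraic_int_power_relation:
  fixes c :: real
  assumes "algebraic_int c"
  obtains p and a :: "nat \<Rightarrow> int" where "p > 0" "c ^ p = (\<Sum>i<p. of_int (a i) * c ^ i)"
proof -
  obtain q where q: "poly (map_poly of_int q) c = 0" "lead_coeff q = 1"
    using assms unfolding algebraic_int_altdef_ipoly by blast
  let ?p = "degree q"
  have 1: "(\<Sum>i\<le>?p. of_int (coeff q i) * c ^ i) = 0"
    using q(1) by (simp add: poly_altdef)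
  have 2: "(\<Sum>i\<le>?p. of_int (coeff q i) * c ^ i) = (\<Sum>i<?p. of_int (coeff q i) * c ^ i) + c ^ ?p"
    unfolding lessThan_Suc_atMost[symmetric] sum.lessThan_Suc using q(2) by simp
  have "?p > 0"
  proof (rule ccontr)
    assume "\<not> ?p > 0"
    then have "?p = 0" by simp
    with 1 2 show False by simp
  qed
  moreover have "c ^ ?p = (\<Sum>i<?p. of_int (- coeff q i) * c ^ i)"
    using 1 2 by (simp add: sum_negf)
  ultimately show ?thesis by (rule that)
qed

text \<open>The powers of \<open>c\<close> below the degree of a monic relation span a module stable
  under \<open>c\<close>. The factor \<open>w\<close> allows them to be combined with generators of
  another module, as in \<open>common_zspan\<close>.\<close>

lemma algebraic_int_power_basis:
  fixes c :: real
  assumes "algebraic_int c"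
  obtains p where "p > 0"
    "\<And>i w. i < p \<Longrightarrow> c * (c ^ i * w) \<in> zspan ((\<lambda>i. c ^ i * w) ` {..<p})"
proof -
  obtain p and a :: "nat \<Rightarrow> int" where p: "p > 0" "c ^ p = (\<Sum>i<p. of_int (a i) * c ^ i)"
    using algebraic_int_power_relation[OF assms] .
  show ?thesis
  proof (rule that[OF p(1)])
    fix i w assume i: "i < p"
    let ?W = "(\<lambda>i. c ^ i * w) ` {..<p}"
    show "c * (c ^ i * w) \<in> zspan ?W"
    proof (cases "Suc i < p")
      case True
      then have "c ^ Suc i * w \<in> ?W" by blast
      then have "c ^ Suc i * w \<in> zspan ?W" by (intro zspan_incl) auto
      then show ?thesis by (simp add: mult.assoc)
    next
      case False
      then have "p = Suc i" using i by simp
      then have "c * (c ^ i * w) = c ^ p * w" by simp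
      also have "\<dots> = (\<Sum>i<p. of_int (a i) * (c ^ i * w))"
        by (simp add: p(2) sum_distrib_right mult.assoc)
      also have "\<dots> \<in> zspan ?W" by (intro zspan_sum zspan_int_mult zspan_incl) auto
      finally show ?thesis .
    qed
  qed
qed

lemma zspan_mono: "finite V \<Longrightarrow> W \<subseteq> V \<Longrightarrow> x \<in> zspan W \<Longrightarrow> x \<in> zspan V"
  using zspan_mult[of W 1 V x] by (auto intro: zspan_incl)

text \<open>Adjoining \<open>c\<close> replaces \<open>W\<close> by the products
  \<open>c^i * w\<close> with \<open>i\<close> below the degree of a monic relation for
  \<open>c\<close>; stability under the earlier elements is inherited.\<close>

lemma common_zspan:
  fixes C :: "real set"
  assumes "finite C" "\<And>c. c \<in> C \<Longrightarrow> algebraic_int c"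
  shows "\<exists>W. finite W \<and> 1 \<in> W \<and> (\<forall>c\<in>C. \<forall>w\<in>W. c * w \<in> zspan W)"
  using assms
proof (induction C)
  case empty
  show ?case by (intro exI[of _ "{1}"]) auto
next
  case (insert c C)
  then obtain W where W: "finite W" "1 \<in> W" "\<And>d w. d \<in> C \<Longrightarrow> w \<in> W \<Longrightarrow> d * w \<in> zspan W" by blast
  have "algebraic_int c" using insert.prems by simp
  then obtain p where p: "p > 0"
    "\<And>i w. i < p \<Longrightarrow> c * (c ^ i * w) \<in> zspan ((\<lambda>i. c ^ i * w) ` {..<p})"
    using algebraic_int_power_basis by blast
  let ?V = "(\<lambda>(i, w). c ^ i * w) ` ({..<p} \<times> W)"
  have fin: "finite ?V" using W(1) by simp
  have "(\<lambda>(i, w). c ^ i * w) (0, 1) \<in> ?V" by (intro imageI) (use p(1) W(2) in auto)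
  then have 1: "1 \<in> ?V" by simp
  have 2: "c * w \<in> zspan ?V" if w: "w \<in> ?V" for w
  proof -
    obtain i v where iv: "i < p" "v \<in> W" "w = c ^ i * v" using w by auto
    show ?thesis unfolding iv(3)
      by (rule zspan_mono[OF fin _ p(2)[OF iv(1)]]) (use iv in force)
  qed
  have 3: "d * w \<in> zspan ?V" if w: "w \<in> ?V" "d \<in> C" for w d
  proof -
    obtain i v where iv: "i < p" "v \<in> W" "w = c ^ i * v" using w(1) by auto
    have "c ^ i * (d * v) \<in> zspan ?V"
    proof (rule zspan_mult[OF _ W(3)[OF w(2) iv(2)]])
      fix u assume "u \<in> W"
      then have "c ^ i * u \<in> ?V" using iv(1) by force
      then show "c ^ i * u \<in> zspan ?V" by (rule zspan_incl[OF fin])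
    qed
    then show ?thesis by (simp add: iv(3) algebra_simps)
  qed
  show ?case using fin 1 2 3 by (intro exI[of _ ?V]) blast
qed

lemma algebraic_int_add_mult:
  fixes x y :: real
  assumes "algebraic_int x" "algebraic_int y"
  shows "algebraic_int (x + y)" "algebraic_int (x * y)"
proof -
  obtain W where W: "finite W" "1 \<in> W" "\<And>c w. c \<in> {x,y} \<Longrightarrow> w \<in> W \<Longrightarrow> c * w \<in> zspan W"
    using common_zspan[of "{x,y}"] assms by blast
  have Wx: "x * w \<in> zspan W" if "w \<in> W" for w by (rule W(3)[OF _ that]) simp
  have Wy: "y * w \<in> zspan W" if "w \<in> W" for w by (rule W(3)[OF _ that]) simp
  show "algebraic_int (x + y)"
  proof (rule algebraic_int_if_zspan_stable[OF W(1,2)])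
    fix w assume "w \<in> W"
    then have "x * w + y * w \<in> zspan W" by (intro zspan_add Wx Wy)
    then show "(x + y) * w \<in> zspan W" by (simp add: distrib_right)
  qed simp
  show "algebraic_int (x * y)"
  proof (rule algebraic_int_if_zspan_stable[OF W(1,2)])
    fix w assume "w \<in> W"
    then have "y * w \<in> zspan W" by (rule Wy)
    from zspan_mult[OF Wx this] show "x * y * w \<in> zspan W" by (simp add: mult.assoc)
  qed simp
qed

lemma algebraic_int_diff:
  fixes x y :: real
  assumes "algebraic_int x" "algebraic_int y"
  shows "algebraic_int (x - y)"
  using algebraic_int_add_mult(1)[OF assms(1), of "-y"] assms by simp

lemma algebraic_int_sum:
  fixes f :: "'a \<Rightarrow> real"
  shows "(\<And>i. i \<in> I \<Longrightarrow> algebraic_int (f i)) \<Longrightarrow> algebraic_int (sum f I)"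
  by (induction I rule: infinite_finite_induct) (auto intro: algebraic_int_add_mult)

lemma algebraic_int_power:
  fixes x :: real
  shows "algebraic_int x \<Longrightarrow> algebraic_int (x ^ n)"
  by (induction n) (auto intro: algebraic_int_add_mult)

text \<open>Transitivity of integrality: if \<open>W\<close> generates a module stable under all
  coefficients, the products of its elements with the coordinates of the eigenvector generate one
  stable under \<open>l\<close>.\<close>

lemma algebraic_int_if_eigenvalue:
  fixes l :: real and v :: "'a \<Rightarrow> real"
  assumes I: "finite I" and k: "k \<in> I" "v k \<noteq> 0"
    and eq: "\<And>i. i \<in> I \<Longrightarrow> l * v i = (\<Sum>j\<in>I. c i j * v j)"
    and c: "\<And>i j. i \<in> I \<Longrightarrow> j \<in> I \<Longrightarrow> algebraic_int (c i j)"
  shows "algebraic_int l"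
proof -
  obtain W where W: "finite W" "1 \<in> W"
    and cW: "\<And>d w. d \<in> (\<lambda>(i,j). c i j) ` (I \<times> I) \<Longrightarrow> w \<in> W \<Longrightarrow> d * w \<in> zspan W"
  proof -
    have "finite ((\<lambda>(i,j). c i j) ` (I \<times> I))" "\<And>d. d \<in> (\<lambda>(i,j). c i j) ` (I \<times> I) \<Longrightarrow> algebraic_int d"
      using I c by auto
    from common_zspan[OF this] that show ?thesis by blast
  qed
  let ?V = "(\<lambda>(w, i). w * v i) ` (W \<times> I)"
  have fin: "finite ?V" using I W by simp
  have "(\<lambda>(w, i). w * v i) (1, k) \<in> ?V" by (intro imageI) (use k W in auto)
  then have k': "v k \<in> ?V" by simp
  show ?thesis
  proof (rule algebraic_int_if_zspan_stable[OF fin k' k(2)])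
    fix x assume "x \<in> ?V"
    then obtain w i where wi: "w \<in> W" "i \<in> I" "x = w * v i" by auto
    have "l * x = w * (l * v i)" by (simp add: wi)
    also have "\<dots> = (\<Sum>j\<in>I. v j * (c i j * w))" by (simp add: eq[OF wi(2)] sum_distrib_left algebra_simps)
    also have "\<dots> \<in> zspan ?V"
    proof (rule zspan_sum)
      fix j assume j: "j \<in> I"
      show "v j * (c i j * w) \<in> zspan ?V"
      proof (rule zspan_mult)
        show "c i j * w \<in> zspan W" using cW wi j by auto
        fix u assume "u \<in> W"
        then have "u * v j \<in> ?V" using j by force
        then show "v j * u \<in> zspan ?V" using zspan_incl[OF fin] by (simp add: mult.commute)
      qed
    qed
    finally show "l * x \<in> zspan ?V" .
  qed
qed

text \<open>Chebyshev polynomials of the second kind, shifted by one: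
  \<open>(l^k - l^(-k)) / (l - 1/l)\<close> for \<open>t = l + 1/l\<close>. They are the
  coefficients of \<open>M\<close> in \<open>M^k\<close> when \<open>M\<close> has determinant 1 and
  trace \<open>t\<close>.\<close>

fun cheb :: "real \<Rightarrow> nat \<Rightarrow> real" where
  "cheb t 0 = 0"
| "cheb t (Suc 0) = 1"
| "cheb t (Suc (Suc k)) = t * cheb t (Suc k) - cheb t k"

text \<open>Modulo \<open>m\<close> the recursion for \<open>cheb t\<close> runs in a finite group and can be reversed, so the sequence is
  periodic and returns to its initial value \<open>0\<close>.\<close>

lemma cheb_divisible:
  assumes t: "algebraic_int t" and m: "m > 0"
  obtains k where "k > 0" "algebraic_int (cheb t k / real m)"
proof -
  obtain p where p: "p > 0" "\<And>i w. i < p \<Longrightarrow> t * (t ^ i * w) \<in> zspan ((\<lambda>i. t ^ i * w) ` {..<p})"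
    using algebraic_int_power_basis[OF t] by blast
  define W where "W = (\<lambda>i. t ^ i) ` {..<p}"
  have fin: "finite W" by (simp add: W_def)
  have 1: "1 \<in> W" using p(1) unfolding W_def by force
  have tW: "t * y \<in> zspan W" if "y \<in> zspan W" for y
    using zspan_mult[OF _ that, of t W] p(2)[where w=1] by (auto simp: W_def)
  have alg: "algebraic_int y" if "y \<in> zspan W" for y
    using that unfolding zspan_def W_def
    by (auto intro!: algebraic_int_sum algebraic_int_add_mult algebraic_int_power t)
  have chW: "cheb t k \<in> zspan W" for k
    by (induction k rule: induct_nat_012) (auto intro: zspan_zero zspan_incl fin 1 zspan_diff tW)
  then have "\<forall>k. \<exists>c. cheb t k = (\<Sum>w\<in>W. of_int (c w) * w)" by (auto simp: zspan_def)
  then obtain c where c: "\<And>k. cheb t k = (\<Sum>w\<in>W. of_int (c k w) * w)" by metis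
  \<comment> \<open>Coefficients of two consecutive terms modulo \<open>m\<close>: the state of the
    recursion, with finitely many values.\<close>
  define f where "f k = restrict (\<lambda>w. (c k w mod int m, c (Suc k) w mod int m)) W" for k
  define mR where "mR = (\<lambda>y. of_nat m * y) ` zspan W"
  have mR_diff: "x - y \<in> mR" if "x \<in> mR" "y \<in> mR" for x y
    using that zspan_diff unfolding mR_def by (auto simp flip: right_diff_distrib)
  have mR_t: "t * x \<in> mR" if x: "x \<in> mR" for x
  proof -
    obtain y where "y \<in> zspan W" "x = of_nat m * y" using x by (auto simp: mR_def)
    then show ?thesis unfolding mR_def by (intro image_eqI[of _ _ "t * y"]) (auto intro: tW)
  qed
  have "range f \<subseteq> (\<Pi>\<^sub>E w\<in>W. {0..<int m} \<times> {0..<int m})"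
    using m by (auto simp: f_def)
  then have "finite (range f)" by (rule finite_subset) (auto intro!: finite_PiE fin)
  then have "\<not> inj f" using finite_imageD infinite_UNIV_nat by blast
  then obtain k l where kl: "k < l" "f k = f l" unfolding inj_def by (metis nat_neq_iff)
  have cong: "cheb t i - cheb t j \<in> mR" if "\<And>w. w \<in> W \<Longrightarrow> c i w mod int m = c j w mod int m" for i j
  proof -
    have "\<forall>w\<in>W. \<exists>e. c i w - c j w = int m * e"
      using that by (metis dvd_def mod_eq_dvd_iff)
    then obtain e where e: "\<And>w. w \<in> W \<Longrightarrow> c i w - c j w = int m * e w" by metis
    have "cheb t i - cheb t j = (\<Sum>w\<in>W. of_int (c i w - c j w) * w)"
      by (simp add: c sum_subtractf left_diff_distrib)
    also have "\<dots> = (\<Sum>w\<in>W. of_int (int m * e w) * w)" by (intro sum.cong) (auto simp: e)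
    also have "\<dots> = of_nat m * (\<Sum>w\<in>W. of_int (e w) * w)" by (simp add: sum_distrib_left mult.assoc)
    finally show ?thesis unfolding mR_def zspan_def by blast
  qed
  have fE: "c k w mod int m = c l w mod int m" "c (Suc k) w mod int m = c (Suc l) w mod int m" if "w \<in> W" for w
    using fun_cong[OF kl(2), of w] that by (auto simp: f_def)
  \<comment> \<open>Solving the recursion for its oldest term carries the congruence down from
    \<open>k\<close> and \<open>l\<close> to \<open>0\<close> and \<open>l - k\<close>, and
    \<open>cheb t 0 = 0\<close>.\<close>
  have "cheb t (k - d) - cheb t (l - d) \<in> mR \<and> cheb t (Suc (k - d)) - cheb t (Suc (l - d)) \<in> mR" if "d \<le> k" for d
    using that
  proof (induction d)
    case 0
    then show ?case using cong fE by simp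
  next
    case (Suc d)
    define i j where "i = k - Suc d" and "j = l - Suc d"
    have ij: "k - d = Suc i" "l - d = Suc j" using Suc.prems kl(1) by (auto simp: i_def j_def)
    have IH: "cheb t (Suc i) - cheb t (Suc j) \<in> mR" "cheb t (Suc (Suc i)) - cheb t (Suc (Suc j)) \<in> mR"
      using Suc by (auto simp: ij)
    have "cheb t i - cheb t j = t * (cheb t (Suc i) - cheb t (Suc j)) - (cheb t (Suc (Suc i)) - cheb t (Suc (Suc j)))"
      by (simp add: algebra_simps)
    also have "\<dots> \<in> mR" by (intro mR_diff mR_t IH)
    finally show ?case using IH by (simp add: i_def j_def)
  qed
  from this[of k] have "0 - cheb t (l - k) \<in> mR" by simp
  then obtain y where y: "y \<in> zspan W" "cheb t (l - k) = of_nat m * (- y)" by (auto simp: mR_def)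
  then have "cheb t (l - k) / real m = - y" using m by simp
  then show ?thesis using that[of "l - k"] kl(1) alg[OF y(1)] by simp
qed

lemma algebraic_int_cheb: "algebraic_int t \<Longrightarrow> algebraic_int (cheb t k)"
  by (induction k rule: induct_nat_012) (auto intro: algebraic_int_diff algebraic_int_add_mult)

section \<open>Nonelementary groups contain pairs of hyperbolic elements in general position\<close>

text \<open>Homogeneous coordinates on the Riemann sphere; in them \<open>moebius\<close> is linear
  and its case distinctions disappear.\<close>

definition pt :: "complex \<Rightarrow> complex \<Rightarrow> complex option" where
  "pt x y = (if y = 0 then None else Some (x / y))"

lemma moebius_pt:
  assumes "x \<noteq> 0 \<or> y \<noteq> 0"
  shows "moebius M (pt x y) =
    pt (of_real (M$1$1) * x + of_real (M$1$2) * y) (of_real (M$2$1) * x + of_real (M$2$2) * y)"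
proof (cases "y = 0")
  case False
  have gen: "(if D / y = 0 then None else Some ((N / y) / (D / y))) = pt N D" for N D
    using False by (simp add: pt_def)
  have eqs: "of_real (M$2$1) * (x / y) + of_real (M$2$2) = (of_real (M$2$1) * x + of_real (M$2$2) * y) / y"
    "of_real (M$1$1) * (x / y) + of_real (M$1$2) = (of_real (M$1$1) * x + of_real (M$1$2) * y) / y"
    using False by (simp_all add: add_divide_distrib)
  have "moebius M (Some (x / y)) =
    (if (of_real (M$2$1) * x + of_real (M$2$2) * y) / y = 0 then None
     else Some (((of_real (M$1$1) * x + of_real (M$1$2) * y) / y) / ((of_real (M$2$1) * x + of_real (M$2$2) * y) / y)))"
    unfolding moebius.simps eqs ..
  also have "\<dots> = pt (of_real (M$1$1) * x + of_real (M$1$2) * y) (of_real (M$2$1) * x + of_real (M$2$2) * y)"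
    by (rule gen)
  finally show ?thesis using False by (simp add: pt_def)
next
  case True
  then have "x \<noteq> 0" using assms by simp
  then show ?thesis using True by (simp add: pt_def)
qed

lemma pt_eqI:
  assumes "x \<noteq> 0 \<or> y \<noteq> 0" "x' \<noteq> 0 \<or> y' \<noteq> 0" "x * y' = x' * y"
  shows "pt x y = pt x' y'"
  using assms by (auto simp: pt_def field_simps)

lemma unimodular_kernel:
  fixes a b c d x y :: complex
  assumes "a * d - b * c = 1" "a * x + b * y = 0" "c * x + d * y = 0"
  shows "x = 0 \<and> y = 0"
proof
  have "x = d * (a * x + b * y) - b * (c * x + d * y) - (a * d - b * c - 1) * x" by (simp add: algebra_simps)
  then show "x = 0" using assms by simp
  have "y = a * (c * x + d * y) - c * (a * x + b * y) - (a * d - b * c - 1) * y" by (simp add: algebra_simps)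
  then show "y = 0" using assms by simp
qed

lemma mat2_inj:
  fixes x y :: complex and M :: mat2
  assumes "det M = 1" "x \<noteq> 0 \<or> y \<noteq> 0"
  shows "of_real (M$1$1) * x + of_real (M$1$2) * y \<noteq> 0 \<or> of_real (M$2$1) * x + of_real (M$2$2) * y \<noteq> 0"
proof (rule ccontr)
  assume "\<not> ?thesis"
  then have 0: "of_real (M$1$1) * x + of_real (M$1$2) * y = 0" "of_real (M$2$1) * x + of_real (M$2$2) * y = 0" by auto
  have "of_real (M$1$1 * M$2$2 - M$1$2 * M$2$1) = (1::complex)"
    using assms(1) unfolding det_2 by simp
  then have d: "of_real (M$1$1) * of_real (M$2$2) - of_real (M$1$2) * of_real (M$2$1) = (1::complex)"
    by simp
  show False using unimodular_kernel[OF d 0] assms(2) by simp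
qed

text \<open>Orbits of at most two points cover all cases that occur: a common fixed point, or a pair
  of points preserved by the group. Equality of points is stated by cross multiplication.\<close>

lemma elementaryI:
  assumes H: "\<And>M. M \<in> H \<Longrightarrow> det M = 1"
    and xy: "x \<noteq> 0 \<or> y \<noteq> 0" and uv: "u \<noteq> 0 \<or> v \<noteq> 0"
    and pos: "pt x y \<in> closed_half_plane"
    and stab: "\<And>M x' y'. M \<in> H \<Longrightarrow> x' = of_real (M$1$1) * x + of_real (M$1$2) * y \<Longrightarrow>
      y' = of_real (M$2$1) * x + of_real (M$2$2) * y \<Longrightarrow> x' * y = x * y' \<or> x' * v = u * y'"
  shows "elementary (cls ` H)"
  unfolding elementary_def
proof (rule bexI[OF _ pos], rule finite_subset[of _ "{pt x y, pt u v}"])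
  show "(\<lambda>g. act g (pt x y)) ` cls ` H \<subseteq> {pt x y, pt u v}"
  proof (rule image_subsetI)
    fix g assume "g \<in> cls ` H"
    then obtain M where M: "M \<in> H" "g = cls M" by blast
    show "act g (pt x y) \<in> {pt x y, pt u v}"
      unfolding M(2) act_cls moebius_pt[OF xy]
      using pt_eqI[OF mat2_inj[OF H[OF M(1)] xy] xy] pt_eqI[OF mat2_inj[OF H[OF M(1)] xy] uv] stab[OF M(1) refl refl] by blast
  qed
qed simp

lemma elementary_real:
  fixes x y u v :: real
  assumes H: "\<And>M. M \<in> H \<Longrightarrow> det M = 1"
    and xy: "x \<noteq> 0 \<or> y \<noteq> 0" and uv: "u \<noteq> 0 \<or> v \<noteq> 0"
    and stab: "\<And>M x' y'. M \<in> H \<Longrightarrow> x' = M$1$1 * x + M$1$2 * y \<Longrightarrow>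
      y' = M$2$1 * x + M$2$2 * y \<Longrightarrow> x' * y = x * y' \<or> x' * v = u * y'"
  shows "elementary (cls ` H)"
proof (rule elementaryI[where x = "of_real x" and y = "of_real y" and u = "of_real u" and v = "of_real v"])
  have "Im (of_real x / of_real y) = 0" by (metis Im_complex_of_real of_real_divide)
  then show "pt (of_real x) (of_real y) \<in> closed_half_plane"
    by (auto simp: pt_def closed_half_plane_def)
next
  fix M :: mat2 and x' y' :: complex
  assume M: "M \<in> H" "x' = of_real (M$1$1) * of_real x + of_real (M$1$2) * of_real y"
    "y' = of_real (M$2$1) * of_real x + of_real (M$2$2) * of_real y"
  have "x' = of_real (M$1$1 * x + M$1$2 * y)" "y' = of_real (M$2$1 * x + M$2$2 * y)" using M by simp_all
  with stab[OF M(1) refl refl] show "x' * of_real y = of_real x * y' \<or> x' * of_real v = of_real u * y'"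
    by (simp only: of_real_mult[symmetric] of_real_eq_iff)
qed (use H xy uv in auto)

lemma trace_commutator:
  fixes g h :: mat2
  assumes "det g = 1" "det h = 1"
  shows "trace (g ** h ** adj2 g ** adj2 h) = 2 - det (g ** h - h ** g)"
proof -
  have "det (A - B) = det A + det B - trace (A ** adj2 B)" for A B :: mat2
    by (simp add: mat2_simps algebra_simps)
  moreover have "adj2 (h ** g) = adj2 g ** adj2 h"
    by (simp add: mat2_simps algebra_simps)
  ultimately show ?thesis using assms by (simp add: det2_mult matrix_mul_assoc)
qed

text \<open>The matrix \<open>g ** h - h ** g\<close> is orthogonal, for the trace form, to the
  traceless part of \<open>g\<close>. For elliptic \<open>g\<close> the determinant is negative
  definite on that complement, whereas the bound on the trace of the group commutator makes it
  nonnegative.\<close>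

lemma elliptic_commute:
  fixes g h :: mat2
  assumes g: "\<bar>trace g\<bar> < 2" "det g = 1" and h: "det h = 1"
    and le: "trace (g ** h ** adj2 g ** adj2 h) \<le> 2"
  shows "g ** h = h ** g"
proof -
  define p q r s where "p = (g$1$1 - g$2$2) / 2" and "q = g$1$2" and "r = g$2$1" and "s = - p\<^sup>2 - q * r"
  define u v w where "u = (g ** h - h ** g)$1$1" and "v = (g ** h - h ** g)$1$2" and "w = (g ** h - h ** g)$2$1"
  have "(trace g)\<^sup>2 < 2\<^sup>2" using g(1) by (metis abs_ge_zero power2_abs power_strict_mono zero_less_numeral)
  moreover have "4 * s = 4 - (trace g)\<^sup>2"
    using g(2) unfolding s_def p_def q_def r_def mat2_simps by (simp add: field_simps power2_eq_square)
  ultimately have s: "s > 0" by simp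
  have r: "r \<noteq> 0"
  proof
    assume "r = 0"
    then have "s = - p\<^sup>2" by (simp add: s_def)
    with s show False by simp
  qed
  have uu: "(g ** h - h ** g)$2$2 = - u" unfolding u_def mat2_mult_nth by (simp add: mat2_mult_nth)
  have orth: "2 * p * u + q * w + r * v = 0"
    unfolding p_def q_def r_def u_def v_def w_def by (simp add: mat2_mult_nth algebra_simps)
  have "det (g ** h - h ** g) = - u\<^sup>2 - v * w"
    unfolding det_2 uu by (simp add: u_def v_def w_def power2_eq_square algebra_simps)
  moreover have "det (g ** h - h ** g) \<ge> 0"
    using le trace_commutator[OF g(2) h] by simp
  \<comment> \<open>Eliminating \<open>v\<close> by \<open>orth\<close> turns minus the determinant,
    times \<open>r^2\<close>, into a sum of squares; \<open>s > 0\<close> is the determinant of the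
    traceless part of \<open>g\<close>.\<close>
  moreover have "r\<^sup>2 * (u\<^sup>2 + v * w) = (r * u - p * w)\<^sup>2 + s * w\<^sup>2"
    using orth unfolding s_def by Groebner_Basis.algebra
  ultimately have "(r * u - p * w)\<^sup>2 + s * w\<^sup>2 \<le> 0"
    by (smt (verit) mult_nonneg_nonneg zero_le_power2 mult_minus_right)
  then have 0: "s * w\<^sup>2 \<le> 0" "(r * u - p * w)\<^sup>2 \<le> 0"
    using s by (smt (verit) mult_nonneg_nonneg zero_le_power2)+
  then have w: "w = 0" using s by (simp add: mult_le_0_iff)
  then have "u = 0" using 0(2) r by simp
  then have "v = 0" using orth w r by simp
  have "g ** h - h ** g = 0"
    unfolding mat2_eq_iff using uu \<open>u = 0\<close> \<open>v = 0\<close> w by (simp add: u_def v_def w_def)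
  then show ?thesis by simp
qed

lemma fixed_point_identity:
  fixes a b c d p q r x :: complex
  assumes "b * r = q * c" "(a - d) * r = 2 * p * c" "x\<^sup>2 - 2 * p * x - q * r = 0"
  shows "(a * x + b * r) * r = x * (c * x + d * r)"
  using assms by Groebner_Basis.algebra

text \<open>Whatever commutes with \<open>g\<close> preserves its only fixed point in the upper half
  plane.\<close>

lemma elementary_commuting_elliptic:
  assumes H: "\<And>M. M \<in> H \<Longrightarrow> det M = 1" and g: "\<bar>trace g\<bar> < 2" "det g = 1"
    and comm: "\<And>h. h \<in> H \<Longrightarrow> g ** h = h ** g"
  shows "elementary (cls ` H)"
proof -
  define p q r s where "p = (g$1$1 - g$2$2) / 2" and "q = g$1$2" and "r = g$2$1" and "s = - p\<^sup>2 - q * r"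
  have "(trace g)\<^sup>2 < 2\<^sup>2" using g(1) by (metis abs_ge_zero power2_abs power_strict_mono zero_less_numeral)
  moreover have "4 * s = 4 - (trace g)\<^sup>2"
    using g(2) unfolding s_def p_def q_def r_def mat2_simps by (simp add: field_simps power2_eq_square)
  ultimately have s: "s > 0" by simp
  have r: "r \<noteq> 0"
  proof
    assume "r = 0"
    then have "s = - p\<^sup>2" by (simp add: s_def)
    with s show False by simp
  qed
  \<comment> \<open>The sign puts the fixed point \<open>x / r\<close> of \<open>g\<close>, where
    \<open>x\<close> has real part \<open>p\<close> and imaginary part \<open>\<sigma>\<close>, into
    the upper half plane.\<close>
  define \<sigma> where "\<sigma> = (if r > 0 then sqrt s else - sqrt s)"
  have sg: "\<sigma>\<^sup>2 = s" using s r by (simp add: \<sigma>_def)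
  have sr: "\<sigma> / r \<ge> 0" using s r by (simp add: \<sigma>_def zero_le_divide_iff)
  define x where "x = Complex p \<sigma>"
  have xx: "x\<^sup>2 - 2 * of_real p * x - of_real q * of_real r = 0"
    using sg by (simp add: x_def complex_eq_iff power2_eq_square s_def)
  have half: "pt x (of_real r) \<in> closed_half_plane"
    using r sr by (auto simp: pt_def closed_half_plane_def x_def)
  show ?thesis
  proof (rule elementaryI[OF H _ _ half])
    fix M x' y' assume M: "M \<in> H" and x': "x' = of_real (M$1$1) * x + of_real (M$1$2) * of_real r"
      and y': "y' = of_real (M$2$1) * x + of_real (M$2$2) * of_real r"
    have e: "g$1$1 * M$1$1 + g$1$2 * M$2$1 = M$1$1 * g$1$1 + M$1$2 * g$2$1"
      "g$2$1 * M$1$1 + g$2$2 * M$2$1 = M$2$1 * g$1$1 + M$2$2 * g$2$1"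
      using comm[OF M] unfolding mat2_eq_iff mat2_mult_nth by blast+
    have p2: "2 * p = g$1$1 - g$2$2" by (simp add: p_def)
    have c: "M$1$2 * r = q * M$2$1" "(M$1$1 - M$2$2) * r = 2 * p * M$2$1"
      unfolding p2 q_def r_def using e by (simp_all add: algebra_simps)
    have "of_real (M$1$2) * of_real r = of_real q * (of_real (M$2$1) :: complex)"
      "(of_real (M$1$1) - of_real (M$2$2)) * of_real r = 2 * of_real p * (of_real (M$2$1) :: complex)"
      using arg_cong[OF c(1), of complex_of_real] arg_cong[OF c(2), of complex_of_real]
      by (simp_all only: of_real_mult of_real_diff of_real_numeral)
    then have "x' * of_real r = x * y'" using xx unfolding x' y'
      by (rule fixed_point_identity)
    then show "x' * of_real r = x * y' \<or> x' * 1 = 1 * y'" by simp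
  qed (use r in auto)
qed

lemma bounded_linear_zero:
  fixes a b :: real
  assumes "\<And>n::nat. \<bar>a + real n * b\<bar> \<le> c"
  shows "b = 0"
proof (rule ccontr)
  assume b: "b \<noteq> 0"
  obtain n :: nat where "(c + \<bar>a\<bar>) / \<bar>b\<bar> < real n" using reals_Archimedean2 by blast
  then have "c + \<bar>a\<bar> < real n * \<bar>b\<bar>" using b by (simp add: field_simps)
  moreover have "real n * \<bar>b\<bar> = \<bar>real n * b\<bar>" by (simp add: abs_mult)
  ultimately show False using assms[of n] by linarith
qed

text \<open>Write \<open>g = s (1 + N)\<close> with \<open>s\<close> a sign and \<open>N\<close>
  nilpotent. The trace of \<open>g^n M\<close> is \<open>s^n (tr M + n tr (N M))\<close>;
  boundedness forces \<open>tr (N M) = 0\<close>, which says that \<open>M\<close> preserves the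
  kernel of \<open>N\<close>, the fixed point of \<open>g\<close>.\<close>

lemma elementary_parabolic:
  assumes H: "\<And>M. M \<in> H \<Longrightarrow> det M = 1" and mult: "\<And>M N. M \<in> H \<Longrightarrow> N \<in> H \<Longrightarrow> M ** N \<in> H"
    and one: "mat 1 \<in> H"
    and tr: "\<And>M. M \<in> H \<Longrightarrow> \<bar>trace M\<bar> \<le> 2"
    and g: "g \<in> H" "\<bar>trace g\<bar> = 2" "g \<noteq> mat 1" "g \<noteq> - mat 1"
  shows "elementary (cls ` H)"
proof -
  define s where "s = trace g / 2"
  have s1: "\<bar>s\<bar> = 1" using g(2) by (simp add: s_def)
  then have s: "s\<^sup>2 = 1" by (metis power2_abs one_power2)
  define N where "N = s *\<^sub>R g - mat 1"
  have det: "det g = 1" using H g by simp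
  have tg: "g$1$1 + g$2$2 = 2 * s" by (simp add: s_def trace2)
  have sN: "g = s *\<^sub>R (mat 1 + N)" using s by (simp add: N_def power2_eq_square)
  have "s * (g$1$1 + g$2$2) = 2" unfolding tg using s by (simp add: power2_eq_square)
  then have trN: "N$2$2 = - N$1$1" by (simp add: N_def algebra_simps)
  have detN: "N$1$1 * N$1$1 + N$1$2 * N$2$1 = 0"
    using det tg s unfolding N_def det_2 by (simp add: mat2_one_nth) Groebner_Basis.algebra
  have NN: "N ** N = 0"
    unfolding mat2_simps trN using detN by (simp add: algebra_simps)
  have pow: "mpow g n = s ^ n *\<^sub>R (mat 1 + real n *\<^sub>R N)" for n
  proof (induction n)
    case (Suc n)
    have "mpow g (Suc n) = s ^ n *\<^sub>R (mat 1 + real n *\<^sub>R N) ** (s *\<^sub>R (mat 1 + N))"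
      using Suc sN by simp
    also have "\<dots> = s ^ Suc n *\<^sub>R ((mat 1 + real n *\<^sub>R N) ** (mat 1 + N))" by (simp add: mult.commute)
    also have "(mat 1 + real n *\<^sub>R N) ** (mat 1 + N) = mat 1 + real (Suc n) *\<^sub>R N"
      by (simp add: mat2_mult_distrib NN scaleR_add_left)
    finally show ?case .
  qed simp
  have gn: "mpow g n \<in> H" for n by (induction n) (auto intro: one mult g)
  have zero: "trace (N ** M) = 0" if M: "M \<in> H" for M
  proof (rule bounded_linear_zero)
    fix n :: nat
    have "\<bar>trace (mpow g n ** M)\<bar> \<le> 2" by (intro tr mult gn M)
    moreover have "mpow g n ** M = s ^ n *\<^sub>R (M + real n *\<^sub>R (N ** M))"
      unfolding pow by (simp add: mat2_mult_distrib)
    ultimately show "\<bar>trace M + real n * trace (N ** M)\<bar> \<le> 2"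
      using s1 by (simp add: abs_mult power_abs)
  qed
  have N0: "N \<noteq> 0"
  proof
    assume "N = 0"
    then have "g = mat 1 \<or> g = - mat 1" using sN s by (auto simp: power2_eq_1_iff)
    with g show False by simp
  qed
  define a b c where "a = N$1$1" and "b = N$1$2" and "c = N$2$1"
  have abc: "a * a + b * c = 0" using detN by (simp add: a_def b_def c_def)
  have nz: "a \<noteq> 0 \<or> b \<noteq> 0 \<or> c \<noteq> 0" using N0 trN unfolding mat2_eq_iff by (auto simp: a_def b_def c_def)
  have tz: "a * M$1$1 + b * M$2$1 + c * M$1$2 - a * M$2$2 = 0" if "M \<in> H" for M
    using zero[OF that] trN unfolding trace2 mat2_mult_nth by (simp add: a_def b_def c_def)
  \<comment> \<open>The kernel of \<open>N\<close> is also its image, spanned by the column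
    \<open>(a, c)\<close> or, if \<open>c = 0\<close>, by \<open>(1, 0)\<close>, the point at
    infinity.\<close>
  show ?thesis
  proof (cases "c = 0")
    case True
    then have "a = 0" "b \<noteq> 0" using abc nz by auto
    then have "M$2$1 = 0" if "M \<in> H" for M using tz[OF that] True by simp
    then show ?thesis by - (rule elementary_real[of H 1 0 1 0], auto simp: H)
  next
    case False
    show ?thesis
    proof (rule elementary_real[of H a c a c, OF H])
      fix M x' y' assume M: "M \<in> H" "x' = M$1$1 * a + M$1$2 * c" "y' = M$2$1 * a + M$2$2 * c"
      have "x' * c = a * y'" using tz[OF M(1)] abc unfolding M(2,3) by Groebner_Basis.algebra
      then show "x' * c = a * y' \<or> x' * c = a * y'" by simp
    qed (use False in auto)
  qed
qed

text \<open>If all traces were at most 2 in absolute value, an elliptic element would commute with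
  the whole group, because traces of commutators are bounded as well. Without elliptic elements, a
  parabolic one forces a common fixed point, or only \<open>mat 1\<close> and \<open>- mat 1\<close>
  are left.\<close>

lemma nonelementary_has_hyperbolic:
  assumes H: "\<And>M. M \<in> H \<Longrightarrow> det M = 1" and mult: "\<And>M N. M \<in> H \<Longrightarrow> N \<in> H \<Longrightarrow> M ** N \<in> H"
    and one: "mat 1 \<in> H" and adj: "\<And>M. M \<in> H \<Longrightarrow> adj2 M \<in> H"
    and ne: "\<not> elementary (cls ` H)"
  obtains h where "h \<in> H" "\<bar>trace h\<bar> > 2"
proof -
  have "\<exists>h\<in>H. \<bar>trace h\<bar> > 2"
  proof (rule ccontr)
    assume "\<not> ?thesis"
    then have tr: "\<bar>trace M\<bar> \<le> 2" if "M \<in> H" for M using that by force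
    show False
    proof (cases "\<exists>g\<in>H. \<bar>trace g\<bar> < 2")
      case True
      then obtain g where g: "g \<in> H" "\<bar>trace g\<bar> < 2" by blast
      have "g ** h = h ** g" if h: "h \<in> H" for h
      proof (rule elliptic_commute[OF g(2) H[OF g(1)] H[OF h]])
        have "\<bar>trace (g ** h ** adj2 g ** adj2 h)\<bar> \<le> 2" by (intro tr mult adj g h)
        then show "trace (g ** h ** adj2 g ** adj2 h) \<le> 2" by simp
      qed
      then show False using elementary_commuting_elliptic[OF H g(2) H[OF g(1)]] ne by blast
    next
      case False
      then have tr2: "\<bar>trace M\<bar> = 2" if "M \<in> H" for M using tr[OF that] that by force
      show False
      proof (cases "\<exists>g\<in>H. g \<noteq> mat 1 \<and> g \<noteq> - mat 1")
        case True
        then show False using elementary_parabolic[OF H mult one tr _ tr2] ne by blast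
      next
        case False
        have "elementary (cls ` H)"
          by (rule elementary_real[of H 1 0 1 0]) (use False H in auto)
        with ne show False by simp
      qed
    qed
  qed
  with that show ?thesis by blast
qed

lemma singular_kernel:
  assumes "det (M::mat2) = 0"
  obtains x y where "x \<noteq> 0 \<or> y \<noteq> 0" "M$1$1 * x + M$1$2 * y = 0" "M$2$1 * x + M$2$2 * y = 0"
proof (cases "M$1$1 = 0 \<and> M$1$2 = 0")
  case True
  show ?thesis
  proof (cases "M$2$1 = 0 \<and> M$2$2 = 0")
    case False
    then show ?thesis using True by (intro that[of "- M$2$2" "M$2$1"]) auto
  qed (use True in \<open>auto intro: that[of 1 0]\<close>)
next
  case False
  then show ?thesis using assms by (intro that[of "- M$1$2" "M$1$1"]) (auto simp: det_2 algebra_simps)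
qed

lemma hyperbolic_diagonalize:
  assumes "det (h::mat2) = 1" "\<bar>trace h\<bar> > 2"
  obtains S l where "det S = 1" "\<bar>l\<bar> > 1" "adj2 S ** h ** S = mat2 l 0 0 (1 / l)"
proof -
  define t where "t = trace h"
  have "t\<^sup>2 > 2\<^sup>2" using assms(2) unfolding t_def by (metis abs_numeral power2_abs power_strict_mono zero_le_numeral abs_ge_zero zero_less_numeral)
  then have t4: "t\<^sup>2 - 4 > 0" by simp
  \<comment> \<open>The sign of \<open>t\<close> selects the eigenvalue of larger absolute
    value.\<close>
  define l where "l = (t + sgn t * sqrt (t\<^sup>2 - 4)) / 2"
  have sq: "(sqrt (t\<^sup>2 - 4))\<^sup>2 = t\<^sup>2 - 4" using t4 by simp
  have sg: "(sgn t)\<^sup>2 = 1" using assms(2) by (auto simp: t_def sgn_if)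
  have l2: "l\<^sup>2 - t * l + 1 = 0"
    using sq sg unfolding l_def by (simp add: field_simps power2_eq_square)
  have "\<bar>l\<bar> > 1"
  proof (cases "t > 0")
    case True
    then have "t > 2" using assms(2) by (simp add: t_def)
    then show ?thesis using True t4 by (simp add: l_def) (smt (verit) real_sqrt_gt_zero)
  next
    case False
    then have "t < - 2" using assms(2) by (simp add: t_def)
    then show ?thesis using t4 by (simp add: l_def) (smt (verit) real_sqrt_gt_zero)
  qed
  then have l0: "l \<noteq> 0" by auto
  define m where "m = 1 / l"
  have lm: "l * m = 1" using l0 by (simp add: m_def)
  have tlm: "t = l + m" using l2 l0 by (simp add: m_def field_simps power2_eq_square)
  have "l \<noteq> m"
  proof
    assume "l = m"
    then have "l * l = 1" using lm by simp
    then have "\<bar>l\<bar> = 1" by (metis abs_mult_self_eq abs_1 abs_ge_zero mult.right_neutral power2_eq_1_iff power2_eq_square abs_minus)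
    with \<open>\<bar>l\<bar> > 1\<close> show False by simp
  qed
  have dl: "det (h - l *\<^sub>R mat 1) = 0"
    using assms(1) l2 unfolding t_def mat2_simps by simp Groebner_Basis.algebra
  have dm: "det (h - m *\<^sub>R mat 1) = 0"
    using assms(1) tlm lm unfolding t_def mat2_simps by simp Groebner_Basis.algebra
  obtain x y where xy: "x \<noteq> 0 \<or> y \<noteq> 0" "h$1$1 * x + h$1$2 * y = l * x" "h$2$1 * x + h$2$2 * y = l * y"
    using singular_kernel[OF dl] by (auto simp: mat2_one_nth algebra_simps)
  obtain u v where uv: "u \<noteq> 0 \<or> v \<noteq> 0" "h$1$1 * u + h$1$2 * v = m * u" "h$2$1 * u + h$2$2 * v = m * v"
    using singular_kernel[OF dm] by (auto simp: mat2_one_nth algebra_simps)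
  define d where "d = x * v - y * u"
  have d: "d \<noteq> 0"
  proof
    assume "d = 0"
    then have z: "x * v = y * u" by (simp add: d_def)
    have "(l - m) * (x * u) = 0" "(l - m) * (x * v) = 0" "(l - m) * (y * v) = 0"
      using z xy uv by Groebner_Basis.algebra+
    then show False using \<open>l \<noteq> m\<close> z xy(1) uv(1) by auto
  qed
  \<comment> \<open>Eigenvectors as columns, the first one rescaled to make the determinant
    1.\<close>
  define S where "S = mat2 (x / d) u (y / d) v"
  have dS: "det S = 1" using d by (simp add: S_def det_2 d_def[symmetric] field_simps) (simp add: d_def)
  have "h ** S = S ** mat2 l 0 0 m"
    using xy(2,3) uv(2,3) d unfolding S_def mat2_eq_iff mat2_mult_nth by (simp add: field_simps)
  then have "adj2 S ** h ** S = mat2 l 0 0 m"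
    using dS by (simp add: mat2_mult_assoc) (simp add: matrix_mul_assoc)
  then show ?thesis using that[OF dS \<open>\<bar>l\<bar> > 1\<close>] by (simp add: m_def)
qed

lemma large_trace:
  fixes l a d :: real
  assumes "\<bar>l\<bar> > 1" "a \<noteq> 0"
  obtains n where "\<bar>l ^ n * a + (1 / l) ^ n * d\<bar> > 2"
proof -
  obtain n where n: "(2 + \<bar>d\<bar>) / \<bar>a\<bar> < \<bar>l\<bar> ^ n" using real_arch_pow[OF assms(1)] by blast
  have "2 + \<bar>d\<bar> < \<bar>l\<bar> ^ n * \<bar>a\<bar>" using n assms(2) by (simp add: field_simps)
  moreover have "\<bar>l ^ n * a\<bar> = \<bar>l\<bar> ^ n * \<bar>a\<bar>" by (simp add: abs_mult power_abs)
  moreover have "\<bar>(1 / l) ^ n * d\<bar> \<le> \<bar>d\<bar>"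
  proof -
    have "\<bar>1 / l\<bar> \<le> 1" using assms(1) by (simp add: field_simps)
    then have "\<bar>1 / l\<bar> ^ n \<le> 1" by (intro power_le_one) auto
    then show ?thesis by (simp add: abs_mult power_abs mult_left_le_one_le)
  qed
  ultimately show ?thesis using that[of n] by linarith
qed

lemma mpow_diag: "mpow (mat2 l 0 0 m) n = mat2 (l ^ n) 0 0 (m ^ n)"
  by (induction n) (auto simp: mat2_simps)

lemma det_comm_diag:
  "det (mat2 l 0 0 l' ** (mat2 m 0 0 m' ** G) - mat2 m 0 0 m' ** G ** mat2 l 0 0 l')
    = m * m' * ((l - l')\<^sup>2 * (G$1$2 * G$2$1))"
  by (simp add: det_2 mat2_mult_nth algebra_simps power2_eq_square)

text \<open>In coordinates where \<open>h\<close> is diagonal, \<open>k\<close> is sought as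
  \<open>f ** g\<close> with \<open>f\<close> a power of \<open>h\<close> or of its inverse. The
  determinant of the commutator is nonzero once both off-diagonal entries of \<open>g\<close> are,
  and a nonzero diagonal entry of \<open>g\<close> lets \<open>f\<close> make the trace
  large.\<close>

lemma hyperbolic_pair:
  assumes H: "\<And>M. M \<in> H \<Longrightarrow> det M = 1" and mult: "\<And>M N. M \<in> H \<Longrightarrow> N \<in> H \<Longrightarrow> M ** N \<in> H"
    and one: "mat 1 \<in> H" and adj: "\<And>M. M \<in> H \<Longrightarrow> adj2 M \<in> H"
    and ne: "\<not> elementary (cls ` H)"
  obtains h k where "h \<in> H" "k \<in> H" "\<bar>trace h\<bar> > 2" "\<bar>trace k\<bar> > 2" "det (h ** k - k ** h) \<noteq> 0"
proof -
  obtain h where h: "h \<in> H" "\<bar>trace h\<bar> > 2"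
    using nonelementary_has_hyperbolic[OF H mult one adj ne] by blast
  obtain S l where S: "det S = 1" "\<bar>l\<bar> > 1" "adj2 S ** h ** S = mat2 l 0 0 (1 / l)"
    using hyperbolic_diagonalize[OF H[OF h(1)] h(2)] by blast
  define C where "C g = adj2 S ** g ** S" for g
  have SC: "S ** C g = g ** S" for g
    using S(1) by (simp add: C_def matrix_mul_assoc)
  have C_mult: "C (f ** g) = C f ** C g" for f g
  proof -
    have "C f ** C g = adj2 S ** f ** (S ** C g)" by (simp only: C_def matrix_mul_assoc)
    then show ?thesis unfolding SC by (simp only: C_def matrix_mul_assoc)
  qed
  have Ch: "C h = mat2 l 0 0 (1 / l)" using S by (simp add: C_def)
  have C_tr: "trace (C g) = trace g" for g
  proof -
    have "trace (C g) = trace (S ** (adj2 S ** g))" unfolding C_def by (rule trace2_mult_commute)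
    also have "\<dots> = trace g" using S(1) by (simp add: matrix_mul_assoc)
    finally show ?thesis .
  qed
  have C_det: "det (C g) = det g" for g by (simp add: C_def det2_mult S(1))
  have C_diff: "C (f - g) = C f - C g" for f g by (simp add: C_def mat2_mult_distrib)
  have C_adj: "C (adj2 g) = adj2 (C g)" for g
  proof -
    have "C (trace g *\<^sub>R mat 1 - g) = trace g *\<^sub>R mat 1 - C g"
      using S(1) by (simp add: C_def mat2_mult_distrib)
    then show ?thesis by (simp add: adj2_def C_tr)
  qed
  have C_pow: "C (mpow g n) = mpow (C g) n" for g n
    using S(1) by (induction n) (simp_all add: C_mult, simp add: C_def)
  have dC: "(C g)$1$1 * (C g)$2$2 - (C g)$1$2 * (C g)$2$1 = 1" if "g \<in> H" for g
    using C_det[of g] H[OF that] by (simp add: det_2)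
  have col: "g$1$1 * S$1$1 + g$1$2 * S$2$1 = S$1$1 * (C g)$1$1 + S$1$2 * (C g)$2$1"
    "g$2$1 * S$1$1 + g$2$2 * S$2$1 = S$2$1 * (C g)$1$1 + S$2$2 * (C g)$2$1"
    "g$1$1 * S$1$2 + g$1$2 * S$2$2 = S$1$1 * (C g)$1$2 + S$1$2 * (C g)$2$2"
    "g$2$1 * S$1$2 + g$2$2 * S$2$2 = S$2$1 * (C g)$1$2 + S$2$2 * (C g)$2$2" for g
    using SC[of g] unfolding mat2_simps by simp_all
  have dS: "S$1$1 * S$2$2 - S$1$2 * S$2$1 = 1" using S(1) by (simp add: det_2)
  then have s1: "S$1$1 \<noteq> 0 \<or> S$2$1 \<noteq> 0" and s2: "S$1$2 \<noteq> 0 \<or> S$2$2 \<noteq> 0" by auto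
  \<comment> \<open>The columns of \<open>S\<close> are the fixed points of \<open>h\<close>. Not
    all of \<open>H\<close> fixes the first one (\<open>g1\<close>), or the second one
    (\<open>g2\<close>), or preserves the pair (\<open>g3\<close>).\<close>
  have "\<exists>g\<in>H. (C g)$2$1 \<noteq> 0"
  proof (rule ccontr)
    assume c: "\<not> ?thesis"
    have "elementary (cls ` H)"
    proof (rule elementary_real[OF H s1 s1])
      fix M x' y' assume M: "M \<in> H" "x' = M$1$1 * S$1$1 + M$1$2 * S$2$1" "y' = M$2$1 * S$1$1 + M$2$2 * S$2$1"
      have "(C M)$2$1 = 0" using c M(1) by blast
      then show "x' * S$2$1 = S$1$1 * y' \<or> x' * S$2$1 = S$1$1 * y'"
        unfolding M(2,3) col by simp
    qed
    with ne show False by simp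
  qed
  then obtain g1 where g1: "g1 \<in> H" "(C g1)$2$1 \<noteq> 0" by blast
  have "\<exists>g\<in>H. (C g)$1$2 \<noteq> 0"
  proof (rule ccontr)
    assume c: "\<not> ?thesis"
    have "elementary (cls ` H)"
    proof (rule elementary_real[OF H s2 s2])
      fix M x' y' assume M: "M \<in> H" "x' = M$1$1 * S$1$2 + M$1$2 * S$2$2" "y' = M$2$1 * S$1$2 + M$2$2 * S$2$2"
      have "(C M)$1$2 = 0" using c M(1) by blast
      then show "x' * S$2$2 = S$1$2 * y' \<or> x' * S$2$2 = S$1$2 * y'"
        unfolding M(2,3) col by simp
    qed
    with ne show False by simp
  qed
  then obtain g2 where g2: "g2 \<in> H" "(C g2)$1$2 \<noteq> 0" by blast
  have "\<exists>g\<in>H. \<not> ((C g)$1$2 = 0 \<and> (C g)$2$1 = 0) \<and> \<not> ((C g)$1$1 = 0 \<and> (C g)$2$2 = 0)"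
  proof (rule ccontr)
    assume c: "\<not> ?thesis"
    have "elementary (cls ` H)"
    proof (rule elementary_real[OF H s1 s2])
      fix M x' y' assume M: "M \<in> H" "x' = M$1$1 * S$1$1 + M$1$2 * S$2$1" "y' = M$2$1 * S$1$1 + M$2$2 * S$2$1"
      have "(C M)$1$1 = 0 \<or> (C M)$2$1 = 0" using c M(1) by blast
      then show "x' * S$2$1 = S$1$1 * y' \<or> x' * S$2$2 = S$1$2 * y'"
        unfolding M(2,3) col by auto
    qed
    with ne show False by simp
  qed
  then obtain g3 where g3: "g3 \<in> H" "\<not> ((C g3)$1$2 = 0 \<and> (C g3)$2$1 = 0)" "\<not> ((C g3)$1$1 = 0 \<and> (C g3)$2$2 = 0)" by blast
  let ?good = "\<lambda>g. (C g)$1$2 \<noteq> 0 \<and> (C g)$2$1 \<noteq> 0 \<and> ((C g)$1$1 \<noteq> 0 \<or> (C g)$2$2 \<noteq> 0)"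
  have "\<exists>g\<in>H. ?good g"
  proof (rule ccontr)
    assume no: "\<not> ?thesis"
    \<comment> \<open>Among \<open>g1\<close>, \<open>g2\<close>, \<open>g3\<close>,
      \<open>g1 ** g3\<close>, \<open>g2 ** g3\<close> there is always a good element.\<close>
    have bad: "\<not> ?good (C' ** g3)" if "C' \<in> H" for C' using no mult[OF that g3(1)] by blast
    show False
    proof (cases "(C g3)$2$1 = 0")
      case True
      then have "(C g3)$1$2 \<noteq> 0" "(C g3)$1$1 \<noteq> 0" "(C g3)$2$2 \<noteq> 0" using g3(2) dC[OF g3(1)] by auto
      moreover have "(C g1)$1$2 = 0 \<or> ((C g1)$1$1 = 0 \<and> (C g1)$2$2 = 0)" using no g1 by blast
      ultimately show False using bad[OF g1(1)] g1(2) dC[OF g1(1)] True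
        unfolding C_mult mat2_mult_nth by auto
    next
      case False
      then have "(C g3)$1$2 = 0" using no g3 by blast
      moreover from this have "(C g3)$2$1 \<noteq> 0" "(C g3)$1$1 \<noteq> 0" "(C g3)$2$2 \<noteq> 0" using g3(2) dC[OF g3(1)] by auto
      moreover have "(C g2)$2$1 = 0 \<or> ((C g2)$1$1 = 0 \<and> (C g2)$2$2 = 0)" using no g2 by blast
      ultimately show False using bad[OF g2(1)] g2(2) dC[OF g2(1)]
        unfolding C_mult mat2_mult_nth by auto
    qed
  qed
  then obtain g where g: "g \<in> H" "(C g)$1$2 \<noteq> 0" "(C g)$2$1 \<noteq> 0" "(C g)$1$1 \<noteq> 0 \<or> (C g)$2$2 \<noteq> 0" by blast
  have l0: "l \<noteq> 0" using S(2) by auto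
  have "\<exists>f\<in>H. \<exists>m. m \<noteq> 0 \<and> C f = mat2 m 0 0 (1 / m) \<and> \<bar>trace (f ** g)\<bar> > 2"
  proof (cases "(C g)$1$1 = 0")
    case False
    obtain n where n: "\<bar>l ^ n * (C g)$1$1 + (1 / l) ^ n * (C g)$2$2\<bar> > 2"
      using large_trace[OF S(2) False] by blast
    have f: "C (mpow h n) = mat2 (l ^ n) 0 0 ((1 / l) ^ n)" by (simp add: C_pow Ch mpow_diag)
    have "trace (mpow h n ** g) = l ^ n * (C g)$1$1 + (1 / l) ^ n * (C g)$2$2"
      unfolding C_tr[symmetric, of "mpow h n ** g"] C_mult f by (simp add: trace2 mat2_mult_nth)
    moreover have "mpow h n \<in> H" by (induction n) (auto intro: one mult h)
    ultimately show ?thesis using n f l0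
      by (intro bexI[of _ "mpow h n"] exI[of _ "l ^ n"]) (auto simp: power_divide)
  next
    case True
    then have a: "(C g)$2$2 \<noteq> 0" using g by simp
    obtain n where n: "\<bar>l ^ n * (C g)$2$2 + (1 / l) ^ n * (C g)$1$1\<bar> > 2"
      using large_trace[OF S(2) a] by blast
    have "adj2 (mat2 l 0 0 (1 / l)) = mat2 (1 / l) 0 0 l" by (simp add: mat2_simps)
    then have f: "C (mpow (adj2 h) n) = mat2 ((1 / l) ^ n) 0 0 (l ^ n)" by (simp add: C_pow C_adj Ch mpow_diag)
    have "trace (mpow (adj2 h) n ** g) = l ^ n * (C g)$2$2 + (1 / l) ^ n * (C g)$1$1"
      unfolding C_tr[symmetric, of "mpow (adj2 h) n ** g"] C_mult f by (simp add: trace2 mat2_mult_nth)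
    moreover have "mpow (adj2 h) n \<in> H" by (induction n) (auto intro: one mult h adj)
    ultimately show ?thesis using n f l0
      by (intro bexI[of _ "mpow (adj2 h) n"] exI[of _ "(1 / l) ^ n"]) (auto simp: power_divide)
  qed
  then obtain f m where f: "f \<in> H" "m \<noteq> 0" "C f = mat2 m 0 0 (1 / m)" "\<bar>trace (f ** g)\<bar> > 2" by blast
  have "l - 1 / l \<noteq> 0"
  proof
    assume "l - 1 / l = 0"
    then have "l * l = 1" using l0 by (simp add: field_simps)
    then have "\<bar>l\<bar> = 1" by (simp add: square_eq_1_iff) auto
    with S(2) show False by simp
  qed
  have "det (h ** (f ** g) - (f ** g) ** h) = det (C h ** (C f ** C g) - (C f ** C g) ** C h)"
    unfolding C_mult[symmetric] C_diff[symmetric] C_det ..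
  also have "\<dots> = (l - 1 / l)\<^sup>2 * ((C g)$1$2 * (C g)$2$1)"
    unfolding Ch f(3) det_comm_diag using f(2) by simp
  also have "\<dots> \<noteq> 0" using g \<open>l - 1 / l \<noteq> 0\<close> by simp
  finally show ?thesis using that[of h "f ** g"] h f(1,4) g(1) mult by blast
qed

section \<open>Totally real number fields\<close>

lemma real_ring_simps [simp]:
  "carrier real_ring = UNIV" "x \<otimes>\<^bsub>real_ring\<^esub> y = x * y" "x \<oplus>\<^bsub>real_ring\<^esub> y = x + y"
  "\<one>\<^bsub>real_ring\<^esub> = 1" "\<zero>\<^bsub>real_ring\<^esub> = 0"
  by (auto simp: ring_of_type_algebra_def)

lemma field_real_ring: "field real_ring"
  by (rule field_from_type_algebra)

lemma ring_real_ring: "ring real_ring"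
  by (rule ring_from_type_algebra)

lemma real_ring_uminus [simp]: "\<ominus>\<^bsub>real_ring\<^esub> x = - x"
proof -
  interpret ring real_ring by (rule ring_real_ring)
  show ?thesis using minus_equality[of "- x" x] by simp
qed

lemma real_ring_inverse [simp]: "x \<noteq> 0 \<Longrightarrow> inv\<^bsub>real_ring\<^esub> x = inverse x"
proof -
  interpret field real_ring by (rule field_real_ring)
  show "x \<noteq> 0 \<Longrightarrow> inv\<^bsub>real_ring\<^esub> x = inverse x"
    by (rule comm_inv_char) auto
qed

section \<open>Subfields of the reals, generated fields and embeddings\<close>

definition real_subfield :: "real set \<Rightarrow> bool" where
  "real_subfield L \<longleftrightarrow> 1 \<in> L \<and> (\<forall>x\<in>L. \<forall>y\<in>L. x + y \<in> L \<and> x * y \<in> L) \<and>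
     (\<forall>x\<in>L. - x \<in> L \<and> inverse x \<in> L)"

lemma real_subfieldD:
  assumes "real_subfield L"
  shows "1 \<in> L" "0 \<in> L" "x \<in> L \<Longrightarrow> y \<in> L \<Longrightarrow> x + y \<in> L" "x \<in> L \<Longrightarrow> y \<in> L \<Longrightarrow> x * y \<in> L"
    "x \<in> L \<Longrightarrow> - x \<in> L" "x \<in> L \<Longrightarrow> inverse x \<in> L" "x \<in> L \<Longrightarrow> y \<in> L \<Longrightarrow> x - y \<in> L"
    "x \<in> L \<Longrightarrow> y \<in> L \<Longrightarrow> x / y \<in> L"
proof -
  show *: "1 \<in> L" "x \<in> L \<Longrightarrow> y \<in> L \<Longrightarrow> x + y \<in> L" "x \<in> L \<Longrightarrow> y \<in> L \<Longrightarrow> x * y \<in> L"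
    "x \<in> L \<Longrightarrow> - x \<in> L" "x \<in> L \<Longrightarrow> inverse x \<in> L" for x y
    using assms by (auto simp: real_subfield_def)
  show "x \<in> L \<Longrightarrow> y \<in> L \<Longrightarrow> x - y \<in> L" using *(2)[of x "- y"] *(4)[of y] by simp
  show "x \<in> L \<Longrightarrow> y \<in> L \<Longrightarrow> x / y \<in> L" using *(3)[of x "inverse y"] *(5)[of y] by (simp add: divide_inverse)
  show "0 \<in> L" using *(2)[of 1 "-1"] *(1) *(4)[of 1] by simp
qed

lemma real_subfield_nat: "real_subfield L \<Longrightarrow> of_nat n \<in> L"
  by (induction n) (auto intro: real_subfieldD)

lemma real_subfield_int: "real_subfield L \<Longrightarrow> of_int n \<in> L"
  by (cases n) (auto intro: real_subfieldD real_subfield_nat simp del: of_nat_Suc)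

lemma real_subfield_Rats: "real_subfield L \<Longrightarrow> q \<in> \<rat> \<Longrightarrow> q \<in> L"
  by (auto elim!: Rats_cases' intro!: real_subfieldD(8) real_subfield_int)

lemma real_subfield_numeral: "real_subfield L \<Longrightarrow> numeral k \<in> L"
  using real_subfield_nat[of L "numeral k"] by simp

lemma real_subfield_sum: "real_subfield L \<Longrightarrow> (\<And>i. i \<in> I \<Longrightarrow> f i \<in> L) \<Longrightarrow> sum f I \<in> L"
  by (induction I rule: infinite_finite_induct) (auto intro: real_subfieldD)

lemma real_subfieldI: "subfield L real_ring \<Longrightarrow> real_subfield L"
proof -
  assume L: "subfield L real_ring"
  interpret field real_ring by (rule field_real_ring)
  have sr: "subring L real_ring" using L subfieldE(1) by blast
  have inv: "inverse x \<in> L" if "x \<in> L" for x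
    using that subfield_m_inv(1)[OF L, of x] subringE(2)[OF sr] by (cases "x = 0") auto
  show ?thesis unfolding real_subfield_def
    using subringE[OF sr] inv by auto
qed

lemma field_over_Q_subfield: "real_subfield (field_over_Q S)"
proof -
  interpret field real_ring by (rule field_real_ring)
  show ?thesis unfolding field_over_Q_def
    by (intro real_subfieldI generate_field_is_subfield) simp
qed

lemma field_over_Q_incl: "x \<in> S \<Longrightarrow> x \<in> field_over_Q S"
  unfolding field_over_Q_def by (rule generate_field.incl) simp

lemma field_over_Q_least:
  assumes L: "real_subfield L" "S \<subseteq> L"
  shows "field_over_Q S \<subseteq> L"
proof
  fix x assume "x \<in> field_over_Q S"
  then have "x \<in> generate_field real_ring (\<rat> \<union> S)" by (simp add: field_over_Q_def)
  then show "x \<in> L"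
    by (induction rule: generate_field.induct)
      (use L(2) in \<open>auto intro: real_subfieldD[OF L(1)] real_subfield_Rats[OF L(1)]\<close>)
qed

definition real_embedding :: "real set \<Rightarrow> (real \<Rightarrow> real) \<Rightarrow> bool" where
  "real_embedding K f \<longleftrightarrow> f 1 = 1 \<and> (\<forall>x\<in>K. \<forall>y\<in>K. f (x + y) = f x + f y \<and> f (x * y) = f x * f y)"

lemma real_embeddingI: "f \<in> ring_hom (real_ring\<lparr>carrier := K\<rparr>) real_ring \<Longrightarrow> real_embedding K f"
  using ring_hom_mult[of f "real_ring\<lparr>carrier := K\<rparr>" real_ring] ring_hom_add[of f "real_ring\<lparr>carrier := K\<rparr>" real_ring]
    ring_hom_one[of f "real_ring\<lparr>carrier := K\<rparr>" real_ring]
  by (simp add: real_embedding_def)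

context
  fixes K :: "real set" and f :: "real \<Rightarrow> real"
  assumes K: "real_subfield K" and f: "real_embedding K f"
begin

lemma embedding_simps:
  shows "f 1 = 1" "x \<in> K \<Longrightarrow> y \<in> K \<Longrightarrow> f (x + y) = f x + f y" "x \<in> K \<Longrightarrow> y \<in> K \<Longrightarrow> f (x * y) = f x * f y"
    "f 0 = 0" "x \<in> K \<Longrightarrow> f (- x) = - f x" "x \<in> K \<Longrightarrow> f (inverse x) = inverse (f x)"
    "x \<in> K \<Longrightarrow> y \<in> K \<Longrightarrow> f (x - y) = f x - f y" "x \<in> K \<Longrightarrow> y \<in> K \<Longrightarrow> f (x / y) = f x / f y"
proof -
  note [intro] = real_subfieldD[OF K]
  show 1: "f 1 = 1" and add: "\<And>x y. x \<in> K \<Longrightarrow> y \<in> K \<Longrightarrow> f (x + y) = f x + f y"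
    and mul: "\<And>x y. x \<in> K \<Longrightarrow> y \<in> K \<Longrightarrow> f (x * y) = f x * f y"
    using f by (auto simp: real_embedding_def)
  show 0: "f 0 = 0" using add[of 0 0] by (simp add: real_subfieldD(2)[OF K])
  show min: "f (- x) = - f x" if "x \<in> K" for x
    using add[OF that real_subfieldD(5)[OF K that]] 0 by simp
  show inv: "f (inverse x) = inverse (f x)" if "x \<in> K" for x
  proof (cases "x = 0")
    case False
    then have "f x * f (inverse x) = 1"
      using mul[OF that real_subfieldD(6)[OF K that]] 1 by simp
    then show ?thesis by (metis inverse_unique)
  qed (simp add: 0)
  show "f (x - y) = f x - f y" if "x \<in> K" "y \<in> K" for x y
    using add[of x "- y"] min[of y] that by (simp add: real_subfieldD(5)[OF K])
  show "f (x / y) = f x / f y" if "x \<in> K" "y \<in> K" for x y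
    using mul[of x "inverse y"] inv[of y] that by (simp add: real_subfieldD(6)[OF K] divide_inverse)
qed

lemma embedding_eq_0: "x \<in> K \<Longrightarrow> f x = 0 \<longleftrightarrow> x = 0"
proof
  assume x: "x \<in> K" "f x = 0"
  show "x = 0"
  proof (rule ccontr)
    assume "x \<noteq> 0"
    then have "f (x * inverse x) = 1" using embedding_simps(1) by simp
    moreover have "f (x * inverse x) = 0"
      using embedding_simps(3)[OF x(1) real_subfieldD(6)[OF K x(1)]] x(2) by simp
    ultimately show False by simp
  qed
qed (simp add: embedding_simps)

lemma embedding_inj: "inj_on f K"
proof (rule inj_onI)
  fix x y assume xy: "x \<in> K" "y \<in> K" "f x = f y"
  then have "f (x - y) = 0" using embedding_simps(7) by simp
  then show "x = y" using embedding_eq_0[OF real_subfieldD(7)[OF K xy(1,2)]] by simp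
qed

lemma embedding_numeral: "f (of_nat n) = of_nat n"
  by (induction n) (auto simp: embedding_simps real_subfield_nat[OF K] real_subfieldD[OF K])

lemma embedding_Rats: "q \<in> \<rat> \<Longrightarrow> f q = q"
proof -
  assume "q \<in> \<rat>"
  then obtain a b where q: "q = of_int a / of_int b" by (metis Rats_cases')
  have "f (of_int a) = of_int a" for a
    by (cases a rule: int_cases2)
      (use embedding_numeral embedding_simps(5)[OF real_subfield_nat[OF K]] in auto)
  then show ?thesis unfolding q
    using embedding_simps(8)[OF real_subfield_int[OF K] real_subfield_int[OF K]] by simp
qed

lemma embedding_sum: "(\<And>i. i \<in> I \<Longrightarrow> g i \<in> K) \<Longrightarrow> f (sum g I) = (\<Sum>i\<in>I. f (g i))"
  by (induction I rule: infinite_finite_induct)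
    (auto simp: embedding_simps real_subfield_sum[OF K])

lemma embedding_image_subfield: 
  assumes L: "real_subfield L" "L \<subseteq> K"
  shows "real_subfield (f ` L)"
proof -
  have "f x + f y = f (x + y)" "f x * f y = f (x * y)" "- f x = f (- x)" "inverse (f x) = f (inverse x)"
    if "x \<in> L" "y \<in> L" for x y
    using subsetD[OF L(2) that(1)] subsetD[OF L(2) that(2)] by (simp_all add: embedding_simps)
  moreover have "1 \<in> f ` L" using embedding_simps(1) real_subfieldD(1)[OF L(1)] by force
  ultimately show ?thesis unfolding real_subfield_def
    using real_subfieldD[OF L(1)] by (auto intro!: imageI)
qed

lemma embedding_field_over_Q:
  assumes "S \<subseteq> K"
  shows "f ` field_over_Q S = field_over_Q (f ` S)"
proof
  have SK: "field_over_Q S \<subseteq> K" by (rule field_over_Q_least[OF K assms])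
  show "field_over_Q (f ` S) \<subseteq> f ` field_over_Q S"
    by (rule field_over_Q_least[OF embedding_image_subfield[OF field_over_Q_subfield SK]])
      (auto intro: field_over_Q_incl)
  have "real_subfield {x \<in> K. f x \<in> field_over_Q (f ` S)}"
    unfolding real_subfield_def
    using real_subfieldD[OF K] real_subfieldD[OF field_over_Q_subfield[of "f ` S"]] embedding_simps by auto
  then have "field_over_Q S \<subseteq> {x \<in> K. f x \<in> field_over_Q (f ` S)}"
    using assms by (intro field_over_Q_least) (auto intro: field_over_Q_incl)
  then show "f ` field_over_Q S \<subseteq> field_over_Q (f ` S)" by blast
qed

end

lemma field_over_Q_abs: "field_over_Q ((\<lambda>x. \<bar>x\<bar>) ` S) = field_over_Q S"
proof
  show "field_over_Q ((\<lambda>x. \<bar>x\<bar>) ` S) \<subseteq> field_over_Q S"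
    by (intro field_over_Q_least field_over_Q_subfield)
      (auto simp: abs_if intro: field_over_Q_incl real_subfieldD[OF field_over_Q_subfield])
  have "x \<in> field_over_Q ((\<lambda>x. \<bar>x\<bar>) ` S)" if "x \<in> S" for x
  proof -
    have "\<bar>x\<bar> \<in> field_over_Q ((\<lambda>x. \<bar>x\<bar>) ` S)" using that by (intro field_over_Q_incl) auto
    then show ?thesis
      by (cases "x \<ge> 0") (auto dest: real_subfieldD(5)[OF field_over_Q_subfield])
  qed
  then show "field_over_Q S \<subseteq> field_over_Q ((\<lambda>x. \<bar>x\<bar>) ` S)"
    by (intro field_over_Q_least field_over_Q_subfield) auto
qed

text \<open>Artin's argument: the relation at \<open>y * x\<close> minus \<open>f j y\<close> times
  the relation at \<open>x\<close> no longer involves \<open>f j\<close>, and it multiplies the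
  coefficient of \<open>f i\<close> by \<open>f i y - f j y\<close>.\<close>

lemma dedekind_independence:
  fixes f :: "'i \<Rightarrow> real \<Rightarrow> real" and K :: "real set"
  assumes "finite I" and K: "real_subfield K" and "\<And>i. i \<in> I \<Longrightarrow> real_embedding K (f i)"
    and "\<And>i j. i \<in> I \<Longrightarrow> j \<in> I \<Longrightarrow> i \<noteq> j \<Longrightarrow> \<exists>x\<in>K. f i x \<noteq> f j x"
    and "\<And>x. x \<in> K \<Longrightarrow> (\<Sum>i\<in>I. c i * f i x) = 0"
  shows "\<forall>i\<in>I. c i = 0"
  using assms(1,3-5)
proof (induction I arbitrary: c)
  case (insert j I)
  have emb: "real_embedding K (f i)" if "i \<in> insert j I" for i using insert.prems(1) that by blast
  have ci: "c i = 0" if i: "i \<in> I" for i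
  proof -
    have ij: "i \<noteq> j" using i insert.hyps by blast
    obtain y where y: "y \<in> K" "f i y \<noteq> f j y" using insert.prems(2)[of i j] i ij by blast
    have all: "\<forall>i\<in>I. c i * (f i y - f j y) = 0"
    proof (rule insert.IH)
      fix x assume x: "x \<in> K"
      have "(\<Sum>i\<in>insert j I. c i * f i (y * x)) - f j y * (\<Sum>i\<in>insert j I. c i * f i x) = 0"
        using insert.prems(3) x real_subfieldD(4)[OF K y(1) x] by simp
      moreover have "(\<Sum>i\<in>insert j I. c i * f i (y * x)) = (\<Sum>i\<in>insert j I. c i * f i y * f i x)"
        by (intro sum.cong) (auto simp: embedding_simps(3)[OF K emb y(1) x])
      ultimately have "(\<Sum>i\<in>insert j I. c i * (f i y - f j y) * f i x) = 0"
        by (simp add: sum_distrib_left sum_subtractf algebra_simps)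
      then show "(\<Sum>i\<in>I. c i * (f i y - f j y) * f i x) = 0"
        using insert.hyps by simp
    qed (use insert.prems in auto)
    show ?thesis using bspec[OF all i] y(2) by simp
  qed
  have "(\<Sum>i\<in>insert j I. c i * f i 1) = 0" using insert.prems(3) real_subfieldD(1)[OF K] by blast
  then have "c j = 0" using insert.hyps ci embedding_simps(1)[OF K emb] by simp
  then show ?case using ci by simp
qed simp

text \<open>Gaussian elimination on the last coordinate: the pivot \<open>k\<close> clears it in the
  other vectors, and a relation among these is completed by the coefficient \<open>d\<close> of the
  pivot.\<close>

lemma linear_dependence:
  fixes v :: "'i \<Rightarrow> nat \<Rightarrow> real"
  assumes "finite I" "card I > n"
  shows "\<exists>c. (\<exists>i\<in>I. c i \<noteq> 0) \<and> (\<forall>j<n. (\<Sum>i\<in>I. c i * v i j) = 0)"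
  using assms
proof (induction n arbitrary: I v)
  case 0
  then have "I \<noteq> {}" by auto
  then show ?case by (intro exI[of _ "\<lambda>_. 1"]) auto
next
  case (Suc n)
  show ?case
  proof (cases "\<forall>i\<in>I. v i n = 0")
    case True
    obtain c where c: "\<exists>i\<in>I. c i \<noteq> 0" "\<forall>j<n. (\<Sum>i\<in>I. c i * v i j) = 0"
      using Suc.IH[OF Suc.prems(1), of v] Suc.prems(2) by auto
    have "(\<Sum>i\<in>I. c i * v i n) = 0" using True by simp
    then show ?thesis using c by (intro exI[of _ c]) (auto simp: less_Suc_eq)
  next
    case False
    then obtain k where k: "k \<in> I" "v k n \<noteq> 0" by blast
    define w where "w i j = v i j - (v i n / v k n) * v k j" for i j
    have "card (I - {k}) > n" using Suc.prems k by simp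
    then obtain c where c: "\<exists>i\<in>I - {k}. c i \<noteq> 0" "\<And>j. j < n \<Longrightarrow> (\<Sum>i\<in>I - {k}. c i * w i j) = 0"
      using Suc.IH[of "I - {k}" w] Suc.prems(1) by auto
    define d where "d = - (\<Sum>i\<in>I - {k}. c i * (v i n / v k n))"
    define c' where "c' = c(k := d)"
    have wn: "w i n = 0" for i using k by (simp add: w_def)
    have "(\<Sum>i\<in>I. c' i * v i j) = 0" if "j < Suc n" for j
    proof -
      have "(\<Sum>i\<in>I. c' i * v i j) = d * v k j + (\<Sum>i\<in>I - {k}. c i * v i j)"
        unfolding sum.remove[OF Suc.prems(1) k(1)] by (simp add: c'_def)
      also have "\<dots> = (\<Sum>i\<in>I - {k}. c i * w i j)"
        by (simp add: d_def w_def right_diff_distrib sum_subtractf sum_distrib_right sum_distrib_left algebra_simps)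
      also have "\<dots> = 0" using c(2)[of j] wn that by (cases "j = n") auto
      finally show ?thesis .
    qed
    moreover have "\<exists>i\<in>I. c' i \<noteq> 0" using c(1) by (auto simp: c'_def)
    ultimately show ?thesis by blast
  qed
qed

lemma dimension_span:
  assumes "ring.dimension real_ring n \<rat> K"
  shows "\<exists>b. (\<forall>x\<in>K. \<exists>q. (\<forall>j. q j \<in> \<rat>) \<and> x = (\<Sum>j<n. q j * b j)) \<and> (\<forall>j<n. b j \<in> K)"
proof -
  interpret ring real_ring by (rule ring_real_ring)
  \<comment> \<open>Carrying \<open>0 \<in> K\<close> through the induction places both the new
    vector and the old space inside the line extension.\<close>
  have "\<exists>b. (\<forall>x\<in>K. \<exists>q. (\<forall>j. q j \<in> \<rat>) \<and> x = (\<Sum>j<n. q j * b j)) \<and> (\<forall>j<n. b j \<in> K) \<and> 0 \<in> K"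
    if "dimension n Q K" "Q = \<rat>" for n K and Q :: "real set"
    using that
  proof (induction n Q K rule: dimension.induct)
    case zero_dim
    show ?case by (auto intro!: exI[of _ "\<lambda>_. 0"])
  next
    case (Suc_dim v E n Q)
    then obtain b where b: "\<forall>x\<in>E. \<exists>q. (\<forall>j. q j \<in> \<rat>) \<and> x = (\<Sum>j<n. q j * b j)" "\<forall>j<n. b j \<in> E" and E0: "0 \<in> E" by blast
    have Q: "0 \<in> Q" "1 \<in> Q" using Suc_dim.prems by simp_all
    have "1 * v + 0 \<in> line_extension Q v E"
      using Q E0 unfolding line_extension_mem_iff real_ring_simps by blast
    moreover have "0 * v + e \<in> line_extension Q v E" if "e \<in> E" for e
      using Q that unfolding line_extension_mem_iff real_ring_simps by blast
    ultimately have Ev: "v \<in> line_extension Q v E" "E \<subseteq> line_extension Q v E" by auto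
    show ?case
    proof (rule exI[of _ "b(n := v)"], rule conjI, rule ballI)
      fix x assume "x \<in> line_extension Q v E"
      then obtain k e where ke: "k \<in> \<rat>" "e \<in> E" "x = k * v + e"
        using Suc_dim.prems by (auto simp: line_extension_mem_iff)
      from b(1) ke(2) obtain q where q: "\<forall>j. q j \<in> \<rat>" "e = (\<Sum>j<n. q j * b j)" by blast
      show "\<exists>q. (\<forall>j. q j \<in> \<rat>) \<and> x = (\<Sum>j<Suc n. q j * (b(n := v)) j)"
        using ke(1,3) q by (intro exI[of _ "q(n := k)"]) (auto simp: algebra_simps intro!: sum.cong)
    next
      show "(\<forall>j<Suc n. (b(n := v)) j \<in> line_extension Q v E) \<and> 0 \<in> line_extension Q v E"
        using b(2) Ev E0 by auto
    qed
  qed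
  from this[OF assms refl] show ?thesis by blast
qed

text \<open>An \<open>L\<close>-linear functional on \<open>K\<close> which vanishes on \<open>L\<close>, built from a maximal \<open>L\<close>-subspace
  avoiding a given point.\<close>

lemma linear_functional:
  fixes L K :: "real set"
  assumes L: "real_subfield L" and K: "real_subfield K" and LK: "L \<subseteq> K" and x0: "x0 \<in> K" "x0 \<notin> L"
  obtains f where "\<And>x y. x \<in> K \<Longrightarrow> y \<in> K \<Longrightarrow> f (x + y) = f x + f y"
    "\<And>l x. l \<in> L \<Longrightarrow> x \<in> K \<Longrightarrow> f (l * x) = l * f x" "f 1 = 0" "f x0 = (1::real)"
proof -
  define \<W> where "\<W> = {W. L \<subseteq> W \<and> W \<subseteq> K \<and> x0 \<notin> W \<and> (\<forall>x\<in>W. \<forall>y\<in>W. x + y \<in> W) \<and> (\<forall>l\<in>L. \<forall>x\<in>W. l * x \<in> W)}"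
  have "L \<in> \<W>" using LK x0 real_subfieldD[OF L] by (auto simp: \<W>_def)
  have "\<exists>M\<in>\<W>. \<forall>W\<in>\<W>. M \<subseteq> W \<longrightarrow> W = M"
  proof (rule subset_Zorn_nonempty)
    fix \<C> assume C: "\<C> \<noteq> {}" "subset.chain \<W> \<C>"
    have CW: "\<And>W. W \<in> \<C> \<Longrightarrow> W \<in> \<W>" using C(2) by (auto simp: subset_chain_def)
    have sum: "x + y \<in> \<Union>\<C>" if xy: "x \<in> \<Union>\<C>" "y \<in> \<Union>\<C>" for x y
    proof -
      obtain U V where UV: "x \<in> U" "U \<in> \<C>" "y \<in> V" "V \<in> \<C>" using xy by blast
      then have "U \<subseteq> V \<or> V \<subseteq> U" using C(2) by (auto simp: subset_chain_def)
      then show ?thesis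
      proof
        assume "U \<subseteq> V"
        then have "x + y \<in> V" using UV CW[OF UV(4)] by (auto simp: \<W>_def)
        then show ?thesis using UV by blast
      next
        assume "V \<subseteq> U"
        then have "x + y \<in> U" using UV CW[OF UV(2)] by (auto simp: \<W>_def)
        then show ?thesis using UV by blast
      qed
    qed
    show "\<Union>\<C> \<in> \<W>" unfolding \<W>_def
    proof (intro CollectI conjI ballI sum)
      obtain W where "W \<in> \<C>" using C(1) by blast
      then show "L \<subseteq> \<Union>\<C>" using CW[of W] unfolding \<W>_def by blast
      show "\<Union>\<C> \<subseteq> K" using CW unfolding \<W>_def by blast
      show "x0 \<notin> \<Union>\<C>" using CW unfolding \<W>_def by blast
      show "l * x \<in> \<Union>\<C>" if lx: "l \<in> L" "x \<in> \<Union>\<C>" for l x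
      proof -
        obtain W where W: "x \<in> W" "W \<in> \<C>" using lx(2) by blast
        then have "l * x \<in> W" using CW[OF W(2)] lx(1) by (auto simp: \<W>_def)
        then show ?thesis using W(2) by blast
      qed
    qed
  qed (use \<open>L \<in> \<W>\<close> in blast)
  then obtain M where M: "M \<in> \<W>" and max: "\<And>W. W \<in> \<W> \<Longrightarrow> M \<subseteq> W \<Longrightarrow> W = M" by blast
  have M': "L \<subseteq> M" "M \<subseteq> K" "x0 \<notin> M" "\<And>x y. x \<in> M \<Longrightarrow> y \<in> M \<Longrightarrow> x + y \<in> M" "\<And>l x. l \<in> L \<Longrightarrow> x \<in> M \<Longrightarrow> l * x \<in> M"
    using M by (auto simp: \<W>_def)
  have Mneg: "- x \<in> M" if "x \<in> M" for x
    using M'(5)[OF real_subfieldD(5)[OF L real_subfieldD(1)[OF L]] that] by simp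
  have M0: "0 \<in> M" using M'(1) real_subfieldD(2)[OF L] by blast
  have ex: "\<exists>l\<in>L. \<exists>w\<in>M. y = w + l * x0" if y: "y \<in> K" for y
  proof (cases "y \<in> M")
    case True
    then show ?thesis using real_subfieldD(2)[OF L] by force
  next
    case False
    \<comment> \<open>The larger subspace \<open>M + L y\<close> contains \<open>x0\<close> by
      maximality of \<open>M\<close>, and the resulting equation can be solved for
      \<open>y\<close>.\<close>
    define W where "W = {w + l * y | w l. w \<in> M \<and> l \<in> L}"
    have MW: "M \<subseteq> W" unfolding W_def using real_subfieldD(2)[OF L] by force
    have "y \<in> W" unfolding W_def using M0 real_subfieldD(1)[OF L] by force
    have "W \<subseteq> K" unfolding W_def using M'(2) LK y real_subfieldD(3,4)[OF K] by blast
    have "x + z \<in> W" if xz: "x \<in> W" "z \<in> W" for x z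
    proof -
      obtain w l w' l' where w: "x = w + l * y" "z = w' + l' * y" "w \<in> M" "w' \<in> M" "l \<in> L" "l' \<in> L"
        using xz by (auto simp: W_def)
      then have "x + z = (w + w') + (l + l') * y" by (simp add: algebra_simps)
      then show ?thesis unfolding W_def using w M'(4) real_subfieldD(3)[OF L] by blast
    qed
    moreover have "k * x \<in> W" if kx: "k \<in> L" "x \<in> W" for k x
    proof -
      obtain w l where w: "x = w + l * y" "w \<in> M" "l \<in> L" using kx by (auto simp: W_def)
      then have "k * x = k * w + (k * l) * y" by (simp add: algebra_simps)
      then show ?thesis unfolding W_def using w M'(5) kx(1) real_subfieldD(4)[OF L] by blast
    qed
    ultimately have "x0 \<in> W"
      using max[of W] MW \<open>y \<in> W\<close> False \<open>W \<subseteq> K\<close> M'(1) unfolding \<W>_def by blast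
    then obtain w l where w: "x0 = w + l * y" "w \<in> M" "l \<in> L" by (auto simp: W_def)
    have "l \<noteq> 0" using w M'(3) by auto
    then have "y = (inverse l * l) * y" by simp
    also have "\<dots> = inverse l * (- w) + inverse l * x0" unfolding w(1) by (simp add: algebra_simps)
    finally have "y = inverse l * (- w) + inverse l * x0" .
    moreover have "inverse l \<in> L" using real_subfieldD(6)[OF L w(3)] .
    ultimately show ?thesis using M'(5) Mneg w(2) by blast
  qed
  have uniq: "l = l'" if "w + l * x0 = w' + l' * x0" "w \<in> M" "w' \<in> M" "l \<in> L" "l' \<in> L" for w w' l l'
  proof (rule ccontr)
    assume "l \<noteq> l'"
    then have "x0 = inverse (l - l') * ((l - l') * x0)" by simp
    also have "(l - l') * x0 = w' + - w" using that(1) by (simp add: left_diff_distrib)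
    finally have "x0 = inverse (l - l') * (w' + - w)" .
    moreover have "inverse (l - l') \<in> L" using that by (intro real_subfieldD(6,7)[OF L])
    ultimately have "x0 \<in> M" using M'(4,5) Mneg that(2,3) by metis
    with M'(3) show False by simp
  qed
  define f where "f y = (THE l. l \<in> L \<and> (\<exists>w\<in>M. y = w + l * x0))" for y
  have fI: "f (w + l * x0) = l" if "w \<in> M" "l \<in> L" for w l
    unfolding f_def using that uniq by (intro the_equality) blast+
  show ?thesis
  proof
    fix x y assume xy: "x \<in> K" "y \<in> K"
    obtain l w where x: "l \<in> L" "w \<in> M" "x = w + l * x0" using ex[OF xy(1)] by blast
    obtain l' w' where y: "l' \<in> L" "w' \<in> M" "y = w' + l' * x0" using ex[OF xy(2)] by blast
    have e: "x + y = (w + w') + (l + l') * x0" unfolding x(3) y(3) by (simp add: algebra_simps)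
    have fx: "f x = l" "f y = l'" unfolding x(3) y(3) by (rule fI[OF x(2,1)], rule fI[OF y(2,1)])
    show "f (x + y) = f x + f y"
      unfolding fx unfolding e by (rule fI[OF M'(4)[OF x(2) y(2)] real_subfieldD(3)[OF L x(1) y(1)]])
  next
    fix k x assume k: "k \<in> L" "x \<in> K"
    obtain l w where x: "l \<in> L" "w \<in> M" "x = w + l * x0" using ex[OF k(2)] by blast
    have e: "k * x = k * w + (k * l) * x0" unfolding x(3) by (simp add: algebra_simps)
    have fx: "f x = l" unfolding x(3) by (rule fI[OF x(2,1)])
    show "f (k * x) = k * f x"
      unfolding fx unfolding e by (rule fI[OF M'(5)[OF k(1) x(2)] real_subfieldD(4)[OF L k(1) x(1)]])
  next
    show "f 1 = 0" using fI[of 1 0] M'(1) real_subfieldD(1,2)[OF L] by auto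
    show "f x0 = 1" using fI[of 0 1] M0 real_subfieldD(1)[OF L] by simp
  qed
qed

locale totally_real =
  fixes n :: nat and K :: "real set" and \<phi> :: "nat \<Rightarrow> real \<Rightarrow> real"
  assumes trnf: "totally_real_number_field n K \<phi>"
begin

lemma K: "real_subfield K"
  using trnf by (auto simp: totally_real_number_field_def intro: real_subfieldI)

lemma emb: "i \<in> {1..n} \<Longrightarrow> real_embedding K (\<phi> i)"
  using trnf by (auto simp: totally_real_number_field_def bij_betw_def intro!: real_embeddingI)

lemma emb1: "x \<in> K \<Longrightarrow> \<phi> 1 x = x"
  using trnf by (auto simp: totally_real_number_field_def)

lemma emb_distinct:
  assumes "i \<in> {1..n}" "j \<in> {1..n}" "i \<noteq> j"
  shows "\<exists>x\<in>K. \<phi> i x \<noteq> \<phi> j x"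
proof (rule ccontr)
  assume c: "\<not> (\<exists>x\<in>K. \<phi> i x \<noteq> \<phi> j x)"
  have bij: "bij_betw \<phi> {1..n} (ring_hom (real_ring\<lparr>carrier := K\<rparr>) real_ring \<inter> extensional K)"
    using trnf by (auto simp: totally_real_number_field_def)
  then have "\<phi> i \<in> extensional K" "\<phi> j \<in> extensional K" using assms by (auto simp: bij_betw_def)
  then have "\<phi> i = \<phi> j" using c by (intro extensionalityI[of _ K]) auto
  moreover have "inj_on \<phi> {1..n}" using bij by (simp add: bij_betw_def)
  ultimately show False using assms by (auto dest: inj_onD)
qed

lemma basis:
  obtains b where "\<And>x. x \<in> K \<Longrightarrow> \<exists>q. (\<forall>j. q j \<in> \<rat>) \<and> x = (\<Sum>j<n. q j * b j)" "\<And>j. j < n \<Longrightarrow> b j \<in> K"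
  using dimension_span[of n K] trnf by (auto simp: totally_real_number_field_def)

text \<open>Multiplication by \<open>x\<close> is given by a rational matrix on the spanning family
  \<open>b\<close>. The product \<open>m\<close> of its denominators makes the matrix integral, with
  eigenvalue \<open>m x\<close> and the vector \<open>b\<close> itself as eigenvector.\<close>

lemma K_fraction:
  assumes "x \<in> K"
  obtains m :: nat where "m > 0" "algebraic_int (of_nat m * x)"
proof -
  obtain b where b: "\<And>x. x \<in> K \<Longrightarrow> \<exists>q. (\<forall>j. q j \<in> \<rat>) \<and> x = (\<Sum>j<n. q j * b j)" "\<And>j. j < n \<Longrightarrow> b j \<in> K"
    using basis by blast
  have "\<forall>i\<in>{..<n}. \<exists>q. (\<forall>j. q j \<in> \<rat>) \<and> x * b i = (\<Sum>j<n. q j * b j)"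
    using b assms real_subfieldD(4)[OF K] by blast
  then obtain q where q: "\<And>i j. i < n \<Longrightarrow> q i j \<in> \<rat>" "\<And>i. i < n \<Longrightarrow> x * b i = (\<Sum>j<n. q i j * b j)"
    by (metis lessThan_iff)
  have "\<forall>p\<in>{..<n} \<times> {..<n}. \<exists>d>0::nat. real d * q (fst p) (snd p) \<in> \<int>"
  proof
    fix p assume "p \<in> {..<n} \<times> {..<n}"
    then have "q (fst p) (snd p) \<in> \<rat>" using q(1) by auto
    then obtain a d :: int where ad: "d > 0" "q (fst p) (snd p) = of_int a / of_int d" by (metis Rats_cases')
    then have "real (nat d) * q (fst p) (snd p) = of_int a" by simp
    then show "\<exists>d>0::nat. real d * q (fst p) (snd p) \<in> \<int>" using ad(1) by (intro exI[of _ "nat d"]) auto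
  qed
  then obtain d where d: "\<And>p. p \<in> {..<n} \<times> {..<n} \<Longrightarrow> d p > (0::nat) \<and> real (d p) * q (fst p) (snd p) \<in> \<int>" by metis
  define m where "m = (\<Prod>p\<in>{..<n} \<times> {..<n}. d p)"
  have m: "m > 0" unfolding m_def using d by (intro prod_pos) blast
  have int: "real m * q i j \<in> \<int>" if "i < n" "j < n" for i j
  proof -
    have ij: "(i, j) \<in> {..<n} \<times> {..<n}" using that by simp
    have "m = d (i, j) * (\<Prod>p\<in>{..<n} \<times> {..<n} - {(i, j)}. d p)"
      unfolding m_def by (rule prod.remove) (use ij in auto)
    then have "real m * q i j = (real (d (i, j)) * q i j) * real (\<Prod>p\<in>{..<n} \<times> {..<n} - {(i, j)}. d p)"
      by (simp only: of_nat_mult mult_ac)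
    also have "\<dots> \<in> \<int>" using d[OF ij] by (intro Ints_mult[OF _ Ints_of_nat]) simp
    finally show ?thesis .
  qed
  define N where "N i j = \<lfloor>real m * q i j\<rfloor>" for i j
  have N: "of_int (N i j) = real m * q i j" if ij: "i < n" "j < n" for i j
  proof -
    obtain z where "real m * q i j = of_int z" using int[OF ij] by (rule Ints_cases)
    then show ?thesis by (simp add: N_def)
  qed
  obtain q1 where q1: "1 = (\<Sum>j<n. q1 j * b j)" using b(1)[OF real_subfieldD(1)[OF K]] by blast
  have "\<exists>k<n. b k \<noteq> 0"
  proof (rule ccontr)
    assume "\<not> ?thesis"
    then have "(\<Sum>j<n. q1 j * b j) = 0" by (intro sum.neutral) auto
    with q1 show False by simp
  qed
  then obtain k where k: "k < n" "b k \<noteq> 0" by blast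
  have "algebraic_int (of_nat m * x)"
  proof (rule algebraic_int_if_integer_eigenvalue[where w = b and N = N, OF _ k])
    fix i assume i: "i < n"
    have "of_nat m * x * b i = (\<Sum>j<n. real m * q i j * b j)"
      using q(2)[OF i] by (simp add: sum_distrib_left mult.assoc)
    also have "\<dots> = (\<Sum>j<n. of_int (N i j) * b j)" using N[OF i] by (intro sum.cong) auto
    finally show "of_nat m * x * b i = (\<Sum>j<n. of_int (N i j) * b j)" .
  qed
  with that m show ?thesis by blast
qed

text \<open>Every \<open>\<rat>\<close>-linear functional on \<open>K\<close> is a real combination of the \<open>n\<close> embeddings, by counting
  dimensions; if the functional is \<open>L\<close>-linear, only the embeddings that are the identity on \<open>L\<close> occur.\<close>

lemma embedding_trivial_on_subfield:
  assumes L: "real_subfield L" and LK: "L \<subseteq> K" "L \<noteq> K" and n: "1 \<in> {1..n}"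
  obtains j where "j \<in> {1..n}" "j \<noteq> 1" "\<And>x. x \<in> L \<Longrightarrow> \<phi> j x = x"
proof -
  have "\<exists>j\<in>{1..n}. j \<noteq> 1 \<and> (\<forall>x\<in>L. \<phi> j x = x)"
  proof (rule ccontr)
    assume no: "\<not> ?thesis"
    obtain x0 where x0: "x0 \<in> K" "x0 \<notin> L" using LK by blast
    obtain f where f: "\<And>x y. x \<in> K \<Longrightarrow> y \<in> K \<Longrightarrow> f (x + y) = f x + f y"
      "\<And>l x. l \<in> L \<Longrightarrow> x \<in> K \<Longrightarrow> f (l * x) = l * f x" "f 1 = 0" "f x0 = 1"
      using linear_functional[OF L K LK(1) x0] by blast
    obtain b where b: "\<And>x. x \<in> K \<Longrightarrow> \<exists>q. (\<forall>j. q j \<in> \<rat>) \<and> x = (\<Sum>j<n. q j * b j)" "\<And>j. j < n \<Longrightarrow> b j \<in> K"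
      using basis by blast
    have f0: "f 0 = 0" using f(1)[of 0 0] real_subfieldD(2)[OF K] by simp
    have fsum: "f (\<Sum>j\<in>I. q j * b j) = (\<Sum>j\<in>I. q j * f (b j))"
      if "\<And>j. q j \<in> \<rat>" "I \<subseteq> {..<n}" for q I
    proof -
      have "finite I" using that(2) finite_subset by blast
      then show ?thesis using that(2)
      proof (induction I)
        case (insert j I)
        have "q j \<in> L" using real_subfield_Rats[OF L that(1)] .
        moreover have "(\<Sum>j\<in>I. q j * b j) \<in> K"
          using insert.prems b(2) real_subfield_Rats[OF K that(1)]
          by (intro real_subfield_sum[OF K] real_subfieldD(4)[OF K]) auto
        moreover have "b j \<in> K" "q j * b j \<in> K"
          using insert.prems b(2) real_subfield_Rats[OF K that(1)] by (auto intro: real_subfieldD(4)[OF K])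
        ultimately show ?case using insert f by simp
      qed (simp add: f0)
    qed
    have psum: "\<phi> i (\<Sum>j<n. q j * b j) = (\<Sum>j<n. q j * \<phi> i (b j))" if "\<And>j. q j \<in> \<rat>" "i \<in> {1..n}" for q i
    proof -
      have qb: "q j \<in> K" "b j \<in> K" if "j < n" for j using real_subfield_Rats[OF K \<open>\<And>j. q j \<in> \<rat>\<close>] b(2)[OF that] by auto
      have "\<phi> i (\<Sum>j<n. q j * b j) = (\<Sum>j<n. \<phi> i (q j * b j))"
        by (rule embedding_sum[OF K emb[OF that(2)]]) (auto intro: real_subfieldD(4)[OF K] qb)
      also have "\<dots> = (\<Sum>j<n. q j * \<phi> i (b j))"
        by (intro sum.cong) (auto simp: embedding_simps(3)[OF K emb[OF that(2)]] qb embedding_Rats[OF K emb[OF that(2)] that(1)])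
      finally show ?thesis .
    qed
    \<comment> \<open>Index 0 is the functional, the others are the embeddings: \<open>n + 1\<close>
      vectors of values on \<open>n\<close> spanning elements.\<close>
    define v where "v i j = (if i = 0 then f (b j) else \<phi> i (b j))" for i j
    obtain c where c: "\<exists>i\<in>{0..n}. c i \<noteq> 0" "\<And>j. j < n \<Longrightarrow> (\<Sum>i\<in>{0..n}. c i * v i j) = 0"
      using linear_dependence[of "{0..n}" n v] by auto
    define F where "F i x = (if i = 0 then f x else \<phi> i x)" for i x
    have Fsum: "F i (\<Sum>j<n. q j * b j) = (\<Sum>j<n. q j * v i j)" if "\<And>j. q j \<in> \<rat>" "i \<in> {0..n}" for q i
      using fsum[of q "{..<n}"] psum[of q i] that by (auto simp: F_def v_def)
    have rel0: "(\<Sum>i\<in>{0..n}. c i * F i x) = 0" if x: "x \<in> K" for x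
    proof -
      obtain q where q: "\<And>j. q j \<in> \<rat>" "x = (\<Sum>j<n. q j * b j)" using b(1)[OF x] by blast
      have "(\<Sum>i\<in>{0..n}. c i * F i x) = (\<Sum>i\<in>{0..n}. \<Sum>j<n. q j * (c i * v i j))"
        unfolding q(2) using Fsum[of q] q(1)
        by (intro sum.cong) (auto simp: sum_distrib_left algebra_simps)
      also have "\<dots> = (\<Sum>j<n. q j * (\<Sum>i\<in>{0..n}. c i * v i j))"
        unfolding sum.swap[of _ "{..<n}" "{0..n}"] sum_distrib_left ..
      also have "\<dots> = 0" using c(2) by simp
      finally show ?thesis .
    qed
    have rel: "c 0 * f x + (\<Sum>i\<in>{1..n}. c i * \<phi> i x) = 0" if x: "x \<in> K" for x
    proof -
      have "{0..n} = insert 0 {1..n}" by auto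
      then show ?thesis using rel0[OF x] by (simp add: F_def)
    qed
    have ci: "c i = 0" if i: "i \<in> {1..n}" "i \<noteq> 1" for i
    proof -
      obtain l where l: "l \<in> L" "\<phi> i l \<noteq> l" using no i by blast
      have lK: "l \<in> K" using l LK by blast
      \<comment> \<open>Subtracting \<open>l\<close> times the relation at \<open>x\<close> from the
        relation at \<open>l * x\<close> removes the \<open>L\<close>-linear \<open>f\<close> and
        leaves a relation among the embeddings alone.\<close>
      have "\<forall>i\<in>{1..n}. c i * (\<phi> i l - l) = 0"
      proof (rule dedekind_independence[OF _ K emb emb_distinct])
        fix x assume x: "x \<in> K"
        have "c 0 * f (l * x) + (\<Sum>i\<in>{1..n}. c i * \<phi> i (l * x)) = 0" by (rule rel) (auto intro: real_subfieldD(4)[OF K] lK x)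
        moreover have "(\<Sum>i\<in>{1..n}. c i * \<phi> i (l * x)) = (\<Sum>i\<in>{1..n}. c i * (\<phi> i l * \<phi> i x))"
          by (intro sum.cong) (auto simp: embedding_simps(3)[OF K emb lK x])
        moreover have "l * (c 0 * f x + (\<Sum>i\<in>{1..n}. c i * \<phi> i x)) = 0" using rel[OF x] by simp
        ultimately show "(\<Sum>i\<in>{1..n}. c i * (\<phi> i l - l) * \<phi> i x) = 0"
          using f(2)[OF l(1) x] by (simp add: sum_distrib_left sum_subtractf algebra_simps)
      qed auto
      from bspec[OF this i(1)] show ?thesis using l(2) by simp
    qed
    \<comment> \<open>What remains relates \<open>f\<close> to the identity, and the values at
      \<open>1\<close> and \<open>x0\<close> rule this out.\<close>
    have rel1: "c 0 * f x + c 1 * x = 0" if x: "x \<in> K" for x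
    proof -
      have "(\<Sum>i\<in>{1..n}. c i * \<phi> i x) = c 1 * \<phi> 1 x + (\<Sum>i\<in>{1..n} - {1}. c i * \<phi> i x)"
        by (rule sum.remove) (use n in auto)
      also have "(\<Sum>i\<in>{1..n} - {1}. c i * \<phi> i x) = 0" by (rule sum.neutral) (use ci in auto)
      finally show ?thesis using rel[OF x] emb1[OF x] by simp
    qed
    have "c 1 = 0" using rel1[OF real_subfieldD(1)[OF K]] f(3) by simp
    moreover have "c 0 = 0" using rel1[OF x0(1)] f(4) \<open>c 1 = 0\<close> by simp
    ultimately have "c i = 0" if "i \<in> {0..n}" for i using ci[of i] that by (cases "i = 0 \<or> i = 1") auto
    with c(1) show False by blast
  qed
  with that show ?thesis by blast
qed

end

section \<open>The Lie algebra of traceless matrices\<close>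

definition brk :: "mat2 \<Rightarrow> mat2 \<Rightarrow> mat2" where
  "brk A B = A ** B - B ** A"

lemma trace_brk [simp]: "trace (brk A B) = 0"
  by (simp add: brk_def trace2_mult_commute)

text \<open>Cayley-Hamilton, polarized.\<close>

lemma mat2_anticommutator:
  "(A::mat2) ** B + B ** A = trace A *\<^sub>R B + trace B *\<^sub>R A + (trace (A ** B) - trace A * trace B) *\<^sub>R mat 1"
  by (simp add: mat2_simps algebra_simps)

lemma traceless_square: "trace (A::mat2) = 0 \<Longrightarrow> A ** A = - det A *\<^sub>R mat 1"
proof -
  assume "trace A = 0"
  then have "A$2$2 = - A$1$1" by (simp add: trace2)
  then show ?thesis by (simp add: mat2_simps algebra_simps)
qed

lemma traceless_anticommute:
  assumes "trace (A::mat2) = 0" "trace B = 0" "trace (A ** B) = 0"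
  shows "A ** B = - (B ** A)"
  using mat2_anticommutator[of A B] assms by (simp add: add_eq_0_iff)

text \<open>\<open>P\<close>, \<open>Q\<close> play the role of the standard generators of a quaternion algebra.\<close>

locale quaternion_pair =
  fixes P Q :: mat2
  assumes tr: "trace P = 0" "trace Q = 0" and dt: "det P \<noteq> 0" "det Q \<noteq> 0"
    and anti: "P ** Q = - (Q ** P)"
begin

lemma PP: "P ** (P ** (A::mat2)) = - det P *\<^sub>R A"
  by (simp add: matrix_mul_assoc traceless_square[OF tr(1)])

lemma QQ: "Q ** (Q ** (A::mat2)) = - det Q *\<^sub>R A"
  by (simp add: matrix_mul_assoc traceless_square[OF tr(2)])

lemma PQ: "P ** (Q ** (A::mat2)) = - (Q ** (P ** A))"
  by (simp add: matrix_mul_assoc anti)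

lemma trace_PQ: "trace (P ** Q) = 0"
  using trace2_mult_commute[of P Q] anti by simp

text \<open>Orthogonal traceless matrices anticommute. So \<open>z\<close> anticommutes with
  \<open>P\<close> and \<open>Q\<close>, hence commutes with \<open>P ** Q\<close>, but it also
  anticommutes with it.\<close>

lemma orthogonal_zero:
  assumes "trace z = 0" "trace (z ** P) = 0" "trace (z ** Q) = 0" "trace (z ** (P ** Q)) = 0"
  shows "z = 0"
proof -
  have zP: "z ** P = - (P ** z)" by (rule traceless_anticommute[OF assms(1) tr(1) assms(2)])
  have zQ: "z ** Q = - (Q ** z)" by (rule traceless_anticommute[OF assms(1) tr(2) assms(3)])
  have "z ** (P ** Q) = - (P ** Q ** z)"
    by (rule traceless_anticommute[OF assms(1) trace_PQ assms(4)])
  moreover have "z ** (P ** Q) = P ** Q ** z"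
  proof -
    have "z ** (P ** Q) = (z ** P) ** Q" by (rule matrix_mul_assoc)
    also have "\<dots> = - (P ** (z ** Q))" by (simp add: zP matrix_mul_assoc)
    also have "\<dots> = P ** Q ** z" by (simp add: zQ matrix_mul_assoc)
    finally show ?thesis .
  qed
  ultimately have "P ** Q ** z = - (P ** Q ** z)" by simp
  then have "P ** Q ** z = 0" by (simp only: mat2_eq_iff) simp
  then have "P ** (Q ** z) = 0" by (simp add: matrix_mul_assoc)
  then have "P ** (P ** (Q ** z)) = 0" by simp
  then have "Q ** z = 0" using PP[of "Q ** z"] dt by simp
  then have "Q ** (Q ** z) = 0" by simp
  then show ?thesis using QQ[of z] dt by simp
qed

text \<open>For the traceless part \<open>z\<close> of \<open>M\<close>, a factor \<open>Q\<close>
  can be moved around the trace of \<open>z ** P\<close> cyclically, or through the product, where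
  it commutes with \<open>z\<close> and anticommutes with \<open>P\<close>; the signs differ, so the
  trace is 0. The other pairings vanish likewise.\<close>

lemma commutant:
  assumes MP: "M ** P = P ** M" and MQ: "M ** Q = Q ** M"
  shows "M = (trace M / 2) *\<^sub>R mat 1"
proof -
  define z where "z = M - (trace M / 2) *\<^sub>R mat 1"
  have zP: "z ** P = P ** z" and zQ: "z ** Q = Q ** z"
    using MP MQ by (simp_all add: z_def mat2_mult_distrib)
  have 1: "trace (z ** P) = 0"
  proof -
    have "trace (Q ** (z ** P ** Q)) = trace (z ** P ** Q ** Q)" by (rule trace2_mult_commute)
    also have "\<dots> = - det Q * trace (z ** P)"
      using QQ[of "mat 1"] by (simp add: matrix_mul_assoc[symmetric])
    finally have a: "trace (Q ** (z ** P ** Q)) = - det Q * trace (z ** P)" .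
    have "Q ** (z ** P ** Q) = (Q ** z) ** (P ** Q)" by (simp add: matrix_mul_assoc)
    also have "\<dots> = - (z ** (Q ** (Q ** P)))" by (simp add: zQ[symmetric] anti matrix_mul_assoc)
    also have "\<dots> = det Q *\<^sub>R (z ** P)" by (simp add: QQ)
    finally have "trace (Q ** (z ** P ** Q)) = det Q * trace (z ** P)" by simp
    with a dt show ?thesis by simp
  qed
  have 2: "trace (z ** Q) = 0"
  proof -
    have "trace (P ** (z ** Q ** P)) = trace (z ** Q ** P ** P)" by (rule trace2_mult_commute)
    also have "\<dots> = - det P * trace (z ** Q)"
      using PP[of "mat 1"] by (simp add: matrix_mul_assoc[symmetric])
    finally have a: "trace (P ** (z ** Q ** P)) = - det P * trace (z ** Q)" .
    have "P ** (z ** Q ** P) = (P ** z) ** (Q ** P)" by (simp add: matrix_mul_assoc)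
    also have "\<dots> = z ** (P ** (Q ** P))" by (simp add: zP[symmetric] matrix_mul_assoc)
    also have "\<dots> = - (z ** (Q ** (P ** P)))" by (simp add: PQ)
    also have "\<dots> = det P *\<^sub>R (z ** Q)" using PP[of "mat 1"] by simp
    finally have "trace (P ** (z ** Q ** P)) = det P * trace (z ** Q)" by simp
    with a dt show ?thesis by simp
  qed
  have 3: "trace (z ** (P ** Q)) = 0"
  proof -
    have "trace (P ** (z ** (P ** Q) ** P)) = trace (z ** (P ** Q) ** P ** P)" by (rule trace2_mult_commute)
    also have "\<dots> = - det P * trace (z ** (P ** Q))"
      using PP[of "mat 1"] by (simp add: matrix_mul_assoc[symmetric])
    finally have a: "trace (P ** (z ** (P ** Q) ** P)) = - det P * trace (z ** (P ** Q))" .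
    have "P ** (z ** (P ** Q) ** P) = (P ** z) ** (P ** (Q ** P))" by (simp add: matrix_mul_assoc)
    also have "\<dots> = z ** (P ** (P ** (Q ** P)))" by (simp add: zP[symmetric] matrix_mul_assoc)
    also have "\<dots> = - det P *\<^sub>R (z ** (Q ** P))" by (simp add: PP)
    also have "\<dots> = det P *\<^sub>R (z ** (P ** Q))" by (simp add: anti)
    finally have "trace (P ** (z ** (P ** Q) ** P)) = det P * trace (z ** (P ** Q))" by simp
    with a dt show ?thesis by simp
  qed
  have "z = 0" by (rule orthogonal_zero[OF _ 1 2 3]) (simp add: z_def)
  then show ?thesis by (simp add: z_def)
qed

lemma traceless_expansion:
  assumes "trace Z = 0"
  obtains \<alpha> \<beta> \<gamma> where "Z = \<alpha> *\<^sub>R P + \<beta> *\<^sub>R Q + \<gamma> *\<^sub>R (P ** Q)"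
proof -
  \<comment> \<open>Coordinates for the trace form: \<open>P\<close>, \<open>Q\<close>,
    \<open>P ** Q\<close> are orthogonal, with values \<open>-2 det P\<close>,
    \<open>-2 det Q\<close>, \<open>-2 det P det Q\<close> on themselves.\<close>
  define \<alpha> where "\<alpha> = - trace (Z ** P) / (2 * det P)"
  define \<beta> where "\<beta> = - trace (Z ** Q) / (2 * det Q)"
  define \<gamma> where "\<gamma> = - trace (Z ** (P ** Q)) / (2 * det P * det Q)"
  define z where "z = Z - (\<alpha> *\<^sub>R P + \<beta> *\<^sub>R Q + \<gamma> *\<^sub>R (P ** Q))"
  have PP1: "P ** P = - det P *\<^sub>R mat 1" and QQ1: "Q ** Q = - det Q *\<^sub>R mat 1"
    by (rule traceless_square, rule tr)+
  have PQP: "P ** Q ** P = det P *\<^sub>R Q"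
  proof -
    have "P ** Q ** P = P ** (Q ** P)" by (simp add: matrix_mul_assoc)
    also have "\<dots> = - (Q ** (P ** P))" by (rule PQ)
    finally show ?thesis by (simp add: PP1)
  qed
  have PQQ: "P ** Q ** Q = - det Q *\<^sub>R P"
    by (simp add: matrix_mul_assoc[symmetric] QQ1)
  have PPQ: "P ** (P ** Q) = - det P *\<^sub>R Q" by (simp add: matrix_mul_assoc PP1)
  have QPQ: "Q ** (P ** Q) = det Q *\<^sub>R P"
  proof -
    have "P ** (Q ** Q) = - (Q ** (P ** Q))" by (rule PQ)
    then show ?thesis by (simp add: QQ1)
  qed
  have PQPQ: "P ** Q ** (P ** Q) = - (det P * det Q) *\<^sub>R mat 1"
    by (simp add: matrix_mul_assoc PQP) (simp add: QQ1)
  have QP: "trace (Q ** P) = 0" using trace_PQ trace2_mult_commute by metis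
  have "z = 0"
  proof (rule orthogonal_zero)
    show "trace z = 0" using assms tr trace_PQ by (simp add: z_def)
    show "trace (z ** P) = 0" using dt
      by (simp add: z_def mat2_mult_distrib PP1 PQP QP tr \<alpha>_def)
    show "trace (z ** Q) = 0" using dt
      by (simp add: z_def mat2_mult_distrib QQ1 PQQ trace_PQ tr \<beta>_def)
    show "trace (z ** (P ** Q)) = 0" using dt
      by (simp add: z_def mat2_mult_distrib PPQ QPQ PQPQ tr \<gamma>_def)
  qed
  then show ?thesis using that[of \<alpha> \<beta> \<gamma>] by (simp add: z_def)
qed

end

text \<open>\<open>U [U, V] + [U, V] U\<close> is \<open>[U^2, V]\<close>, which vanishes because
  \<open>U^2\<close> is scalar.\<close>

lemma commutator_pair:
  assumes U: "trace U = 0" "det U \<noteq> 0" and V: "trace V = 0" and d: "det (brk U V) \<noteq> 0"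
  shows "quaternion_pair U (brk U V)"
proof
  have UU: "U ** U = - det U *\<^sub>R mat 1" by (rule traceless_square[OF U(1)])
  have "U ** (U ** V) = - det U *\<^sub>R V" by (simp add: matrix_mul_assoc UU)
  moreover have "V ** U ** U = - det U *\<^sub>R V" by (simp add: matrix_mul_assoc[symmetric] UU)
  ultimately show "U ** brk U V = - (brk U V ** U)"
    by (simp add: brk_def mat2_mult_distrib matrix_mul_assoc)
qed (use assms in auto)

definition lie_ideal :: "mat2 set \<Rightarrow> bool" where
  "lie_ideal D \<longleftrightarrow> (\<forall>X\<in>D. trace X = 0) \<and> (\<forall>X\<in>D. \<forall>Y\<in>D. X + Y \<in> D) \<and> (\<forall>c. \<forall>X\<in>D. c *\<^sub>R X \<in> D) \<and>
     (\<forall>X\<in>D. \<forall>Y. trace Y = 0 \<longrightarrow> brk Y X \<in> D)"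

lemma brk_brk:
  assumes "trace X = 0" "trace Y = 0"
  shows "brk Y (brk Y X) = (- 4 * det Y) *\<^sub>R X - (2 * trace (X ** Y)) *\<^sub>R Y"
proof -
  have "X$2$2 = - X$1$1" "Y$2$2 = - Y$1$1" using assms by (simp_all add: trace2)
  then show ?thesis by (simp add: brk_def mat2_simps algebra_simps)
qed

text \<open>Simplicity of \<open>sl(2,R)\<close>: by \<open>brk_brk\<close> every \<open>Y\<close>
  not orthogonal to \<open>X\<close> lies in the ideal, and an orthogonal \<open>Z\<close> is the
  difference of two such elements.\<close>

lemma lie_ideal_all:
  assumes D: "lie_ideal D" and X: "X \<in> D" "X \<noteq> 0" and Z: "trace Z = 0"
  shows "Z \<in> D"
proof -
  have trX: "trace X = 0" using D X by (auto simp: lie_ideal_def)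
  have add: "\<And>A B. A \<in> D \<Longrightarrow> B \<in> D \<Longrightarrow> A + B \<in> D" and scale: "\<And>c A. A \<in> D \<Longrightarrow> c *\<^sub>R A \<in> D"
    using D by (auto simp: lie_ideal_def)
  have diff: "A - B \<in> D" if "A \<in> D" "B \<in> D" for A B
    using add[OF that(1) scale[OF that(2), of "-1"]] by simp
  have step: "Y \<in> D" if Y: "trace Y = 0" "trace (X ** Y) \<noteq> 0" for Y
  proof -
    have "brk Y (brk Y X) \<in> D" using D X Y by (auto simp: lie_ideal_def)
    then have "(- 4 * det Y) *\<^sub>R X - brk Y (brk Y X) \<in> D" by (intro diff scale X)
    then have "(2 * trace (X ** Y)) *\<^sub>R Y \<in> D" by (simp add: brk_brk[OF trX Y(1)])
    then have "inverse (2 * trace (X ** Y)) *\<^sub>R (2 * trace (X ** Y)) *\<^sub>R Y \<in> D" by (rule scale)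
    then show ?thesis using Y(2) by simp
  qed
  have "\<exists>Y. trace Y = 0 \<and> trace (X ** Y) \<noteq> 0"
  proof (rule ccontr)
    assume no: "\<not> ?thesis"
    have "trace (X ** mat2 1 0 0 (-1)) = 0" "trace (X ** mat2 0 1 0 0) = 0" "trace (X ** mat2 0 0 1 0) = 0"
      using no by (auto simp: trace2)
    then have "X = 0" using trX by (simp add: mat2_simps)
    with X(2) show False by simp
  qed
  then obtain Y0 where Y0: "trace Y0 = 0" "trace (X ** Y0) \<noteq> 0" by blast
  show ?thesis
  proof (cases "trace (X ** Z) = 0")
    case False
    then show ?thesis using step Z by blast
  next
    case True
    then have "Z + Y0 \<in> D" using Z Y0 by (intro step) (auto simp: mat2_mult_distrib)
    then have "Z + Y0 - Y0 \<in> D" using step[OF Y0] by (rule diff)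
    then show ?thesis by simp
  qed
qed

text \<open>The eigenvalues of \<open>ad X\<close> are 0 and the square roots of
  \<open>- 4 det X\<close>; this lets the bracket alone determine the determinant.\<close>

lemma brk_cubed:
  assumes "trace X = 0" "trace Y = 0"
  shows "brk X (brk X (brk X Y)) = (- 4 * det X) *\<^sub>R brk X Y"
proof -
  have "X$2$2 = - X$1$1" "Y$2$2 = - Y$1$1" using assms by (simp_all add: trace2)
  then show ?thesis by (simp add: brk_def mat2_simps algebra_simps)
qed

lemma brk_add: "brk (A + B) C = brk A C + brk B C" "brk A (B + C) = brk A B + brk A C"
  "brk (c *\<^sub>R A) B = c *\<^sub>R brk A B" "brk A (c *\<^sub>R B) = c *\<^sub>R brk A B" "brk 0 A = 0" "brk A 0 = 0"
  by (auto simp: brk_def mat2_mult_distrib algebra_simps)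

abbreviation tpart :: "mat2 \<Rightarrow> mat2" where
  "tpart M \<equiv> M - (trace M / 2) *\<^sub>R mat 1"

text \<open>A nonzero Lie endomorphism of the traceless matrices extends to an algebra endomorphism
  of all matrices, because \<open>X Y = ([X,Y] + tr(X Y)) / 2\<close> and the trace form is determined by the bracket.\<close>

lemma lie_hom_extends:
  fixes T :: "mat2 \<Rightarrow> mat2"
  assumes add: "\<And>X Y. trace X = 0 \<Longrightarrow> trace Y = 0 \<Longrightarrow> T (X + Y) = T X + T Y"
    and scale: "\<And>c X. trace X = 0 \<Longrightarrow> T (c *\<^sub>R X) = c *\<^sub>R T X"
    and trT: "\<And>X. trace X = 0 \<Longrightarrow> trace (T X) = 0"
    and br: "\<And>X Y. trace X = 0 \<Longrightarrow> trace Y = 0 \<Longrightarrow> T (brk X Y) = brk (T X) (T Y)"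
    and nz: "trace X0 = 0" "T X0 \<noteq> 0"
  defines "\<theta> \<equiv> \<lambda>M. (trace M / 2) *\<^sub>R mat 1 + T (tpart M)"
  shows "\<theta> (A ** B) = \<theta> A ** \<theta> B" "trace (\<theta> A) = trace A" "\<theta> (mat 1) = mat 1"
    "trace X = 0 \<Longrightarrow> det (T X) = det X"
proof -
  have T0: "T 0 = 0" using scale[of 0 0] by simp
  have inj: "X = 0" if X: "trace X = 0" "T X = 0" for X
  proof (rule ccontr)
    assume "X \<noteq> 0"
    have "lie_ideal {X. trace X = 0 \<and> T X = 0}"
      unfolding lie_ideal_def using add scale br by (auto simp: brk_add)
    from lie_ideal_all[OF this _ \<open>X \<noteq> 0\<close> nz(1)] X nz(2) show False by simp
  qed
  have detT: "det (T X) = det X" if X: "trace X = 0" for X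
  proof (rule ccontr)
    assume ne: "det (T X) \<noteq> det X"
    \<comment> \<open>Applying \<open>brk_cubed\<close> before or after \<open>T\<close> multiplies
      \<open>T (brk X Y)\<close> by two different scalars; injectivity then makes \<open>X\<close>
      central.\<close>
    have com: "brk X Y = 0" if Y: "trace Y = 0" for Y
    proof -
      have "T (brk X (brk X (brk X Y))) = brk (T X) (brk (T X) (brk (T X) (T Y)))"
        using X Y by (simp add: br)
      also have "\<dots> = (- 4 * det (T X)) *\<^sub>R brk (T X) (T Y)"
        by (rule brk_cubed[OF trT[OF X] trT[OF Y]])
      finally have "T (brk X (brk X (brk X Y))) = (- 4 * det (T X)) *\<^sub>R brk (T X) (T Y)" .
      moreover have "T (brk X (brk X (brk X Y))) = (- 4 * det X) *\<^sub>R brk (T X) (T Y)"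
        unfolding brk_cubed[OF X Y] br[OF X Y, symmetric] by (rule scale) simp
      ultimately have "(- 4 * det X) *\<^sub>R brk (T X) (T Y) = (- 4 * det (T X)) *\<^sub>R brk (T X) (T Y)" by simp
      then have "T (brk X Y) = 0" using ne X Y by (simp add: br)
      then show ?thesis by (rule inj[OF trace_brk])
    qed
    have "brk X (mat2 1 0 0 (-1)) = 0" "brk X (mat2 0 1 0 0) = 0" "brk X (mat2 0 0 1 0) = 0"
      by (rule com, simp add: trace2)+
    then have "X = 0" using X by (simp add: brk_def mat2_simps)
    with ne T0 show False by simp
  qed
  then show "trace X = 0 \<Longrightarrow> det (T X) = det X" .
  have prod: "X ** Y = (1/2) *\<^sub>R brk X Y + (trace (X ** Y) / 2) *\<^sub>R mat 1" if "trace X = 0" "trace Y = 0" for X Y :: mat2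
  proof -
    have "X$2$2 = - X$1$1" "Y$2$2 = - Y$1$1" using that by (simp_all add: trace2)
    then have "2 *\<^sub>R (X ** Y) = brk X Y + trace (X ** Y) *\<^sub>R mat 1"
      by (simp add: brk_def mat2_simps algebra_simps)
    then have "(1/2) *\<^sub>R 2 *\<^sub>R (X ** Y) = (1/2) *\<^sub>R (brk X Y + trace (X ** Y) *\<^sub>R mat 1)" by (simp only:)
    then show ?thesis by (simp add: scaleR_add_right)
  qed
  have polar: "trace (X ** Y) = det X + det Y - det (X + Y)" if "trace X = 0" "trace Y = 0" for X Y :: mat2
  proof -
    have "X$2$2 = - X$1$1" "Y$2$2 = - Y$1$1" using that by (simp_all add: trace2)
    then show ?thesis by (simp add: mat2_simps algebra_simps)
  qed
  have form: "trace (T X ** T Y) = trace (X ** Y)" if "trace X = 0" "trace Y = 0" for X Y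
    using that by (simp add: polar trT detT add[symmetric])
  have tl0: "trace (tpart M) = 0" for M :: mat2 by simp
  show tr\<theta>: "trace (\<theta> A) = trace A" for A by (simp add: \<theta>_def trT)
  show "\<theta> (mat 1) = mat 1" by (simp add: \<theta>_def T0)
  show "\<theta> (A ** B) = \<theta> A ** \<theta> B"
  proof -
    define a b X Y where "a = trace A / 2" and "b = trace B / 2" and "X = tpart A" and "Y = tpart B"
    have XY: "trace X = 0" "trace Y = 0" by (simp_all add: X_def Y_def)
    have A: "A = a *\<^sub>R mat 1 + X" and B: "B = b *\<^sub>R mat 1 + Y" by (simp_all add: a_def b_def X_def Y_def)
    have \<theta>I: "\<theta> (c *\<^sub>R mat 1 + Z) = c *\<^sub>R mat 1 + T Z" if "trace Z = 0" for c Z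
      using that by (simp add: \<theta>_def)
    define c where "c = a * b + trace (X ** Y) / 2"
    define Z where "Z = a *\<^sub>R Y + b *\<^sub>R X + (1/2) *\<^sub>R brk X Y"
    have "A ** B = (a * b) *\<^sub>R mat 1 + a *\<^sub>R Y + b *\<^sub>R X + X ** Y"
      unfolding A B by (simp add: mat2_mult_distrib algebra_simps)
    also have "X ** Y = (1/2) *\<^sub>R brk X Y + (trace (X ** Y) / 2) *\<^sub>R mat 1"
      by (rule prod[OF XY])
    also have "(a * b) *\<^sub>R mat 1 + a *\<^sub>R Y + b *\<^sub>R X + \<dots> = c *\<^sub>R mat 1 + Z"
      by (simp add: c_def Z_def algebra_simps)
    finally have AB: "A ** B = c *\<^sub>R mat 1 + Z" .
    have "\<theta> (A ** B) = c *\<^sub>R mat 1 + T Z" unfolding AB by (rule \<theta>I) (simp add: Z_def XY)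
    also have "T Z = a *\<^sub>R T Y + b *\<^sub>R T X + (1/2) *\<^sub>R brk (T X) (T Y)"
      using XY by (simp add: Z_def add scale br)
    also have "c *\<^sub>R mat 1 + \<dots> = (a * b) *\<^sub>R mat 1 + a *\<^sub>R T Y + b *\<^sub>R T X +
        ((1/2) *\<^sub>R brk (T X) (T Y) + (trace (T X ** T Y) / 2) *\<^sub>R mat 1)"
      unfolding form[OF XY] by (simp add: c_def algebra_simps)
    also have "\<dots> = (a *\<^sub>R mat 1 + T X) ** (b *\<^sub>R mat 1 + T Y)"
      unfolding prod[OF trT[OF XY(1)] trT[OF XY(2)], symmetric] by (simp add: mat2_mult_distrib algebra_simps)
    also have "\<dots> = \<theta> A ** \<theta> B" unfolding A B \<theta>I[OF XY(1)] \<theta>I[OF XY(2)] ..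
    finally show ?thesis .
  qed
qed

section \<open>The Zariski tangent space of a subgroup at the identity\<close>

lemma entry_polynomial_cong:
  assumes "entry_polynomial r f" "\<And>i. i \<in> {1..r} \<Longrightarrow> x i = y i"
  shows "f x = f y"
  using assms(1) by induction (use assms(2) in auto)

lemma entry_polynomial_mult_right:
  "i \<in> {1..r} \<Longrightarrow> entry_polynomial r (\<lambda>x. (x i ** A i)$j$k)"
  unfolding mat2_mult_nth by (intro entry_polynomial.intros)

lemma entry_polynomial_mult_left:
  "i \<in> {1..r} \<Longrightarrow> entry_polynomial r (\<lambda>x. ((A i :: mat2) ** x i)$j$k)"
  unfolding mat2_mult_nth by (intro entry_polynomial.intros)

lemma entry_polynomial_translate:
  assumes "entry_polynomial r f"
  shows "entry_polynomial r (\<lambda>x. f (\<lambda>i. y i ** x i))" "entry_polynomial r (\<lambda>x. f (\<lambda>i. x i ** y i))"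
  using assms
  by (induction) (auto intro: entry_polynomial.intros entry_polynomial_mult_left entry_polynomial_mult_right)

text \<open>The left-invariant vector field of \<open>X\<close> applied to \<open>f\<close>. The
  line \<open>g (1 + t X)\<close> has the same tangent as \<open>g exp(t X)\<close> and keeps the
  dependence on \<open>t\<close> polynomial.\<close>

definition ld :: "(nat \<Rightarrow> mat2) \<Rightarrow> ((nat \<Rightarrow> mat2) \<Rightarrow> real) \<Rightarrow> (nat \<Rightarrow> mat2) \<Rightarrow> real" where
  "ld X f = (\<lambda>g. deriv (\<lambda>t. f (\<lambda>i. g i + t *\<^sub>R (g i ** X i))) 0)"

lemma ld_has_derivative:
  assumes "entry_polynomial r f"
  shows "((\<lambda>t. f (\<lambda>i. g i + t *\<^sub>R (g i ** X i))) has_real_derivative ld X f g) (at 0)"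
proof -
  have "\<exists>d. ((\<lambda>t. f (\<lambda>i. g i + t *\<^sub>R (g i ** X i))) has_real_derivative d) (at 0)"
    using assms
  proof induction
    case (entry i j k)
    show ?case by (auto intro!: exI derivative_eq_intros)
  next
    case (add f g)
    then show ?case using DERIV_add by blast
  next
    case (mult f g)
    then show ?case using DERIV_mult by blast
  qed (auto intro: exI[of _ 0])
  then obtain d where d: "((\<lambda>t. f (\<lambda>i. g i + t *\<^sub>R (g i ** X i))) has_real_derivative d) (at 0)" by blast
  show ?thesis unfolding ld_def DERIV_imp_deriv[OF d] by (rule d)
qed

lemma ld_eqI:
  assumes "((\<lambda>t. f (\<lambda>i. g i + t *\<^sub>R (g i ** X i))) has_real_derivative d) (at 0)"
  shows "ld X f g = d"
  unfolding ld_def using assms by (rule DERIV_imp_deriv)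

lemma ld_const: "ld X (\<lambda>x. c) = (\<lambda>x. 0)"
  by (rule ext, rule ld_eqI) simp

lemma ld_entry: "ld X (\<lambda>x. x i $ j $ k) = (\<lambda>x. (x i ** X i) $ j $ k)"
  by (rule ext, rule ld_eqI) (auto intro!: derivative_eq_intros)

lemma ld_add:
  assumes "entry_polynomial r f" "entry_polynomial r g"
  shows "ld X (\<lambda>x. f x + g x) = (\<lambda>x. ld X f x + ld X g x)"
  by (rule ext, rule ld_eqI) (intro DERIV_add ld_has_derivative[OF assms(1)] ld_has_derivative[OF assms(2)])

lemma ld_mult:
  assumes "entry_polynomial r f" "entry_polynomial r g"
  shows "ld X (\<lambda>x. f x * g x) = (\<lambda>x. ld X f x * g x + f x * ld X g x)"
proof (rule ext, rule ld_eqI)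
  fix x
  show "((\<lambda>t. f (\<lambda>i. x i + t *\<^sub>R (x i ** X i)) * g (\<lambda>i. x i + t *\<^sub>R (x i ** X i)))
    has_real_derivative ld X f x * g x + f x * ld X g x) (at 0)"
    using DERIV_mult[OF ld_has_derivative[OF assms(1), of x X] ld_has_derivative[OF assms(2), of x X]]
    by (simp add: algebra_simps)
qed

lemma ld_entry_polynomial: "entry_polynomial r f \<Longrightarrow> entry_polynomial r (ld X f)"
  by (induction rule: entry_polynomial.induct)
    (auto simp: ld_const ld_entry ld_add ld_mult intro: entry_polynomial.intros entry_polynomial_mult_right)

lemma ld_mult_right:
  assumes "i \<in> {1..r}"
  shows "ld X (\<lambda>x. (x i ** (A::mat2)) $ j $ k) = (\<lambda>x. (x i ** (X i ** A)) $ j $ k)"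
proof (rule ext, rule ld_eqI)
  fix x :: "nat \<Rightarrow> mat2"
  have "(\<lambda>t. ((x i + t *\<^sub>R (x i ** X i)) ** A) $ j $ k) = (\<lambda>t. (x i ** A)$j$k + t * ((x i ** (X i ** A))$j$k))"
    by (simp add: mat2_mult_distrib matrix_mul_assoc)
  then show "((\<lambda>t. ((x i + t *\<^sub>R (x i ** X i)) ** A) $ j $ k) has_real_derivative (x i ** (X i ** A)) $ j $ k) (at 0)"
    by (auto intro!: derivative_eq_intros)
qed

lemma ld_linear:
  assumes "entry_polynomial r f"
  shows "ld (\<lambda>i. c *\<^sub>R X i + d *\<^sub>R Y i) f g = c * ld X f g + d * ld Y f g"
  using assms
  by (induction) (auto simp: ld_const ld_entry ld_add ld_mult mat2_mult_distrib algebra_simps)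

lemma ld_cong:
  assumes "entry_polynomial r f" "\<And>i. i \<in> {1..r} \<Longrightarrow> X i = Y i"
  shows "ld X f = ld Y f"
  using assms(1)
  by (induction) (use assms(2) in \<open>auto simp: ld_const ld_entry ld_add ld_mult\<close>)

text \<open>Second order terms cancel in the commutator, so both sides are derivations in
  \<open>f\<close> and only the matrix entries have to be compared.\<close>

lemma ld_bracket:
  assumes "entry_polynomial r f"
  shows "ld (\<lambda>i. brk (X i) (Y i)) f g = ld X (ld Y f) g - ld Y (ld X f) g"
  using assms
proof (induction arbitrary: g)
  case (entry i j k)
  show ?case unfolding ld_entry ld_mult_right[OF entry] by (simp add: brk_def mat2_mult_distrib)
next
  case (add f h)
  note P = add.hyps ld_entry_polynomial[OF add.hyps(1)] ld_entry_polynomial[OF add.hyps(2)]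
  show ?case by (simp add: ld_add[OF P(1,2)] ld_add[OF P(3,4)] add.IH)
next
  case (mult f h)
  note P = mult.hyps ld_entry_polynomial[OF mult.hyps(1)] ld_entry_polynomial[OF mult.hyps(2)]
  show ?case
    unfolding ld_mult[OF P(1,2)] ld_add[OF entry_polynomial.mult entry_polynomial.mult, OF P(3,2) P(1,4)]
      ld_mult[OF P(3,2)] ld_mult[OF P(1,4)] mult.IH
    by (simp add: algebra_simps)
qed (simp add: ld_const)

lemma ld_translate: "ld X (\<lambda>x. f (\<lambda>i. y i ** x i)) g = ld X f (\<lambda>i. y i ** g i)"
  by (simp add: ld_def mat2_mult_distrib matrix_mul_assoc)

lemma ld_conj:
  assumes f: "entry_polynomial r f" and y: "\<And>i. i \<in> {1..r} \<Longrightarrow> det (y i) = 1"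
  shows "ld X (\<lambda>x. f (\<lambda>i. y i ** x i ** adj2 (y i))) (\<lambda>i. mat 1) = ld (\<lambda>i. y i ** X i ** adj2 (y i)) f (\<lambda>i. mat 1)"
proof -
  have "f (\<lambda>i. y i ** (mat 1 + t *\<^sub>R X i) ** adj2 (y i)) = f (\<lambda>i. mat 1 + t *\<^sub>R (y i ** X i ** adj2 (y i)))" for t
    by (rule entry_polynomial_cong[OF f]) (simp add: mat2_mult_distrib y)
  then show ?thesis by (simp add: ld_def)
qed

lemma entry_polynomial_path:
  assumes "entry_polynomial r f"
  shows "\<exists>q. \<forall>t. f (\<lambda>i. A i + t *\<^sub>R B i) = poly q t"
  using assms
proof induction
  case (const c)
  show ?case by (intro exI[of _ "[:c:]"]) simp
next
  case (entry i j k)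
  show ?case by (intro exI[of _ "[:A i $ j $ k, B i $ j $ k:]"]) simp
next
  case (add f g)
  then obtain p q where "\<forall>t. f (\<lambda>i. A i + t *\<^sub>R B i) = poly p t" "\<forall>t. g (\<lambda>i. A i + t *\<^sub>R B i) = poly q t" by blast
  then show ?case by (intro exI[of _ "p + q"]) simp
next
  case (mult f g)
  then obtain p q where "\<forall>t. f (\<lambda>i. A i + t *\<^sub>R B i) = poly p t" "\<forall>t. g (\<lambda>i. A i + t *\<^sub>R B i) = poly q t" by blast
  then show ?case by (intro exI[of _ "p * q"]) simp
qed

text \<open>Along \<open>g (1 + t X)\<close> with \<open>X\<^sup>2 = 0\<close>, the derivative of a polynomial \<open>f\<close> is \<open>ld X f\<close>, so all
  Taylor coefficients at \<open>t = 0\<close> vanish.\<close>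

lemma vanish_along_nilpotent:
  assumes V: "\<And>f. f \<in> V \<Longrightarrow> entry_polynomial r f \<and> f g = 0 \<and> ld X f \<in> V"
    and nil: "\<And>i. X i ** X i = 0" and f: "f \<in> V"
  shows "f (\<lambda>i. g i + t *\<^sub>R (g i ** X i)) = 0"
proof -
  have zero: "q = 0" if "f \<in> V" "\<forall>t. f (\<lambda>i. g i + t *\<^sub>R (g i ** X i)) = poly q t" for q f
    using that
  proof (induction "degree q" arbitrary: q f rule: less_induct)
    case less
    have fE: "entry_polynomial r f" "f g = 0" "ld X f \<in> V" using V[OF less.prems(1)] by auto
    have der: "ld X f (\<lambda>i. g i + t *\<^sub>R (g i ** X i)) = poly (pderiv q) t" for t
    proof (rule ld_eqI)
      \<comment> \<open>Since \<open>X^2 = 0\<close>,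
        \<open>(1 + t X) (1 + s X) = 1 + (t + s) X\<close>: the line is a one-parameter group, and
        \<open>ld X f\<close> along it is the ordinary derivative.\<close>
      have "(\<lambda>s. f (\<lambda>i. (g i + t *\<^sub>R (g i ** X i)) + s *\<^sub>R ((g i + t *\<^sub>R (g i ** X i)) ** X i)))
          = (\<lambda>s. f (\<lambda>i. g i + (t + s) *\<^sub>R (g i ** X i)))"
        by (simp add: mat2_mult_distrib mat2_mult_assoc nil algebra_simps)
      also have "\<dots> = (\<lambda>s. poly q (s + t))" using less.prems(2) by (simp add: add.commute)
      finally show "((\<lambda>s. f (\<lambda>i. (g i + t *\<^sub>R (g i ** X i)) + s *\<^sub>R ((g i + t *\<^sub>R (g i ** X i)) ** X i)))
          has_real_derivative poly (pderiv q) t) (at 0)"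
        using poly_DERIV[of q "0 + t"] DERIV_shift[of "poly q" "poly (pderiv q) t" 0 t] by simp
    qed
    have "poly q 0 = 0" using spec[OF less.prems(2), of 0] fE(2) by simp
    have "degree q = 0"
    proof (rule ccontr)
      assume "degree q \<noteq> 0"
      then have "degree (pderiv q) < degree q" by (simp add: degree_pderiv)
      then have "pderiv q = 0" using less.hyps fE(3) der by blast
      with \<open>degree q \<noteq> 0\<close> show False by (simp add: pderiv_eq_0_iff)
    qed
    then obtain c where "q = [:c:]" using degree_eq_zeroE by blast
    with \<open>poly q 0 = 0\<close> show "q = 0" by simp
  qed
  obtain q where q: "\<forall>t. f (\<lambda>i. g i + t *\<^sub>R (g i ** X i)) = poly q t"
    using entry_polynomial_path[of r f g "\<lambda>i. g i ** X i"] V[OF f] by blast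
  show ?thesis using q zero[OF f q] by simp
qed

text \<open>Three factors suffice once the lower left entry is nonzero. The fourth arranges this:
  for \<open>M$2$1 = 0\<close> the value \<open>z = -1\<close> moves the nonzero entry
  \<open>M$2$2\<close> there.\<close>

lemma SL2_elementary_factorization:
  fixes M :: mat2
  assumes "det M = 1"
  obtains x c y z where
    "M = mat2 1 x 0 1 ** mat2 1 0 c 1 ** mat2 1 y 0 1 ** mat2 1 0 z 1"
proof -
  define z where "z = (if M$2$1 = 0 then -1 else 0::real)"
  define N where "N = M ** mat2 1 0 (- z) 1"
  have dN: "det N = 1" using assms by (simp add: N_def det2_mult) (simp add: det_2)
  have MN: "M = N ** mat2 1 0 z 1"
    by (simp add: N_def mat2_simps algebra_simps)
  have c: "N$2$1 \<noteq> 0"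
    using assms by (auto simp: N_def z_def mat2_mult_nth det_2)
  define c x y where "c = N$2$1" and "x = (N$1$1 - 1) / c" and "y = (N$2$2 - 1) / c"
  have c0: "c \<noteq> 0" using c by (simp add: c_def)
  have xc: "x * c = N$1$1 - 1" and cy: "c * y = N$2$2 - 1" using c0 by (simp_all add: x_def y_def)
  have "c * N$1$2 = N$1$1 * N$2$2 - 1" using dN by (simp add: det_2 c_def algebra_simps)
  also have "\<dots> = c * ((x * c + 1) * y + x)" 
  proof -
    have "N$1$1 = 1 + x * c" "N$2$2 = 1 + c * y" using xc cy by simp_all
    then show ?thesis by (simp add: algebra_simps)
  qed
  finally have b: "N$1$2 = (x * c + 1) * y + x" using c0 by simp
  have "N = mat2 1 x 0 1 ** mat2 1 0 c 1 ** mat2 1 y 0 1"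
    using xc cy b by (simp add: mat2_eq_iff mat2_mult_nth c_def algebra_simps)
  with MN that show ?thesis by metis
qed

section \<open>Exponential sums and logarithms\<close>

text \<open>The formal sum of the pairs \<open>(c, \<mu>)\<close> stands for the exponential sum \<open>\<Sum> c \<mu>\<^sup>n\<close>.\<close>

definition evl :: "(complex \<times> complex) list \<Rightarrow> (complex \<Rightarrow> complex) \<Rightarrow> complex" where
  "evl xs h = (\<Sum>p\<leftarrow>xs. fst p * h (snd p))"

lemma evl_simps [simp]: "evl [] h = 0" "evl (p # xs) h = fst p * h (snd p) + evl xs h"
  "evl (xs @ ys) h = evl xs h + evl ys h"
  by (auto simp: evl_def)

lemma interpolation:
  fixes h :: "complex \<Rightarrow> complex"
  assumes "finite S" shows "\<exists>p. \<forall>x\<in>S. poly p x = h x"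
  using assms
proof (induction S)
  case (insert a S)
  then obtain p where p: "\<forall>x\<in>S. poly p x = h x" by blast
  define q where "q = (\<Prod>x\<in>S. [:- x, 1:])"
  have q: "poly q x = (\<Prod>y\<in>S. x - y)" for x by (simp add: q_def poly_prod)
  have "poly q a \<noteq> 0" using insert.hyps by (auto simp: q)
  moreover have "poly q x = 0" if "x \<in> S" for x using insert.hyps that by (auto simp: q)
  ultimately show ?case using p
    by (intro exI[of _ "p + Polynomial.smult ((h a - poly p a) / poly q a) q"]) auto
qed simp

lemma evl_sum: "evl xs (\<lambda>x. \<Sum>j\<in>J. a j * g j x) = (\<Sum>j\<in>J. a j * evl xs (g j))"
  by (induction xs) (simp_all add: sum_distrib_left sum.distrib algebra_simps)

text \<open>On the finitely many bases \<open>h\<close> agrees with a polynomial, and the sum at a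
  polynomial is a combination of the vanishing power sums.\<close>

lemma evl_zero:
  assumes "\<And>n. evl xs (\<lambda>x. x ^ n) = 0"
  shows "evl xs h = 0"
proof -
  obtain p where p: "\<forall>x\<in>snd ` set xs. poly p x = h x" using interpolation[of "snd ` set xs" h] by auto
  have "evl xs h = evl xs (poly p)"
    unfolding evl_def by (intro arg_cong[of _ _ sum_list] map_cong) (use p in auto)
  also have "poly p = (\<lambda>x. \<Sum>j\<le>degree p. coeff p j * x ^ j)" by (rule ext) (simp add: poly_altdef)
  also have "evl xs \<dots> = 0" unfolding evl_sum using assms by simp
  finally show ?thesis .
qed

definition evl_prod :: "(complex \<times> complex) list \<Rightarrow> (complex \<times> complex) list \<Rightarrow> (complex \<times> complex) list" where
  "evl_prod xs ys = concat (map (\<lambda>p. map (\<lambda>q. (fst p * fst q, snd p * snd q)) ys) xs)"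

lemma evl_map: "evl (map (\<lambda>q. (c * fst q, m * snd q)) ys) h = c * evl ys (\<lambda>x. h (m * x))"
  by (induction ys) (auto simp: algebra_simps)

lemma evl_evl_prod: "evl (evl_prod xs ys) h = evl xs (\<lambda>x. evl ys (\<lambda>y. h (x * y)))"
  by (induction xs) (auto simp: evl_prod_def evl_map)

lemma evl_mult: "evl xs (\<lambda>x. c * g x) = c * evl xs g" "evl xs (\<lambda>x. g x * c) = evl xs g * c"
  "evl xs (\<lambda>x. f x + g x) = evl xs f + evl xs g"
  by (induction xs) (auto simp: algebra_simps)

lemma evl_cong: "(\<And>p. p \<in> set xs \<Longrightarrow> f (snd p) = g (snd p)) \<Longrightarrow> evl xs f = evl xs g"
  by (induction xs) auto

text \<open>\<open>\<lambda>\<close> is an eigenvalue, \<open>\<kappa> tpart \<gamma>\<close> the logarithm of the hyperbolic part of \<open>\<gamma>\<close>.\<close>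

lemma log_data:
  assumes "\<bar>t\<bar> \<noteq> (2::real)"
  obtains l :: complex and k :: real where "l \<noteq> 0" "l + 1 / l = of_real t" "l \<noteq> 1 / l"
    "of_real k * (l - 1 / l) = 2 * of_real (ln (cmod l))" "\<bar>t\<bar> > 2 \<Longrightarrow> k \<noteq> 0"
proof (cases "\<bar>t\<bar> > 2")
  case True
  \<comment> \<open>The companion matrix makes \<open>hyperbolic_diagonalize\<close> applicable, so
    \<open>l\<close> is real.\<close>
  define h where "h = mat2 t (-1) 1 0"
  have h: "det h = 1" "trace h = t" by (simp_all add: h_def det_2 trace2)
  obtain S l where S: "det S = 1" "\<bar>l\<bar> > 1" "adj2 S ** h ** S = mat2 l 0 0 (1 / l)"
    using hyperbolic_diagonalize[OF h(1)] h(2) True by auto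
  have "trace (adj2 S ** h ** S) = trace (S ** (adj2 S ** h))" by (rule trace2_mult_commute)
  also have "\<dots> = t" using S(1) h by (simp add: matrix_mul_assoc)
  finally have t: "l + 1 / l = t" unfolding S(3) by (simp add: trace2)
  have l0: "l \<noteq> 0" using S(2) by auto
  have l1: "l \<noteq> 1 / l"
  proof
    assume "l = 1 / l"
    then have "l * l = 1" using l0 by (simp add: field_simps)
    then have "\<bar>l\<bar> = 1" by (simp add: square_eq_1_iff) auto
    with S(2) show False by simp
  qed
  define k where "k = 2 * ln \<bar>l\<bar> / (l - 1 / l)"
  show ?thesis
  proof (rule that[of "of_real l" k])
    show "complex_of_real l + 1 / complex_of_real l = of_real t"
      unfolding t[symmetric] by simp
    show "complex_of_real l \<noteq> 1 / complex_of_real l"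
    proof
      assume "complex_of_real l = 1 / complex_of_real l"
      then have "complex_of_real l = complex_of_real (1 / l)" by simp
      then show False using l1 by (simp only: of_real_eq_iff)
    qed
    have "k * (l - 1 / l) = 2 * ln \<bar>l\<bar>" using l1 by (simp add: k_def)
    then have "complex_of_real (k * (l - 1 / l)) = complex_of_real (2 * ln \<bar>l\<bar>)" by (simp only:)
    then show "of_real k * (complex_of_real l - 1 / complex_of_real l) = 2 * of_real (ln (cmod (of_real l)))"
      by simp
    show "k \<noteq> 0" using S(2) l1 by (simp add: k_def)
  qed (use l0 in simp)
next
  case False
  then have "\<bar>t\<bar> < 2" using assms by simp
  then have "t\<^sup>2 < 4" using abs_square_less_1[of "t / 2"] by (simp add: power_divide)
  then have s: "1 - (t / 2)\<^sup>2 > 0" by (simp add: power_divide)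
  \<comment> \<open>An eigenvalue on the unit circle: \<open>ln (cmod l) = 0\<close>, so the
    hyperbolic part is trivial and \<open>k = 0\<close>.\<close>
  define l where "l = Complex (t / 2) (sqrt (1 - (t / 2)\<^sup>2))"
  have "(cmod l)\<^sup>2 = 1" using s by (simp add: l_def cmod_power2)
  then have n: "cmod l = 1" by (simp add: power2_eq_1_iff) (use norm_ge_zero[of l] in linarith)
  then have l0: "l \<noteq> 0" by auto
  have "l * cnj l = 1" using n by (simp add: complex_norm_square[symmetric])
  then have inv: "1 / l = cnj l" using l0 by (simp add: field_simps)
  have "sqrt (1 - (t / 2)\<^sup>2) > 0" using s by simp
  then have "l \<noteq> cnj l" by (simp add: l_def complex_eq_iff)
  moreover have "l + cnj l = of_real t" by (simp add: l_def complex_eq_iff)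
  ultimately show ?thesis using that[of l 0] l0 n inv False by simp
qed

text \<open>Both sides satisfy the Cayley-Hamilton recursion; the coefficients solve the initial
  conditions \<open>d\<close> at \<open>n = 0\<close> and \<open>e\<close> at
  \<open>n = 1\<close>.\<close>

lemma mpow_entry:
  fixes g :: mat2 and l :: complex and j k :: 2
  assumes g: "det g = 1" and l: "l \<noteq> 0" "l + 1 / l = of_real (trace g)" "l \<noteq> 1 / l"
  defines "d \<equiv> of_real ((mat 1 :: mat2)$j$k)" and "e \<equiv> of_real (g$j$k)"
  shows "of_real (mpow g n $ j $ k) =
    (e - d / l) / (l - 1 / l) * l ^ n + (l * d - e) / (l - 1 / l) * (1 / l) ^ n"
proof -
  define m where "m = 1 / l"
  have lm: "l * m = 1" using l(1) by (simp add: m_def)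
  have lm0: "l - m \<noteq> 0" using l(3) by (simp add: m_def)
  define A B where "A = (e - d * m) / (l - m)" and "B = (l * d - e) / (l - m)"
  have AB: "A * (l - m) = e - d * m" "B * (l - m) = l * d - e" using lm0 by (simp_all add: A_def B_def)
  have ABd: "A + B = d"
  proof -
    have "(A + B) * (l - m) = d * (l - m)" 
      unfolding distrib_right AB by (simp add: algebra_simps)
    then show ?thesis using lm0 by simp
  qed
  have ABe: "A * l + B * m = e"
  proof -
    have "(A * l + B * m) * (l - m) = A * (l - m) * l + B * (l - m) * m" by (simp add: algebra_simps)
    also have "\<dots> = e * (l - m) + (d - d) * (l * m)" unfolding AB by (simp add: algebra_simps)
    finally show ?thesis using lm0 by simp
  qed
  have CH: "mpow g (Suc (Suc n)) $ j $ k = trace g * mpow g (Suc n) $ j $ k - mpow g n $ j $ k" for n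
  proof -
    have "g ** g = trace g *\<^sub>R g - mat 1"
      using adj2_mult(1)[of g] g by (simp add: adj2_def mat2_mult_distrib) (metis add_diff_cancel_left' diff_add_cancel)
    then have "mpow g (Suc (Suc n)) = trace g *\<^sub>R mpow g (Suc n) - mpow g n"
      by (simp add: mat2_mult_assoc mat2_mult_distrib)
    then show ?thesis by simp
  qed
  have "of_real (mpow g n $ j $ k) = A * l ^ n + B * m ^ n"
  proof (induction n rule: induct_nat_012)
    case 0
    show ?case using ABd by (simp add: d_def)
  next
    case 1
    show ?case using ABe by (simp add: e_def)
  next
    case (ge2 n)
    have "of_real (mpow g (Suc (Suc n)) $ j $ k) = (l + m) * (A * l ^ Suc n + B * m ^ Suc n) - (A * l ^ n + B * m ^ n)"
      unfolding CH of_real_diff of_real_mult ge2.IH using l(2) by (simp add: m_def)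
    also have "\<dots> = A * l ^ Suc (Suc n) + B * m ^ Suc (Suc n) + (l * m - 1) * (A * l ^ n + B * m ^ n)"
      by (simp add: algebra_simps)
    finally show ?case using lm by simp
  qed
  then show ?thesis by (simp add: A_def B_def m_def)
qed

text \<open>One formal sum yields the values on powers and, with \<open>ln (cmod x)\<close> in place
  of \<open>x^n\<close>, the derivative at the identity. Multiplying polynomials multiplies bases,
  and the logarithm of a product becomes the Leibniz rule; this is why nonzero bases are
  recorded.\<close>

lemma entry_polynomial_on_powers:
  assumes f: "entry_polynomial r f"
    and g: "\<And>i. i \<in> {1..r} \<Longrightarrow> det (g i) = 1"
    and l: "\<And>i. i \<in> {1..r} \<Longrightarrow> l i \<noteq> 0" "\<And>i. i \<in> {1..r} \<Longrightarrow> l i + 1 / l i = of_real (trace (g i))"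
      "\<And>i. i \<in> {1..r} \<Longrightarrow> l i \<noteq> 1 / l i"
    and k: "\<And>i. i \<in> {1..r} \<Longrightarrow> of_real (k i) * (l i - 1 / l i) = 2 * of_real (ln (cmod (l i)))"
  shows "\<exists>xs. (\<forall>p\<in>set xs. snd p \<noteq> 0) \<and> (\<forall>n. of_real (f (\<lambda>i. mpow (g i) n)) = evl xs (\<lambda>x. x ^ n)) \<and>
    of_real (ld (\<lambda>i. k i *\<^sub>R tpart (g i)) f (\<lambda>i. mat 1)) = evl xs (\<lambda>x. of_real (ln (cmod x)))"
  using f
proof induction
  case (const c)
  show ?case by (intro exI[of _ "[(of_real c, 1)]"]) (simp add: ld_const)
next
  case (entry i a b)
  define d e where "d = complex_of_real ((mat 1 :: mat2)$a$b)" and "e = complex_of_real (g i$a$b)"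
  define D where "D = l i - 1 / l i"
  have D0: "D \<noteq> 0" using l(3)[OF entry] by (simp add: D_def)
  let ?xs = "[((e - d / l i) / D, l i), ((l i * d - e) / D, 1 / l i)]"
  have "of_real (mpow (g i) n $ a $ b) = evl ?xs (\<lambda>x. x ^ n)" for n
    using mpow_entry[OF g[OF entry] l(1)[OF entry] l(2)[OF entry] l(3)[OF entry], of n a b]
    by (simp add: d_def e_def D_def)
  moreover have "of_real (ld (\<lambda>i. k i *\<^sub>R tpart (g i)) (\<lambda>x. x i $ a $ b) (\<lambda>i. mat 1)) = evl ?xs (\<lambda>x. of_real (ln (cmod x)))"
  proof -
    have "(tpart (g i)) $ a $ b = g i $ a $ b - trace (g i) / 2 * (mat 1 :: mat2) $ a $ b" by simp
    then have G: "2 * of_real ((tpart (g i)) $ a $ b) = 2 * e - (l i + 1 / l i) * d"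
      by (simp add: d_def e_def l(2)[OF entry])
    have "2 * (of_real (k i) * of_real ((tpart (g i)) $ a $ b) * D) = (of_real (k i) * D) * (2 * of_real ((tpart (g i)) $ a $ b))"
      by simp
    also have "\<dots> = 2 * (of_real (ln (cmod (l i))) * (2 * e - (l i + 1 / l i) * d))"
      unfolding G unfolding D_def k[OF entry] by simp
    also have "2 * e - (l i + 1 / l i) * d = (e - d / l i) - (l i * d - e)"
      by (simp add: algebra_simps)
    finally have 1: "of_real (k i) * of_real ((tpart (g i)) $ a $ b) * D = of_real (ln (cmod (l i))) * ((e - d / l i) - (l i * d - e))"
      by (simp only: mult_cancel_left) simp
    have "ln (cmod (1 / l i)) = - ln (cmod (l i))"
      using l(1)[OF entry] by (simp add: norm_divide ln_div)
    then have "evl ?xs (\<lambda>x. of_real (ln (cmod x))) * D = of_real (ln (cmod (l i))) * ((e - d / l i) - (l i * d - e))"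
      using D0 by (simp add: algebra_simps add_divide_distrib diff_divide_distrib)
    with 1 have "of_real (k i) * of_real ((tpart (g i)) $ a $ b) * D = evl ?xs (\<lambda>x. of_real (ln (cmod x))) * D" by simp
    then have "of_real (k i) * of_real ((tpart (g i)) $ a $ b) = evl ?xs (\<lambda>x. of_real (ln (cmod x)))"
      using D0 by (simp only: mult_cancel_right) simp
    then show ?thesis by (simp add: ld_entry)
  qed
  ultimately show ?case using l(1)[OF entry] by (intro exI[of _ ?xs]) auto
next
  case (add f h)
  then obtain xs ys where "\<forall>p\<in>set xs. snd p \<noteq> 0" "\<forall>n. of_real (f (\<lambda>i. mpow (g i) n)) = evl xs (\<lambda>x. x ^ n)"
    "of_real (ld (\<lambda>i. k i *\<^sub>R tpart (g i)) f (\<lambda>i. mat 1)) = evl xs (\<lambda>x. of_real (ln (cmod x)))"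
    "\<forall>p\<in>set ys. snd p \<noteq> 0" "\<forall>n. of_real (h (\<lambda>i. mpow (g i) n)) = evl ys (\<lambda>x. x ^ n)"
    "of_real (ld (\<lambda>i. k i *\<^sub>R tpart (g i)) h (\<lambda>i. mat 1)) = evl ys (\<lambda>x. of_real (ln (cmod x)))" by metis
  then show ?case by (intro exI[of _ "xs @ ys"]) (auto simp: ld_add[OF add.hyps])
next
  case (mult f h)
  from mult.IH(1) obtain xs where x: "\<And>p. p \<in> set xs \<Longrightarrow> snd p \<noteq> 0" "\<And>n. of_real (f (\<lambda>i. mpow (g i) n)) = evl xs (\<lambda>x. x ^ n)"
    "of_real (ld (\<lambda>i. k i *\<^sub>R tpart (g i)) f (\<lambda>i. mat 1)) = evl xs (\<lambda>x. of_real (ln (cmod x)))" by blast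
  from mult.IH(2) obtain ys where y: "\<And>p. p \<in> set ys \<Longrightarrow> snd p \<noteq> 0" "\<And>n. of_real (h (\<lambda>i. mpow (g i) n)) = evl ys (\<lambda>x. x ^ n)"
    "of_real (ld (\<lambda>i. k i *\<^sub>R tpart (g i)) h (\<lambda>i. mat 1)) = evl ys (\<lambda>x. of_real (ln (cmod x)))" by blast
  have nz: "\<forall>p\<in>set (evl_prod xs ys). snd p \<noteq> 0" using x(1) y(1) by (auto simp: evl_prod_def)
  have ev: "of_real (f (\<lambda>i. mpow (g i) n) * h (\<lambda>i. mpow (g i) n)) = evl (evl_prod xs ys) (\<lambda>x. x ^ n)" for n
    by (simp add: x(2) y(2) evl_evl_prod power_mult_distrib evl_mult)
  have x1: "of_real (f (\<lambda>i. mat 1)) = evl xs (\<lambda>x. 1)" using x(2)[of 0] by simp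
  have y1: "of_real (h (\<lambda>i. mat 1)) = evl ys (\<lambda>x. 1)" using y(2)[of 0] by simp
  have "evl (evl_prod xs ys) (\<lambda>x. of_real (ln (cmod x))) =
      evl xs (\<lambda>x. evl ys (\<lambda>y. of_real (ln (cmod x)) * 1 + of_real (ln (cmod y))))"
    unfolding evl_evl_prod
    by (intro evl_cong) (auto simp: norm_mult ln_mult x(1) y(1))
  also have "\<dots> = evl xs (\<lambda>x. of_real (ln (cmod x))) * evl ys (\<lambda>x. 1) + evl xs (\<lambda>x. 1) * evl ys (\<lambda>x. of_real (ln (cmod x)))"
  proof -
    let ?L = "\<lambda>x. complex_of_real (ln (cmod x))"
    have inner: "evl ys (\<lambda>y. ?L x * 1 + ?L y) = ?L x * evl ys (\<lambda>_. 1) + 1 * evl ys ?L" for x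
      by (simp only: evl_mult(3) evl_mult(1)[of ys "?L x" "\<lambda>_. 1"] mult_1_left)
    show ?thesis
      unfolding inner
      by (simp only: evl_mult(3) evl_mult(2)[of xs ?L] evl_mult(2)[of xs "\<lambda>_. 1"])
  qed
  finally have "evl (evl_prod xs ys) (\<lambda>x. of_real (ln (cmod x))) = of_real (ld (\<lambda>i. k i *\<^sub>R tpart (g i)) (\<lambda>x. f x * h x) (\<lambda>i. mat 1))"
    by (simp add: ld_mult[OF mult.hyps] x(3) y(3) x1 y1)
  with nz ev show ?case by (intro exI[of _ "evl_prod xs ys"]) simp
qed

section \<open>Vanishing ideal and tangent space of a group of lifts\<close>

definition sg :: "nat \<Rightarrow> mat2 \<Rightarrow> nat \<Rightarrow> mat2" where
  "sg i Z = (\<lambda>k. if k = i then Z else 0)"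

locale tangent =
  fixes r :: nat and T :: "(nat \<Rightarrow> mat2) set"
  assumes T_det: "T \<subseteq> SLr r" and T_mult: "\<And>x y. x \<in> T \<Longrightarrow> y \<in> T \<Longrightarrow> (\<lambda>i. x i ** y i) \<in> T"
    and T_one: "(\<lambda>i. mat 1) \<in> T" and T_adj: "\<And>x. x \<in> T \<Longrightarrow> (\<lambda>i. adj2 (x i)) \<in> T"
begin

definition Van :: "((nat \<Rightarrow> mat2) \<Rightarrow> real) set" where
  "Van = {f. entry_polynomial r f \<and> (\<forall>x\<in>T. f x = 0)}"

definition tanspace :: "(nat \<Rightarrow> mat2) set" where
  "tanspace = {X. \<forall>f\<in>Van. ld X f (\<lambda>i. mat 1) = 0}"

lemma Van_poly: "f \<in> Van \<Longrightarrow> entry_polynomial r f"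
  by (simp add: Van_def)

lemma T_det1: "x \<in> T \<Longrightarrow> i \<in> {1..r} \<Longrightarrow> det (x i) = 1"
  using T_det by (auto simp: SLr_def)

text \<open>Left translation by \<open>T\<close> preserves the vanishing ideal, so derivatives that
  vanish at the identity on the whole ideal vanish at every point of \<open>T\<close>.\<close>

lemma ld_Van:
  assumes X: "X \<in> tanspace" and f: "f \<in> Van"
  shows "ld X f \<in> Van"
  unfolding Van_def
proof (intro CollectI conjI ballI)
  show "entry_polynomial r (ld X f)" by (intro ld_entry_polynomial Van_poly f)
  fix y assume y: "y \<in> T"
  have "(\<lambda>x. f (\<lambda>i. y i ** x i)) \<in> Van"
    using f y T_mult by (auto simp: Van_def intro: entry_polynomial_translate)
  then have "ld X (\<lambda>x. f (\<lambda>i. y i ** x i)) (\<lambda>i. mat 1) = 0" using X by (simp add: tanspace_def)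
  then show "ld X f y = 0" unfolding ld_translate by simp
qed

lemma tan_linear: "X \<in> tanspace \<Longrightarrow> Y \<in> tanspace \<Longrightarrow> (\<lambda>i. c *\<^sub>R X i + d *\<^sub>R Y i) \<in> tanspace"
  by (simp add: tanspace_def ld_linear[OF Van_poly])

lemma tan_brk: "X \<in> tanspace \<Longrightarrow> Y \<in> tanspace \<Longrightarrow> (\<lambda>i. brk (X i) (Y i)) \<in> tanspace"
  unfolding tanspace_def mem_Collect_eq
proof
  fix f assume XY: "\<forall>f\<in>Van. ld X f (\<lambda>i. mat 1) = 0" "\<forall>f\<in>Van. ld Y f (\<lambda>i. mat 1) = 0" and f: "f \<in> Van"
  then have "ld X f \<in> Van" "ld Y f \<in> Van" using ld_Van by (auto simp: tanspace_def)
  then show "ld (\<lambda>i. brk (X i) (Y i)) f (\<lambda>i. mat 1) = 0"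
    using XY by (simp add: ld_bracket[OF Van_poly[OF f]])
qed

lemma tan_cong: "X \<in> tanspace \<Longrightarrow> (\<And>i. i \<in> {1..r} \<Longrightarrow> Y i = X i) \<Longrightarrow> Y \<in> tanspace"
  unfolding tanspace_def using ld_cong[OF Van_poly, of _ Y X] by auto

lemma tan_conj:
  assumes "X \<in> tanspace" "y \<in> T"
  shows "(\<lambda>i. y i ** X i ** adj2 (y i)) \<in> tanspace"
  unfolding tanspace_def mem_Collect_eq
proof
  fix f assume f: "f \<in> Van"
  have "(\<lambda>x. f (\<lambda>i. y i ** x i ** adj2 (y i))) \<in> Van"
    using f T_mult[OF T_mult[OF assms(2)] T_adj[OF assms(2)]]
      entry_polynomial_translate(1)[OF entry_polynomial_translate(2)[OF Van_poly[OF f], of "\<lambda>i. adj2 (y i)"], of y]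
    by (auto simp: Van_def)
  then have "ld X (\<lambda>x. f (\<lambda>i. y i ** x i ** adj2 (y i))) (\<lambda>i. mat 1) = 0" using assms(1) by (simp add: tanspace_def)
  then show "ld (\<lambda>i. y i ** X i ** adj2 (y i)) f (\<lambda>i. mat 1) = 0"
    using ld_conj[OF Van_poly[OF f], of y X] T_det1[OF assms(2)] by simp
qed

text \<open>\<open>det (x i) - 1\<close> is in the vanishing ideal, and its derivative at the
  identity is the trace.\<close>

lemma tan_traceless:
  assumes X: "X \<in> tanspace" and i: "i \<in> {1..r}"
  shows "trace (X i) = 0"
proof -
  define f where "f x = x i $ 1 $ 1 * x i $ 2 $ 2 + ((-1) * (x i $ 1 $ 2 * x i $ 2 $ 1) + (-1))" for x :: "nat \<Rightarrow> mat2"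
  have fd: "f x = det (x i) - 1" for x by (simp add: f_def det_2)
  have E: "entry_polynomial r f" unfolding f_def using i by (intro entry_polynomial.intros)
  then have "f \<in> Van" using T_det1 i by (auto simp: Van_def fd)
  then have "ld X f (\<lambda>i. mat 1) = 0" using X by (simp add: tanspace_def)
  moreover have "ld X f (\<lambda>i. mat 1) = trace (X i)"
  proof (rule ld_eqI)
    have "(\<lambda>t. f (\<lambda>i. mat 1 + t *\<^sub>R (mat 1 ** X i))) = (\<lambda>t. t * trace (X i) + t\<^sup>2 * det (X i))"
      by (rule ext) (simp add: fd mat2_simps power2_eq_square algebra_simps)
    then show "((\<lambda>t. f (\<lambda>i. mat 1 + t *\<^sub>R (mat 1 ** X i))) has_real_derivative trace (X i)) (at 0)"
      by (auto intro!: derivative_eq_intros)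
  qed
  ultimately show ?thesis by simp
qed

lemma T_mpow: "x \<in> T \<Longrightarrow> (\<lambda>i. mpow (x i) n) \<in> T"
  by (induction n) (auto intro: T_one T_mult)

text \<open>For \<open>f\<close> in the vanishing ideal, \<open>f (g\<^sup>n) = \<Sum> c \<mu>\<^sup>n\<close> is zero for all \<open>n\<close>. Hence \<open>\<Sum> c h(\<mu>) = 0\<close> for every
  function \<open>h\<close>, and \<open>h(\<mu>) = ln \<bar>\<mu>\<bar>\<close> gives the derivative of \<open>f\<close> at the identity along the logarithm of the
  hyperbolic part of \<open>g\<close>.\<close>

lemma tan_log:
  assumes g: "g \<in> T" and ne: "\<And>i. i \<in> {1..r} \<Longrightarrow> \<bar>trace (g i)\<bar> \<noteq> 2"
  obtains k where "(\<lambda>i. k i *\<^sub>R tpart (g i)) \<in> tanspace" "\<And>i. i \<in> {1..r} \<Longrightarrow> \<bar>trace (g i)\<bar> > 2 \<Longrightarrow> k i \<noteq> 0"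
proof -
  have "\<forall>i\<in>{1..r}. \<exists>(l::complex) (k::real). l \<noteq> 0 \<and> l + 1 / l = of_real (trace (g i)) \<and> l \<noteq> 1 / l \<and>
      of_real k * (l - 1 / l) = 2 * of_real (ln (cmod l)) \<and> (\<bar>trace (g i)\<bar> > 2 \<longrightarrow> k \<noteq> 0)"
  proof
    fix i assume "i \<in> {1..r}"
    from log_data[OF ne[OF this]] obtain l :: complex and k :: real where "l \<noteq> 0" "l + 1 / l = of_real (trace (g i))" "l \<noteq> 1 / l"
      "of_real k * (l - 1 / l) = 2 * of_real (ln (cmod l))" "\<bar>trace (g i)\<bar> > 2 \<Longrightarrow> k \<noteq> 0" by metis
    then show "\<exists>(l::complex) (k::real). l \<noteq> 0 \<and> l + 1 / l = of_real (trace (g i)) \<and> l \<noteq> 1 / l \<and>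
      of_real k * (l - 1 / l) = 2 * of_real (ln (cmod l)) \<and> (\<bar>trace (g i)\<bar> > 2 \<longrightarrow> k \<noteq> 0)" by blast
  qed
  then obtain l :: "nat \<Rightarrow> complex" and k :: "nat \<Rightarrow> real" where lk: "\<And>i. i \<in> {1..r} \<Longrightarrow> l i \<noteq> 0 \<and> l i + 1 / l i = of_real (trace (g i)) \<and> l i \<noteq> 1 / l i \<and>
      of_real (k i) * (l i - 1 / l i) = 2 * of_real (ln (cmod (l i))) \<and> (\<bar>trace (g i)\<bar> > 2 \<longrightarrow> k i \<noteq> 0)" by metis
  have "(\<lambda>i. k i *\<^sub>R tpart (g i)) \<in> tanspace"
    unfolding tanspace_def mem_Collect_eq
  proof
    fix f assume f: "f \<in> Van"
    obtain xs where xs: "\<forall>n. of_real (f (\<lambda>i. mpow (g i) n)) = evl xs (\<lambda>x. x ^ n)"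
      "of_real (ld (\<lambda>i. k i *\<^sub>R tpart (g i)) f (\<lambda>i. mat 1)) = evl xs (\<lambda>x. of_real (ln (cmod x)))"
      using entry_polynomial_on_powers[OF Van_poly[OF f], of g l k] T_det1[OF g] lk by blast
    have "f (\<lambda>i. mpow (g i) n) = 0" for n using f T_mpow[OF g] by (auto simp: Van_def)
    then have "evl xs (\<lambda>x. x ^ n) = 0" for n using spec[OF xs(1), of n] by simp
    then have "evl xs (\<lambda>x. of_real (ln (cmod x))) = 0" by (rule evl_zero)
    then show "ld (\<lambda>i. k i *\<^sub>R tpart (g i)) f (\<lambda>i. mat 1) = 0" using xs(2) by simp
  qed
  then show ?thesis using that lk by blast
qed

text \<open>From the identity, unipotent steps in single factors reach every point, because
  elementary matrices generate \<open>SL(2,R)\<close>. Each step stays in the zero set by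
  \<open>vanish_along_nilpotent\<close>, as \<open>Van\<close> is closed under \<open>ld\<close> by
  \<open>ld_Van\<close>.\<close>

lemma vanish_if_full:
  assumes full: "\<And>i Z. i \<in> {1..r} \<Longrightarrow> trace Z = 0 \<Longrightarrow> sg i Z \<in> tanspace"
    and f: "f \<in> Van" and x: "x \<in> SLr r"
  shows "f x = 0"
proof -
  define P where "P g \<longleftrightarrow> (\<forall>f\<in>Van. f g = 0)" for g
  have step: "P (g(i := g i ** (mat 1 + t *\<^sub>R Z)))" if P: "P g" and i: "i \<in> {1..r}" and Z: "trace Z = 0" "Z ** Z = 0" for g i Z t
    unfolding P_def
  proof
    fix f assume f: "f \<in> Van"
    have "f (\<lambda>k. g k + t *\<^sub>R (g k ** sg i Z k)) = 0"
    proof (rule vanish_along_nilpotent[where V = Van and r = r])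
      show "entry_polynomial r f \<and> f g = 0 \<and> ld (sg i Z) f \<in> Van" if "f \<in> Van" for f
        using that P Van_poly[OF that] ld_Van[OF full[OF i Z(1)] that] by (simp add: P_def)
    qed (use Z f in \<open>auto simp: sg_def\<close>)
    moreover have "(\<lambda>k. g k + t *\<^sub>R (g k ** sg i Z k)) = g(i := g i ** (mat 1 + t *\<^sub>R Z))"
      by (rule ext) (simp add: sg_def mat2_mult_distrib)
    ultimately show "f (g(i := g i ** (mat 1 + t *\<^sub>R Z))) = 0" by simp
  qed
  have up: "P (g(i := g i ** mat2 1 t 0 1))" if "P g" "i \<in> {1..r}" for g i t
  proof -
    have "mat2 1 t 0 1 = mat 1 + t *\<^sub>R mat2 0 1 0 0" by (simp add: mat2_eq_iff)
    then show ?thesis by (simp only:) (rule step[OF that], simp_all add: mat2_simps)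
  qed
  have low: "P (g(i := g i ** mat2 1 0 t 1))" if "P g" "i \<in> {1..r}" for g i t
  proof -
    have "mat2 1 0 t 1 = mat 1 + t *\<^sub>R mat2 0 0 1 0" by (simp add: mat2_eq_iff)
    then show ?thesis by (simp only:) (rule step[OF that], simp_all add: mat2_simps)
  qed
  have mul: "P (g(i := g i ** M))" if P: "P g" and i: "i \<in> {1..r}" and M: "det M = 1" for g i M
  proof -
    obtain a c b z where F: "M = mat2 1 a 0 1 ** mat2 1 0 c 1 ** mat2 1 b 0 1 ** mat2 1 0 z 1"
      using SL2_elementary_factorization[OF M] .
    have "P (g(i := g i ** mat2 1 a 0 1 ** mat2 1 0 c 1 ** mat2 1 b 0 1 ** mat2 1 0 z 1))"
      using low[OF up[OF low[OF up[OF P i, of a] i, of c] i, of b] i, of z] by simp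
    then show ?thesis unfolding F by (simp add: matrix_mul_assoc)
  qed
  \<comment> \<open>The components of \<open>x\<close> replace those of the identity one at a
    time.\<close>
  have "P (\<lambda>k. if k \<in> {1..m} then x k else mat 1)" if "m \<le> r" for m
    using that
  proof (induction m)
    case 0
    show ?case using T_one by (auto simp: P_def Van_def)
  next
    case (Suc m)
    let ?g = "\<lambda>k. if k \<in> {1..m} then x k else mat 1"
    have "P (?g(Suc m := ?g (Suc m) ** x (Suc m)))"
      using Suc x by (intro mul) (auto simp: SLr_def)
    moreover have "?g(Suc m := ?g (Suc m) ** x (Suc m)) = (\<lambda>k. if k \<in> {1..Suc m} then x k else mat 1)"
      by (auto simp: fun_eq_iff)
    ultimately show ?case by simp
  qed
  from this[of r] have "f (\<lambda>k. if k \<in> {1..r} then x k else mat 1) = 0" using f by (auto simp: P_def)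
  moreover have "f (\<lambda>k. if k \<in> {1..r} then x k else mat 1) = f x"
    by (rule entry_polynomial_cong[OF Van_poly[OF f]]) auto
  ultimately show ?thesis by simp
qed

end

section \<open>Projections of the tangent space and relations between two components\<close>

lemma brk_tpart: "brk (tpart A) (tpart B) = brk A B"
  by (simp add: brk_def mat2_mult_distrib algebra_simps)

lemma det_tpart: "4 * det (tpart A) = 4 * det A - (trace A)\<^sup>2"
proof -
  have "det (A - s *\<^sub>R mat 1) = det A - s * trace A + s\<^sup>2" for s
    by (simp add: mat2_simps power2_eq_square algebra_simps)
  then show ?thesis by (simp add: power2_eq_square)
qed

lemma det_tpart_nonzero: "det A = 1 \<Longrightarrow> \<bar>trace A\<bar> > 2 \<Longrightarrow> det (tpart A) \<noteq> 0"
proof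
  assume A: "det A = 1" "\<bar>trace A\<bar> > 2" "det (tpart A) = 0"
  then have "(trace A)\<^sup>2 = 2\<^sup>2" using det_tpart[of A] by simp
  then have "\<bar>trace A\<bar> = 2" by (metis abs_numeral power2_eq_iff_nonneg abs_ge_zero power2_abs)
  with A(2) show False by simp
qed

context tangent
begin

text \<open>By \<open>tan_log\<close> the projection contains the traceless parts \<open>U\<close>,
  \<open>V\<close> of \<open>h i\<close>, \<open>k i\<close>; \<open>reg\<close> guarantees the
  distinct eigenvalues required there. It is closed under brackets, and \<open>U\<close>,
  \<open>[U, V]\<close>, \<open>U [U, V] = [U, [U, V]] / 2\<close> span the traceless
  matrices.\<close>

lemma tan_surj:
  assumes i: "i \<in> {1..r}" and h: "h \<in> T" "\<bar>trace (h i)\<bar> > 2" and k: "k \<in> T" "\<bar>trace (k i)\<bar> > 2"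
    and d: "det (h i ** k i - k i ** h i) \<noteq> 0"
    and reg: "\<And>x j. x \<in> T \<Longrightarrow> j \<in> {1..r} \<Longrightarrow> \<bar>trace (x i)\<bar> > 2 \<Longrightarrow> \<bar>trace (x j)\<bar> \<noteq> 2"
    and Z: "trace Z = 0"
  obtains X where "X \<in> tanspace" "X i = Z"
proof -
  define D where "D = (\<lambda>X. X i) ` tanspace"
  have lin: "c *\<^sub>R A + d *\<^sub>R B \<in> D" if AB: "A \<in> D" "B \<in> D" for c d A B
  proof -
    obtain X Y where X: "X \<in> tanspace" "A = X i" and Y: "Y \<in> tanspace" "B = Y i" using AB unfolding D_def by blast
    show ?thesis unfolding D_def X(2) Y(2) by (rule image_eqI[OF _ tan_linear[OF X(1) Y(1)]]) simp
  qed
  have br: "brk A B \<in> D" if AB: "A \<in> D" "B \<in> D" for A B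
  proof -
    obtain X Y where X: "X \<in> tanspace" "A = X i" and Y: "Y \<in> tanspace" "B = Y i" using AB unfolding D_def by blast
    show ?thesis unfolding D_def X(2) Y(2) by (rule image_eqI[OF _ tan_brk[OF X(1) Y(1)]]) simp
  qed
  have sc: "c *\<^sub>R A \<in> D" if "A \<in> D" for c A using lin[OF that that, of c 0] by simp
  have tlD: "tpart (x i) \<in> D" if x: "x \<in> T" "\<bar>trace (x i)\<bar> > 2" for x
  proof -
    obtain c where c: "(\<lambda>i. c i *\<^sub>R tpart (x i)) \<in> tanspace" "\<And>i. i \<in> {1..r} \<Longrightarrow> \<bar>trace (x i)\<bar> > 2 \<Longrightarrow> c i \<noteq> 0"
      using tan_log[OF x(1)] reg[OF x(1) _ x(2)] by blast
    have "c i *\<^sub>R tpart (x i) \<in> D" unfolding D_def by (rule image_eqI[OF _ c(1)]) simp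
    then have "inverse (c i) *\<^sub>R c i *\<^sub>R tpart (x i) \<in> D" by (rule sc)
    then show ?thesis using c(2)[OF i x(2)] by simp
  qed
  define U V where "U = tpart (h i)" and "V = tpart (k i)"
  have UV: "U \<in> D" "V \<in> D" using tlD h k by (auto simp: U_def V_def)
  have "quaternion_pair U (brk U V)"
  proof (rule commutator_pair)
    show "det U \<noteq> 0" unfolding U_def by (rule det_tpart_nonzero[OF T_det1[OF h(1) i] h(2)])
    show "det (brk U V) \<noteq> 0" using d unfolding U_def V_def brk_tpart by (simp add: brk_def)
  qed (simp_all add: U_def V_def)
  then interpret quaternion_pair U "brk U V" .
  obtain \<alpha> \<beta> \<gamma> where e: "Z = \<alpha> *\<^sub>R U + \<beta> *\<^sub>R brk U V + \<gamma> *\<^sub>R (U ** brk U V)"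
    using traceless_expansion[OF Z] .
  have "brk U (brk U V) = U ** brk U V + U ** brk U V"
    using anti unfolding brk_def[of U "brk U V"] by simp
  then have "U ** brk U V = (1/2) *\<^sub>R brk U (brk U V)"
    by (simp add: scaleR_2[symmetric])
  then have "U ** brk U V \<in> D" using sc br UV by metis
  then have "1 *\<^sub>R (\<alpha> *\<^sub>R U + \<beta> *\<^sub>R brk U V) + \<gamma> *\<^sub>R (U ** brk U V) \<in> D" by (intro lin br UV)
  then have "Z \<in> D" by (simp add: e)
  then show ?thesis using that unfolding D_def by blast
qed

text \<open>A tangent vector of minimal support among those that do not vanish at \<open>i\<close> shows that the \<open>i\<close>-th component
  determines the \<open>j\<close>-th one for some \<open>j \<noteq> i\<close>, through a Lie homomorphism.\<close>

lemma dichotomy: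
  assumes hyp: "\<And>i. i \<in> {1..r} \<Longrightarrow> \<exists>h\<in>T. \<exists>k\<in>T. \<bar>trace (h i)\<bar> > 2 \<and> \<bar>trace (k i)\<bar> > 2 \<and> det (h i ** k i - k i ** h i) \<noteq> 0"
    and reg: "\<And>x i j. x \<in> T \<Longrightarrow> i \<in> {1..r} \<Longrightarrow> j \<in> {1..r} \<Longrightarrow> \<bar>trace (x i)\<bar> > 2 \<Longrightarrow> \<bar>trace (x j)\<bar> \<noteq> 2"
    and not_dense: "\<not> (\<forall>f\<in>Van. \<forall>x\<in>SLr r. f x = 0)"
  obtains i j \<theta> where "i \<in> {1..r}" "j \<in> {1..r}" "i \<noteq> j"
    "\<And>A B. \<theta> (A ** B) = \<theta> A ** \<theta> B" "\<And>A. trace (\<theta> A) = trace A"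
    "\<And>x. x \<in> T \<Longrightarrow> \<theta> (x i) = x j \<or> \<theta> (x i) = - x j"
proof -
  have surj: "\<exists>X\<in>tanspace. X i = Z" if iZ: "i \<in> {1..r}" "trace Z = 0" for i Z
  proof -
    obtain h k where hk: "h \<in> T" "k \<in> T" "\<bar>trace (h i)\<bar> > 2" "\<bar>trace (k i)\<bar> > 2" "det (h i ** k i - k i ** h i) \<noteq> 0"
      using hyp[OF iZ(1)] by blast
    show ?thesis
    proof (rule tan_surj[of i h k Z])
      show "\<bar>trace (x j)\<bar> \<noteq> 2" if "x \<in> T" "j \<in> {1..r}" "\<bar>trace (x i)\<bar> > 2" for x j
        using reg[OF that(1) iZ(1) that(2,3)] .
    qed (use iZ hk in blast)+
  qed
  have lin: "(\<lambda>i. c *\<^sub>R X i + d *\<^sub>R Y i) \<in> tanspace" if "X \<in> tanspace" "Y \<in> tanspace" for c d X Y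
    by (rule tan_linear[OF that])
  have "\<exists>i\<in>{1..r}. \<exists>Z. trace Z = 0 \<and> sg i Z \<notin> tanspace"
    using vanish_if_full not_dense by blast
  then obtain i Z0 where i: "i \<in> {1..r}" and Z0: "trace Z0 = 0" "sg i Z0 \<notin> tanspace" by blast
  define supp where "supp X = {k \<in> {1..r}. X k \<noteq> (0::mat2)}" for X
  have fin: "finite (supp X)" for X by (simp add: supp_def)
  define good where "good X \<longleftrightarrow> X \<in> tanspace \<and> X i \<noteq> 0" for X
  have "\<exists>X. good X"
  proof -
    have "trace (mat2 0 1 0 0) = 0" by (simp add: trace2)
    then obtain X where "X \<in> tanspace" "X i = mat2 0 1 0 0" using surj[OF i] by blast
    moreover have "mat2 0 1 0 0 \<noteq> 0" by (simp add: mat2_eq_iff)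
    ultimately show ?thesis unfolding good_def by metis
  qed
  then obtain X0 where X0: "good X0" and min: "\<And>X. good X \<Longrightarrow> card (supp X0) \<le> card (supp X)"
    using ex_has_least_nat[of good _ "\<lambda>X. card (supp X)"] by metis
  define I where "I = supp X0"
  define tI where "tI = {X \<in> tanspace. supp X \<subseteq> I}"
  have X0I: "X0 \<in> tI" using X0 by (simp add: tI_def I_def good_def)
  have tI_iff: "X \<in> tI \<longleftrightarrow> X \<in> tanspace \<and> (\<forall>k\<in>{1..r} - I. X k = 0)" for X
    unfolding tI_def supp_def by blast
  have tI_lin: "(\<lambda>k. c *\<^sub>R X k + d *\<^sub>R Y k) \<in> tI" if "X \<in> tI" "Y \<in> tI" for c d X Y
    using that lin[of X Y c d] unfolding tI_iff by simp
  have tI_brk: "(\<lambda>k. brk (Y k) (X k)) \<in> tI" if "X \<in> tI" "Y \<in> tanspace" for X Y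
    using that tan_brk[of Y X] unfolding tI_iff by (simp add: brk_add)
  have tI_tr: "trace (X k) = 0" if "X \<in> tI" "k \<in> {1..r}" for X k
    using that tan_traceless by (auto simp: tI_def)
  have tI_tan: "X \<in> tanspace" if "X \<in> tI" for X using that by (simp add: tI_def)
  \<comment> \<open>Brackets with arbitrary tangent vectors do not enlarge supports, and by
    \<open>surj\<close> such vectors take every traceless value at \<open>k\<close>; so a whole
    ideal of \<open>sl(2,R)\<close> arises, not just a subalgebra.\<close>
  have ideal: "lie_ideal ((\<lambda>X. X k) ` {X \<in> tI. X i = 0})" if k: "k \<in> {1..r}" for k
    unfolding lie_ideal_def
  proof (intro conjI ballI allI impI)
    fix A assume "A \<in> (\<lambda>X. X k) ` {X \<in> tI. X i = 0}"
    then obtain X where X: "X \<in> tI" "X i = 0" "A = X k" by blast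
    show "trace A = 0" using X tI_tr k by simp
    show "c *\<^sub>R A \<in> (\<lambda>X. X k) ` {X \<in> tI. X i = 0}" for c
      using tI_lin[OF X(1,1), of c 0] X by (intro image_eqI[of _ _ "\<lambda>k. c *\<^sub>R X k + 0 *\<^sub>R X k"]) auto
    show "A + B \<in> (\<lambda>X. X k) ` {X \<in> tI. X i = 0}" if B: "B \<in> (\<lambda>X. X k) ` {X \<in> tI. X i = 0}" for B
    proof -
      obtain Y where Y: "Y \<in> tI" "Y i = 0" "B = Y k" using B by blast
      show ?thesis
        using tI_lin[OF X(1) Y(1), of 1 1] X Y by (intro image_eqI[of _ _ "\<lambda>k. 1 *\<^sub>R X k + 1 *\<^sub>R Y k"]) auto
    qed
    show "brk B A \<in> (\<lambda>X. X k) ` {X \<in> tI. X i = 0}" if trB: "trace B = 0" for B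
    proof -
      obtain Y where Y: "Y \<in> tanspace" "Y k = B" using surj[OF k trB] by blast
      show ?thesis
        using tI_brk[OF X(1) Y(1)] X Y by (intro image_eqI[of _ _ "\<lambda>k. brk (Y k) (X k)"]) (auto simp: brk_add)
    qed
  qed
  \<comment> \<open>Otherwise the ideal at \<open>k\<close> is everything, and subtracting from
    \<open>X0\<close> a vector that agrees with it at \<open>k\<close> and vanishes at
    \<open>i\<close> contradicts minimality.\<close>
  have kernel: "X k = 0" if X: "X \<in> tI" "X i = 0" and k: "k \<in> I" "k \<noteq> i" for X k
  proof (rule ccontr)
    assume ne: "X k \<noteq> 0"
    have k': "k \<in> {1..r}" using k by (auto simp: I_def supp_def)
    have "X0 k \<in> (\<lambda>X. X k) ` {X \<in> tI. X i = 0}"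
      by (rule lie_ideal_all[OF ideal[OF k'] _ ne tI_tr[OF X0I k']]) (use X in auto)
    then obtain Y where Y: "Y \<in> tI" "Y i = 0" "Y k = X0 k" by auto
    define W where "W = (\<lambda>k. 1 *\<^sub>R X0 k + (-1) *\<^sub>R Y k)"
    have W: "W \<in> tI" unfolding W_def by (rule tI_lin[OF X0I Y(1)])
    have "good W" using W X0 Y(2) by (simp add: good_def W_def tI_def)
    then have "card (supp X0) \<le> card (supp W)" by (rule min)
    moreover have "supp W \<subseteq> I - {k}" using W Y(3) by (auto simp: tI_def supp_def W_def)
    then have "card (supp W) < card I"
      using k(1) fin[of X0] by (intro psubset_card_mono) (auto simp: I_def)
    ultimately show False by (simp add: I_def)
  qed
  have iI: "i \<in> I" using X0 i by (auto simp: I_def supp_def good_def)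
  have onto: "\<exists>X\<in>tI. X i = Z" if Z: "trace Z = 0" for Z
  proof -
    have "lie_ideal ((\<lambda>X. X i) ` tI)"
      unfolding lie_ideal_def
    proof (intro conjI ballI allI impI)
      fix A assume "A \<in> (\<lambda>X. X i) ` tI"
      then obtain X where X: "X \<in> tI" "A = X i" by blast
      show "trace A = 0" using X tI_tr i by simp
      show "c *\<^sub>R A \<in> (\<lambda>X. X i) ` tI" for c
        using tI_lin[OF X(1,1), of c 0] X by (intro image_eqI[of _ _ "\<lambda>k. c *\<^sub>R X k + 0 *\<^sub>R X k"]) auto
      show "A + B \<in> (\<lambda>X. X i) ` tI" if B: "B \<in> (\<lambda>X. X i) ` tI" for B
      proof -
        obtain Y where Y: "Y \<in> tI" "B = Y i" using B by blast
        show ?thesis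
          using tI_lin[OF X(1) Y(1), of 1 1] X Y by (intro image_eqI[of _ _ "\<lambda>k. 1 *\<^sub>R X k + 1 *\<^sub>R Y k"]) auto
      qed
      show "brk B A \<in> (\<lambda>X. X i) ` tI" if trB: "trace B = 0" for B
      proof -
        obtain Y where Y: "Y \<in> tanspace" "Y i = B" using surj[OF i trB] by blast
        show ?thesis
          using tI_brk[OF X(1) Y(1)] X Y by (intro image_eqI[of _ _ "\<lambda>k. brk (Y k) (X k)"]) auto
      qed
    qed
    from lie_ideal_all[OF this imageI[OF X0I] _ Z] X0 show ?thesis by (auto simp: good_def)
  qed
  \<comment> \<open>If \<open>I\<close> were \<open>{i}\<close>, the vector \<open>sg i Z0\<close>
    would be tangent, against its choice.\<close>
  have "\<exists>j\<in>I. j \<noteq> i"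
  proof (rule ccontr)
    assume "\<not> ?thesis"
    then have I: "I \<subseteq> {i}" by blast
    obtain X where X: "X \<in> tI" "X i = Z0" using onto[OF Z0(1)] by blast
    have "sg i Z0 \<in> tanspace"
    proof (rule tan_cong[OF tI_tan[OF X(1)]])
      fix k assume "k \<in> {1..r}"
      then show "sg i Z0 k = X k" using X I by (auto simp: sg_def tI_def supp_def)
    qed
    with Z0 show False by simp
  qed
  then obtain j where j: "j \<in> I" "j \<noteq> i" by blast
  have jr: "j \<in> {1..r}" using j by (auto simp: I_def supp_def)
  \<comment> \<open>By \<open>kernel\<close> the \<open>j\<close>-th component of a vector in
    \<open>tI\<close> depends only on the \<open>i\<close>-th one; \<open>T0\<close> is this
    dependence, and any choice in \<open>sel\<close> gives the same value.\<close>
  define sel where "sel Z = (SOME X. X \<in> tI \<and> X i = Z)" for Z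
  define T0 where "T0 Z = sel Z j" for Z
  have sel: "sel Z \<in> tI" "sel Z i = Z" if "trace Z = 0" for Z
    using someI_ex[of "\<lambda>X. X \<in> tI \<and> X i = Z"] onto[OF that] unfolding sel_def by blast+
  have T0: "T0 (X i) = X j" if X: "X \<in> tI" for X
  proof -
    have tr: "trace (X i) = 0" using tI_tr[OF X i] .
    have "(\<lambda>k. 1 *\<^sub>R sel (X i) k + (-1) *\<^sub>R X k) j = 0"
      by (rule kernel[OF tI_lin[OF sel(1)[OF tr] X] _ j]) (simp add: sel(2)[OF tr])
    then show ?thesis by (simp add: T0_def)
  qed
  have add: "T0 (A + B) = T0 A + T0 B" if "trace A = 0" "trace B = 0" for A B
    using T0[OF tI_lin[OF sel(1)[OF that(1)] sel(1)[OF that(2)], of 1 1]] sel(2)[OF that(1)] sel(2)[OF that(2)]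
    by (simp add: T0_def)
  have scale: "T0 (c *\<^sub>R A) = c *\<^sub>R T0 A" if "trace A = 0" for c A
    using T0[OF tI_lin[OF sel(1)[OF that] sel(1)[OF that], of c 0]] sel(2)[OF that]
    by (simp add: T0_def)
  have trT: "trace (T0 A) = 0" if "trace A = 0" for A
    unfolding T0_def by (rule tI_tr[OF sel(1)[OF that] jr])
  have br: "T0 (brk A B) = brk (T0 A) (T0 B)" if "trace A = 0" "trace B = 0" for A B
    using T0[OF tI_brk[OF sel(1)[OF that(2)] tI_tan[OF sel(1)[OF that(1)]]]] sel(2)[OF that(1)] sel(2)[OF that(2)]
    by (simp add: T0_def)
  have nz: "trace (X0 i) = 0" "T0 (X0 i) \<noteq> 0"
    using tI_tr[OF X0I i] T0[OF X0I] j(1) by (auto simp: I_def supp_def)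
  define \<theta> where "\<theta> = (\<lambda>M. (trace M / 2) *\<^sub>R mat 1 + T0 (tpart M))"
  have \<theta>: "\<theta> (A ** B) = \<theta> A ** \<theta> B" "trace (\<theta> A) = trace A" "\<theta> (mat 1) = mat 1"
    and detT: "trace A = 0 \<Longrightarrow> det (T0 A) = det A" for A B
    unfolding \<theta>_def by (rule lie_hom_extends[OF add scale trT br nz], assumption+)+
  have \<theta>T: "\<theta> A = T0 A" if "trace A = 0" for A using that by (simp add: \<theta>_def)
  have T00: "T0 0 = 0" using scale[of 0 0] by simp
  have adj: "\<theta> (adj2 A) = adj2 (\<theta> A)" for A
  proof -
    have e: "tpart (adj2 A) = (-1) *\<^sub>R tpart A" by (simp add: adj2_def mat2_eq_iff trace2)
    have "\<theta> (adj2 A) = (trace (adj2 A) / 2) *\<^sub>R mat 1 + T0 (tpart (adj2 A))"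
      by (simp only: \<theta>_def)
    also have "T0 (tpart (adj2 A)) = (-1) *\<^sub>R T0 (tpart A)" unfolding e by (rule scale) simp
    also have "trace (adj2 A) = trace A" by simp
    also have "(trace A / 2) *\<^sub>R mat 1 + (-1) *\<^sub>R T0 (tpart A) = adj2 (\<theta> A)"
      unfolding adj2_def \<theta>(2) unfolding \<theta>_def by (simp add: mat2_eq_iff)
    finally show ?thesis .
  qed
  \<comment> \<open>Conjugation by \<open>T\<close> preserves tangent vectors and supports, so
    \<open>T0\<close> intertwines the adjoint actions of \<open>x i\<close> and
    \<open>x j\<close>.\<close>
  have equiv: "T0 (x i ** A ** adj2 (x i)) = x j ** T0 A ** adj2 (x j)" if x: "x \<in> T" and A: "trace A = 0" for x A
  proof -
    have "(\<lambda>k. x k ** sel A k ** adj2 (x k)) \<in> tI"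
      using tan_conj[OF tI_tan[OF sel(1)[OF A]] x] sel(1)[OF A] unfolding tI_iff by simp
    from T0[OF this] show ?thesis by (simp add: sel(2)[OF A] T0_def)
  qed
  show ?thesis
  proof (rule that[OF i jr _ \<theta>(1,2)])
    show "i \<noteq> j" using j by simp
    fix x assume x: "x \<in> T"
    have dx: "det (x i) = 1" "det (x j) = 1" using T_det1[OF x] i jr by auto
    define G where "G = \<theta> (x i)"
    have GG: "G ** adj2 G = mat 1"
      unfolding G_def adj[symmetric] \<theta>(1)[symmetric] using dx by (simp add: \<theta>(3))
    then have dG: "det G = 1" by (simp add: mat2_eq_iff)
    \<comment> \<open>\<open>G\<close> and \<open>x j\<close> conjugate the image of
      \<open>T0\<close> in the same way. So \<open>M\<close> commutes with a quaternion pair, is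
      scalar, and has determinant 1: only a sign is left.\<close>
    define M where "M = adj2 G ** x j"
    have com: "M ** T0 A = T0 A ** M" if A: "trace A = 0" for A
    proof -
      have tr': "trace (x i ** A ** adj2 (x i)) = 0"
      proof -
        have "trace (x i ** A ** adj2 (x i)) = trace (adj2 (x i) ** (x i ** A))" by (rule trace2_mult_commute)
        then show ?thesis using dx A by (simp add: matrix_mul_assoc)
      qed
      have "x j ** T0 A ** adj2 (x j) = G ** T0 A ** adj2 G"
        unfolding equiv[OF x A, symmetric] \<theta>T[OF tr', symmetric] \<theta>(1) adj \<theta>T[OF A] G_def ..
      then have "adj2 G ** (x j ** T0 A ** adj2 (x j)) ** x j = adj2 G ** (G ** T0 A ** adj2 G) ** x j" by simp
      moreover have "adj2 G ** (x j ** T0 A ** adj2 (x j)) ** x j = M ** T0 A"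
      proof -
        have "adj2 G ** (x j ** T0 A ** adj2 (x j)) ** x j = M ** T0 A ** (adj2 (x j) ** x j)"
          by (simp only: M_def matrix_mul_assoc)
        then show ?thesis using dx by simp
      qed
      moreover have "adj2 G ** (G ** T0 A ** adj2 G) ** x j = T0 A ** M"
      proof -
        have "adj2 G ** (G ** T0 A ** adj2 G) ** x j = (adj2 G ** G) ** T0 A ** M"
          by (simp only: M_def matrix_mul_assoc)
        then show ?thesis using dG by simp
      qed
      ultimately show ?thesis by simp
    qed
    define P Q where "P = T0 (mat2 1 0 0 (-1))" and "Q = T0 (mat2 0 1 1 0)"
    have tr0: "trace (mat2 1 0 0 (-1)) = 0" "trace (mat2 0 1 1 0) = 0" by (simp_all add: trace2)
    interpret quaternion_pair P Q
    proof
      show "trace P = 0" "trace Q = 0" using trT tr0 by (simp_all add: P_def Q_def)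
      show "det P \<noteq> 0" "det Q \<noteq> 0" using detT tr0 by (simp_all add: P_def Q_def det_2)
      have "trace (mat2 1 0 0 (-1) ** mat2 0 1 1 0) = 0" by (simp add: trace2 mat2_mult_nth)
      then have "trace (P ** Q) = 0"
        unfolding P_def Q_def \<theta>T[OF tr0(1), symmetric] \<theta>T[OF tr0(2), symmetric] \<theta>(1)[symmetric] \<theta>(2) .
      then show "P ** Q = - (Q ** P)"
        by (intro traceless_anticommute) (use trT tr0 in \<open>simp_all add: P_def Q_def\<close>)
    qed
    define c where "c = trace M / 2"
    have Mc: "M = c *\<^sub>R mat 1" unfolding c_def
      by (rule commutant) (use com tr0 in \<open>simp_all add: P_def Q_def\<close>)
    have "det M = 1" by (simp add: M_def det2_mult dG dx)
    then have "c\<^sup>2 = 1" unfolding Mc by simp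
    then have c: "c = 1 \<or> c = - 1" by (simp add: power2_eq_1_iff)
    have "x j = G ** M" unfolding M_def by (simp add: matrix_mul_assoc dG)
    also have "\<dots> = c *\<^sub>R G" unfolding Mc by simp
    finally show "\<theta> (x i) = x j \<or> \<theta> (x i) = - x j" using c by (auto simp: G_def)
  qed
qed

end

section \<open>Quaternion algebras\<close>

definition qtr :: "quat4 \<Rightarrow> real" where
  "qtr x = 2 * fst x"

lemma quat_mult_assoc: "quat_mult a b (quat_mult a b x y) z = quat_mult a b x (quat_mult a b y z)"
  by (cases x; cases y; cases z) (simp add: algebra_simps)

lemma quat_mult_one [simp]: "quat_mult a b (1, 0, 0, 0) x = x" "quat_mult a b x (1, 0, 0, 0) = x"
  by (cases x; simp)+

lemma quat_mult_scalar: "quat_mult a b (c, 0, 0, 0) x = c *\<^sub>R x"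
  by (cases x) simp

lemma quat_mult_scaleR: "quat_mult a b (c *\<^sub>R x) y = c *\<^sub>R quat_mult a b x y" "quat_mult a b x (c *\<^sub>R y) = c *\<^sub>R quat_mult a b x y"
  by (cases x; cases y; simp add: algebra_simps)+

lemma quat_mult_distrib: "quat_mult a b (x + y) z = quat_mult a b x z + quat_mult a b y z"
  "quat_mult a b z (x + y) = quat_mult a b z x + quat_mult a b z y"
  "quat_mult a b (x - y) z = quat_mult a b x z - quat_mult a b y z"
  "quat_mult a b z (x - y) = quat_mult a b z x - quat_mult a b z y"
  by (cases x; cases y; cases z; simp add: algebra_simps)+

lemma quat_square: "quat_mult a b x x = qtr x *\<^sub>R x - reduced_norm a b x *\<^sub>R (1, 0, 0, 0)"
  by (cases x) (simp add: qtr_def algebra_simps power2_eq_square)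

lemma qtr_simps: "qtr (x + y) = qtr x + qtr y" "qtr (x - y) = qtr x - qtr y" "qtr (c *\<^sub>R x) = c * qtr x" "qtr (1, 0, 0, 0) = 2"
  by (auto simp: qtr_def)

lemma reduced_norm_mult: "reduced_norm a b (quat_mult a b x y) = reduced_norm a b x * reduced_norm a b y"
  by (cases x; cases y) (simp add: power2_eq_square algebra_simps)

primrec qpow :: "real \<Rightarrow> real \<Rightarrow> quat4 \<Rightarrow> nat \<Rightarrow> quat4" where
  "qpow a b x 0 = (1, 0, 0, 0)"
| "qpow a b x (Suc n) = quat_mult a b (qpow a b x n) x"

lemma qpow_cheb:
  assumes "reduced_norm a b x = 1"
  shows "qpow a b x (Suc n) = cheb (qtr x) (Suc n) *\<^sub>R x - cheb (qtr x) n *\<^sub>R (1, 0, 0, 0)"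
proof (induction n)
  case (Suc n)
  have "qpow a b x (Suc (Suc n)) = quat_mult a b (cheb (qtr x) (Suc n) *\<^sub>R x - cheb (qtr x) n *\<^sub>R (1, 0, 0, 0)) x"
    using Suc by simp
  also have "\<dots> = cheb (qtr x) (Suc n) *\<^sub>R (qtr x *\<^sub>R x - (1, 0, 0, 0)) - cheb (qtr x) n *\<^sub>R x"
    unfolding quat_mult_distrib quat_mult_scaleR quat_square assms by simp
  also have "\<dots> = cheb (qtr x) (Suc (Suc n)) *\<^sub>R x - cheb (qtr x) (Suc n) *\<^sub>R (1, 0, 0, 0)"
    by (simp only: cheb.simps) (simp add: algebra_simps)
  finally show ?case .
qed (simp add: zero_prod_def)

lemma reduced_norm_qpow: "reduced_norm a b x = 1 \<Longrightarrow> reduced_norm a b (qpow a b x n) = 1"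
  by (induction n) (simp_all add: reduced_norm_mult)

lemma qpow_add: "qpow a b x (m + n) = quat_mult a b (qpow a b x m) (qpow a b x n)"
  by (induction n) (simp_all add: quat_mult_assoc)

lemma qpow_mult: "qpow a b x (m * n) = qpow a b (qpow a b x m) n"
proof (induction n)
  case (Suc n)
  have "m * Suc n = m * n + m" by simp
  then show ?case using Suc by (simp only: qpow_add qpow.simps)
qed simp

text \<open>Strict growth keeps \<open>cheb t n\<close> away from 0, so that no positive power of a
  hyperbolic element is scalar.\<close>

lemma cheb_increasing: "\<bar>t\<bar> > 2 \<Longrightarrow> \<bar>cheb t n\<bar> < \<bar>cheb t (Suc n)\<bar>"
proof (induction n)
  case (Suc n)
  have "2 * \<bar>cheb t (Suc n)\<bar> \<le> \<bar>t\<bar> * \<bar>cheb t (Suc n)\<bar>" using Suc.prems by (intro mult_right_mono) auto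
  also have "\<dots> = \<bar>t * cheb t (Suc n)\<bar>" by (simp add: abs_mult)
  also have "\<dots> \<le> \<bar>cheb t (Suc (Suc n))\<bar> + \<bar>cheb t n\<bar>" by simp
  finally show ?case using Suc by simp
qed simp

lemma cheb_nonzero: "\<bar>t\<bar> > 2 \<Longrightarrow> n > 0 \<Longrightarrow> cheb t n \<noteq> 0"
  using cheb_increasing[of t "n - 1"] by auto

lemma mpow_cheb:
  assumes "det M = 1"
  shows "mpow M (Suc n) = cheb (trace M) (Suc n) *\<^sub>R M - cheb (trace M) n *\<^sub>R mat 1"
proof (induction n)
  case (Suc n)
  have MM: "M ** M = trace M *\<^sub>R M - mat 1"
  proof -
    have "M ** (trace M *\<^sub>R mat 1 - M) = mat 1" using adj2_mult(1)[of M] assms by (simp add: adj2_def)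
    then have "trace M *\<^sub>R M - M ** M = mat 1" by (simp add: mat2_mult_distrib)
    then show ?thesis by (simp add: algebra_simps)
  qed
  have "mpow M (Suc (Suc n)) = (cheb (trace M) (Suc n) *\<^sub>R M - cheb (trace M) n *\<^sub>R mat 1) ** M"
    using Suc by simp
  also have "\<dots> = cheb (trace M) (Suc n) *\<^sub>R (trace M *\<^sub>R M - mat 1) - cheb (trace M) n *\<^sub>R M"
    unfolding mat2_mult_distrib mat2_mult_scaleR MM by simp
  also have "\<dots> = cheb (trace M) (Suc (Suc n)) *\<^sub>R M - cheb (trace M) (Suc n) *\<^sub>R mat 1"
    by (simp only: cheb.simps) (simp add: algebra_simps)
  finally show ?case .
qed simp

lemma mpow_hyperbolic:
  assumes "det M = 1" "\<bar>trace M\<bar> > 2" "n > 0"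
  obtains s q where "s \<noteq> 0" "mpow M n = s *\<^sub>R M + q *\<^sub>R mat 1"
proof -
  obtain m where n: "n = Suc m" using assms(3) gr0_conv_Suc by blast
  have "mpow M n = cheb (trace M) n *\<^sub>R M + (- cheb (trace M) m) *\<^sub>R mat 1"
    unfolding n mpow_cheb[OF assms(1)] by simp
  with that cheb_nonzero[OF assms(2,3)] show ?thesis by blast
qed

text \<open>The averaging operator \<open>z \<mapsto> \<Sum> e z e'\<close> over dual bases, which takes values in the scalars;
  it turns a \<open>K\<close>-rational intertwiner of \<open>P\<close>, \<open>Q\<close> into a conjugating element.\<close>

context quaternion_pair
begin

lemma sandwich:
  fixes z :: mat2
  defines "p \<equiv> - det P" and "q \<equiv> - det Q"
  shows "Q ** (P ** (z ** (P ** Q))) + p *\<^sub>R (Q ** (z ** Q)) + q *\<^sub>R (P ** (z ** P)) + (p * q) *\<^sub>R z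
    = (2 * p * q * trace z) *\<^sub>R mat 1"
proof -
  define M where "M = Q ** (P ** (z ** (P ** Q))) + p *\<^sub>R (Q ** (z ** Q)) + q *\<^sub>R (P ** (z ** P)) + (p * q) *\<^sub>R z"
  have P2: "P ** (P ** A) = p *\<^sub>R A" and Q2: "Q ** (Q ** A) = q *\<^sub>R A" for A :: mat2
    using PP[of A] QQ[of A] by (simp_all add: p_def q_def)
  have P1: "P ** P = p *\<^sub>R mat 1" and Q1: "Q ** Q = q *\<^sub>R mat 1"
    using P2[of "mat 1"] Q2[of "mat 1"] by simp_all
  have c: "A ** P ** B = A ** (P ** B)" "A ** Q ** B = A ** (Q ** B)" for A B :: mat2
    by (simp_all add: matrix_mul_assoc)
  have zPQP: "z ** (P ** (Q ** P)) = - p *\<^sub>R (z ** Q)" 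
    using PQ[of P] by (simp add: P1)
  have zQPQ: "z ** (Q ** (P ** Q)) = - q *\<^sub>R (z ** P)"
  proof -
    have "Q ** (P ** Q) = - (P ** (Q ** Q))" using PQ[of Q] by simp
    then show ?thesis by (simp add: Q1)
  qed
  \<comment> \<open>Multiplying by \<open>P\<close> on the other side exchanges the first two terms
    and the last two; for \<open>Q\<close> it exchanges the first with the third and the second with
    the fourth.\<close>
  have MP: "M ** P = P ** M"
    unfolding M_def mat2_mult_distrib mat2_mult_scaleR mat2_mult_assoc
    using zPQP by (simp add: P1 P2 PQ anti algebra_simps)
  have MQ: "M ** Q = Q ** M"
    unfolding M_def mat2_mult_distrib mat2_mult_scaleR mat2_mult_assoc
    by (simp add: Q1 Q2 algebra_simps)
  have "trace (Q ** (P ** (z ** (P ** Q)))) = p * q * trace z"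
  proof -
    have "trace (Q ** (P ** (z ** (P ** Q)))) = trace ((P ** (z ** (P ** Q))) ** Q)" by (rule trace2_mult_commute)
    also have "\<dots> = q * trace (P ** (z ** P))" by (simp add: mat2_mult_assoc Q1)
    also have "trace (P ** (z ** P)) = trace ((z ** P) ** P)" by (rule trace2_mult_commute)
    also have "\<dots> = p * trace z" by (simp add: mat2_mult_assoc P1)
    finally show ?thesis by simp
  qed
  moreover have "trace (Q ** (z ** Q)) = q * trace z"
    using trace2_mult_commute[of Q "z ** Q"] by (simp add: mat2_mult_assoc Q1)
  moreover have "trace (P ** (z ** P)) = p * trace z"
    using trace2_mult_commute[of P "z ** P"] by (simp add: mat2_mult_assoc P1)
  ultimately have "trace M / 2 = 2 * p * q * trace z"
    by (simp add: M_def)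
  with commutant[OF MP MQ] show ?thesis unfolding M_def by simp
qed

end

locale quaternion_embedding =
  fixes K :: "real set" and a b :: real and f :: "real \<Rightarrow> real" and \<psi> :: "quat4 \<Rightarrow> mat2"
  assumes K: "real_subfield K" and ab: "a \<in> K" "b \<in> K" "a \<noteq> 0" "b \<noteq> 0"
    and f: "real_embedding K f" and ext: "extends_embedding K a b f \<psi>"
begin

abbreviation "A \<equiv> K \<times> K \<times> K \<times> K"
abbreviation "qm \<equiv> quat_mult a b"
abbreviation "nrd \<equiv> reduced_norm a b"

lemma Kc [intro]: "x \<in> K \<Longrightarrow> y \<in> K \<Longrightarrow> x + y \<in> K" "x \<in> K \<Longrightarrow> y \<in> K \<Longrightarrow> x * y \<in> K"
  "x \<in> K \<Longrightarrow> - x \<in> K" "x \<in> K \<Longrightarrow> y \<in> K \<Longrightarrow> x - y \<in> K" "0 \<in> K" "1 \<in> K" "x \<in> K \<Longrightarrow> y \<in> K \<Longrightarrow> x / y \<in> K"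
  "numeral k \<in> K"
  using real_subfieldD[OF K] real_subfield_numeral[OF K] by auto

lemma A_closed:
  "x \<in> A \<Longrightarrow> y \<in> A \<Longrightarrow> x + y \<in> A" "x \<in> A \<Longrightarrow> y \<in> A \<Longrightarrow> x - y \<in> A" "x \<in> A \<Longrightarrow> y \<in> A \<Longrightarrow> qm x y \<in> A"
  "c \<in> K \<Longrightarrow> x \<in> A \<Longrightarrow> c *\<^sub>R x \<in> A" "(1, 0, 0, 0) \<in> A" "x \<in> A \<Longrightarrow> qtr x \<in> K" "x \<in> A \<Longrightarrow> nrd x \<in> K"
proof -
  show "x \<in> A \<Longrightarrow> y \<in> A \<Longrightarrow> x + y \<in> A" "x \<in> A \<Longrightarrow> y \<in> A \<Longrightarrow> x - y \<in> A"
    "c \<in> K \<Longrightarrow> x \<in> A \<Longrightarrow> c *\<^sub>R x \<in> A" "(1, 0, 0, 0) \<in> A" by auto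
  show "qm x y \<in> A" if x: "x \<in> A" and y: "y \<in> A"
  proof -
    obtain x0 x1 x2 x3 where x': "x = (x0, x1, x2, x3)" "x0 \<in> K" "x1 \<in> K" "x2 \<in> K" "x3 \<in> K" using x by auto
    obtain y0 y1 y2 y3 where y': "y = (y0, y1, y2, y3)" "y0 \<in> K" "y1 \<in> K" "y2 \<in> K" "y3 \<in> K" using y by auto
    show ?thesis unfolding x'(1) y'(1) quat_mult.simps
      by (intro SigmaI Kc ab x'(2-5) y'(2-5))
  qed
  show "nrd x \<in> K" if x: "x \<in> A"
  proof -
    obtain x0 x1 x2 x3 where x': "x = (x0, x1, x2, x3)" "x0 \<in> K" "x1 \<in> K" "x2 \<in> K" "x3 \<in> K" using x by auto
    show ?thesis unfolding x'(1) reduced_norm.simps power2_eq_square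
      by (intro Kc ab x'(2-5))
  qed
  show "qtr x \<in> K" if "x \<in> A" using that by (auto simp: qtr_def)
qed

lemma qpow_A: "x \<in> A \<Longrightarrow> qpow a b x n \<in> A"
  by (induction n) (use A_closed in auto)

lemma psi_add: "x \<in> A \<Longrightarrow> y \<in> A \<Longrightarrow> \<psi> (x + y) = \<psi> x + \<psi> y"
  and psi_mult: "x \<in> A \<Longrightarrow> y \<in> A \<Longrightarrow> \<psi> (qm x y) = \<psi> x ** \<psi> y"
  and psi_one: "\<psi> (1, 0, 0, 0) = mat 1"
  and psi_scalar: "c \<in> K \<Longrightarrow> \<psi> (c, 0, 0, 0) = f c *\<^sub>R mat 1"
  and psi_inj: "inj_on \<psi> A"
proof -
  have h: "\<psi> \<in> ring_hom (quaternion_algebra K a b) M2R" and s: "\<forall>c\<in>K. \<psi> (c, 0, 0, 0) = f c *\<^sub>R mat 1"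
    and i: "inj_on \<psi> (carrier (quaternion_algebra K a b))"
    using ext by (auto simp: extends_embedding_def)
  show "x \<in> A \<Longrightarrow> y \<in> A \<Longrightarrow> \<psi> (x + y) = \<psi> x + \<psi> y"
    using ring_hom_add[OF h, of x y] by (simp add: quaternion_algebra_def M2R_def)
  show "x \<in> A \<Longrightarrow> y \<in> A \<Longrightarrow> \<psi> (qm x y) = \<psi> x ** \<psi> y"
    using ring_hom_mult[OF h, of x y] by (simp add: quaternion_algebra_def M2R_def)
  show "\<psi> (1, 0, 0, 0) = mat 1" using ring_hom_one[OF h] by (simp add: quaternion_algebra_def M2R_def)
  show "c \<in> K \<Longrightarrow> \<psi> (c, 0, 0, 0) = f c *\<^sub>R mat 1" using s by blast
  show "inj_on \<psi> A" using i by (simp add: quaternion_algebra_def)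
qed

lemma psi_scaleR: "c \<in> K \<Longrightarrow> x \<in> A \<Longrightarrow> \<psi> (c *\<^sub>R x) = f c *\<^sub>R \<psi> x"
proof -
  assume cx: "c \<in> K" "x \<in> A"
  have "\<psi> (c *\<^sub>R x) = \<psi> (qm (c, 0, 0, 0) x)" by (simp only: quat_mult_scalar)
  also have "\<dots> = \<psi> (c, 0, 0, 0) ** \<psi> x" by (rule psi_mult) (use cx in auto)
  finally show ?thesis using psi_scalar[OF cx(1)] by simp
qed

lemma psi_diff: "x \<in> A \<Longrightarrow> y \<in> A \<Longrightarrow> \<psi> (x - y) = \<psi> x - \<psi> y"
proof -
  assume xy: "x \<in> A" "y \<in> A"
  have "\<psi> (x - y) + \<psi> y = \<psi> (x - y + y)" by (rule psi_add[symmetric]) (use xy A_closed in auto)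
  then show ?thesis by (simp add: algebra_simps)
qed

lemma psi_zero: "\<psi> 0 = 0"
  using psi_diff[of "(1,0,0,0)" "(1,0,0,0)"] A_closed(5) by simp

lemma psi_eq_0: "x \<in> A \<Longrightarrow> \<psi> x = 0 \<Longrightarrow> x = 0"
  using psi_inj psi_zero by (auto dest!: inj_onD[of \<psi> A x 0] simp: zero_prod_def)

abbreviation "qi \<equiv> (0, 1, 0, 0) :: quat4"
abbreviation "qj \<equiv> (0, 0, 1, 0) :: quat4"
abbreviation "qk \<equiv> (0, 0, 0, 1) :: quat4"

text \<open>The images anticommute and their squares are nonzero scalars, so conjugation by one
  generator negates the other, whose trace is therefore 0.\<close>

lemma ij_pair: "quaternion_pair (\<psi> qi) (\<psi> qj)"
proof -
  have ijA: "qi \<in> A" "qj \<in> A" "qk \<in> A" by auto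
  have fa: "f a \<noteq> 0" "f b \<noteq> 0" using embedding_eq_0[OF K f] ab by auto
  have ii: "\<psi> qi ** \<psi> qi = f a *\<^sub>R mat 1"
    using psi_mult[OF ijA(1,1)] psi_scalar[OF ab(1)] by simp
  have jj: "\<psi> qj ** \<psi> qj = f b *\<^sub>R mat 1"
    using psi_mult[OF ijA(2,2)] psi_scalar[OF ab(2)] by simp
  have anti: "\<psi> qi ** \<psi> qj = - (\<psi> qj ** \<psi> qi)"
  proof -
    have "\<psi> qi ** \<psi> qj + \<psi> qj ** \<psi> qi = \<psi> (qm qi qj + qm qj qi)"
      using A_closed(3)[OF ijA(1,2)] A_closed(3)[OF ijA(2,1)] by (simp only: psi_add psi_mult ijA)
    also have "qm qi qj + qm qj qi = 0" by (simp add: zero_prod_def)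
    finally show ?thesis by (simp add: psi_zero add_eq_0_iff)
  qed
  have ti: "f b * trace (\<psi> qi) = - (f b * trace (\<psi> qi))"
  proof -
    have "f b * trace (\<psi> qi) = trace (\<psi> qi ** (\<psi> qj ** \<psi> qj))" by (simp add: jj)
    also have "\<dots> = - trace (\<psi> qj ** \<psi> qi ** \<psi> qj)" by (simp add: matrix_mul_assoc anti)
    also have "trace (\<psi> qj ** \<psi> qi ** \<psi> qj) = trace (\<psi> qj ** (\<psi> qj ** \<psi> qi))" by (rule trace2_mult_commute)
    also have "\<dots> = f b * trace (\<psi> qi)" by (simp add: matrix_mul_assoc jj)
    finally show ?thesis .
  qed
  have tj: "f a * trace (\<psi> qj) = - (f a * trace (\<psi> qj))"
  proof -
    have "f a * trace (\<psi> qj) = trace (\<psi> qi ** (\<psi> qi ** \<psi> qj))" by (simp add: matrix_mul_assoc ii)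
    also have "\<dots> = trace ((\<psi> qi ** \<psi> qj) ** \<psi> qi)" by (rule trace2_mult_commute)
    also have "\<dots> = - trace (\<psi> qj ** (\<psi> qi ** \<psi> qi))" by (simp add: matrix_mul_assoc anti)
    finally show ?thesis by (simp add: ii)
  qed
  show ?thesis
  proof
    show t: "trace (\<psi> qi) = 0" "trace (\<psi> qj) = 0" using ti tj fa by simp_all
    have "- det (\<psi> qi) *\<^sub>R mat 1 = f a *\<^sub>R (mat 1 :: mat2)" "- det (\<psi> qj) *\<^sub>R mat 1 = f b *\<^sub>R (mat 1 :: mat2)"
      using traceless_square[OF t(1)] traceless_square[OF t(2)] ii jj by simp_all
    then have "- det (\<psi> qi) = f a" "- det (\<psi> qj) = f b" by (simp_all add: mat2_eq_iff)
    then show "det (\<psi> qi) \<noteq> 0" "det (\<psi> qj) \<noteq> 0" using fa by auto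
  qed (rule anti)
qed

lemma psi_trace: "x \<in> A \<Longrightarrow> trace (\<psi> x) = f (qtr x)"
proof -
  assume "x \<in> A"
  then obtain x0 x1 x2 x3 where x: "x = (x0, x1, x2, x3)" "x0 \<in> K" "x1 \<in> K" "x2 \<in> K" "x3 \<in> K" by auto
  have ijA: "qi \<in> A" "qj \<in> A" "qk \<in> A" by auto
  interpret quaternion_pair "\<psi> qi" "\<psi> qj" by (rule ij_pair)
  have k: "trace (\<psi> qk) = 0" using psi_mult[OF ijA(1,2)] trace_PQ by simp
  have "\<psi> x = \<psi> ((x0, 0, 0, 0) + (x1 *\<^sub>R qi + (x2 *\<^sub>R qj + x3 *\<^sub>R qk)))" by (simp add: x(1))
  also have "\<dots> = f x0 *\<^sub>R mat 1 + (f x1 *\<^sub>R \<psi> qi + (f x2 *\<^sub>R \<psi> qj + f x3 *\<^sub>R \<psi> qk))"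
  proof -
    have s: "x1 *\<^sub>R qi \<in> A" "x2 *\<^sub>R qj \<in> A" "x3 *\<^sub>R qk \<in> A" "(x0, 0, 0, 0) \<in> A" using x by auto
    have s': "x2 *\<^sub>R qj + x3 *\<^sub>R qk \<in> A" "x1 *\<^sub>R qi + (x2 *\<^sub>R qj + x3 *\<^sub>R qk) \<in> A" using x by auto
    show ?thesis
      unfolding psi_add[OF s(4) s'(2)] psi_add[OF s(1) s'(1)] psi_add[OF s(2,3)] psi_scalar[OF x(2)]
        psi_scaleR[OF x(3) ijA(1)] psi_scaleR[OF x(4) ijA(2)] psi_scaleR[OF x(5) ijA(3)] ..
  qed
  finally have "trace (\<psi> x) = 2 * f x0" using tr k by simp
  moreover have "f (2 * x0) = 2 * f x0"
    using embedding_simps(3)[OF K f, of 2 x0] embedding_numeral[OF K f, of 2] x(2) Kc by simp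
  ultimately show ?thesis by (simp add: qtr_def x(1))
qed

text \<open>Cayley-Hamilton for \<open>\<psi> x\<close> compared with the image of the quadratic
  equation \<open>quat_square\<close>.\<close>

lemma psi_det: "x \<in> A \<Longrightarrow> det (\<psi> x) = f (nrd x)"
proof -
  assume x: "x \<in> A"
  have "\<psi> (qm x x) = f (qtr x) *\<^sub>R \<psi> x - f (nrd x) *\<^sub>R mat 1"
    unfolding quat_square using x A_closed by (simp add: psi_diff psi_scaleR psi_scalar)
  then have "\<psi> x ** \<psi> x = trace (\<psi> x) *\<^sub>R \<psi> x - f (nrd x) *\<^sub>R mat 1"
    by (simp add: psi_mult x psi_trace)
  moreover have "\<psi> x ** \<psi> x = trace (\<psi> x) *\<^sub>R \<psi> x - det (\<psi> x) *\<^sub>R mat 1"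
    by (simp add: mat2_simps algebra_simps)
  ultimately have "f (nrd x) *\<^sub>R mat 1 = det (\<psi> x) *\<^sub>R (mat 1 :: mat2)" by auto
  then show ?thesis by (simp add: mat2_eq_iff)
qed

lemma psi_qpow: "x \<in> A \<Longrightarrow> \<psi> (qpow a b x n) = mpow (\<psi> x) n"
  by (induction n) (simp_all add: psi_one psi_mult qpow_A)

end

section \<open>Irreducible arithmetic groups\<close>

declare One_nat_def [simp del]

locale arithmetic_group = totally_real n K \<phi> for n K \<phi> +
  fixes r :: nat and a b :: real and \<psi> :: "nat \<Rightarrow> quat4 \<Rightarrow> mat2" and \<O> :: "quat4 set" and \<Delta> :: "(nat \<Rightarrow> mat2 set) set"
  assumes r: "1 \<le> r" "r \<le> n" and a: "a \<in> K - {0}" and b: "b \<in> K - {0}"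
    and ram: "\<And>j. j \<in> {r+1..n} \<Longrightarrow> ramified_at a b (\<phi> j)"
    and ext: "\<And>i. i \<in> {1..r} \<Longrightarrow> extends_embedding K a b (\<phi> i) (\<psi> i)"
    and order: "is_order K a b \<O>"
    and Delta: "subgroup \<Delta> (PSL2R_pow r)"
    and comm: "commensurable (PSL2R_pow r) \<Delta> (norm_one_group r a b \<psi> \<O>)"
begin

abbreviation "A \<equiv> K \<times> K \<times> K \<times> K"
abbreviation "qm \<equiv> quat_mult a b"
abbreviation "nrd \<equiv> reduced_norm a b"
abbreviation "G1 \<equiv> norm_one_group r a b \<psi> \<O>"
abbreviation "OK \<equiv> ring_of_integers K"
abbreviation "pc x \<equiv> pcls r (\<lambda>i. \<psi> i x)"

lemma ir: "i \<in> {1..r} \<Longrightarrow> i \<in> {1..n}"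
  using r by auto

lemma one_r: "1 \<in> {1..r}"
  using r by auto

lemma qe: "i \<in> {1..r} \<Longrightarrow> quaternion_embedding K a b (\<phi> i) (\<psi> i)"
  by unfold_locales (use K a b emb[OF ir] ext in auto)

sublocale Q1: quaternion_embedding K a b "\<phi> 1" "\<psi> 1"
  by (rule qe[OF one_r])

lemmas A_closed = Q1.A_closed
lemmas psi_add = quaternion_embedding.psi_add[OF qe]
lemmas psi_diff = quaternion_embedding.psi_diff[OF qe]
lemmas psi_mult = quaternion_embedding.psi_mult[OF qe]
lemmas psi_one = quaternion_embedding.psi_one[OF qe]
lemmas psi_scaleR = quaternion_embedding.psi_scaleR[OF qe]
lemmas psi_trace = quaternion_embedding.psi_trace[OF qe]
lemmas psi_det = quaternion_embedding.psi_det[OF qe]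
lemmas psi_qpow = quaternion_embedding.psi_qpow[OF qe]
lemmas psi_eq_0 = quaternion_embedding.psi_eq_0[OF qe]

lemma OK_iff: "c \<in> OK \<longleftrightarrow> c \<in> K \<and> algebraic_int c"
  by (simp add: ring_of_integers_def)

lemma OK_closed: "c \<in> OK \<Longrightarrow> d \<in> OK \<Longrightarrow> c + d \<in> OK" "c \<in> OK \<Longrightarrow> d \<in> OK \<Longrightarrow> c * d \<in> OK"
  "c \<in> OK \<Longrightarrow> - c \<in> OK" "real m \<in> OK" "0 \<in> OK" "1 \<in> OK"
  using real_subfieldD[OF K] real_subfield_nat[OF K] algebraic_int_add_mult by (auto simp: OK_iff)

lemma span_over_iff:
  assumes "finite B" "0 \<in> S"
  shows "x \<in> span_over S B \<longleftrightarrow> (\<exists>c. (\<forall>y\<in>B. c y \<in> S) \<and> x = (\<Sum>y\<in>B. c y *\<^sub>R y))"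
proof
  assume "x \<in> span_over S B"
  then obtain B' c where c: "x = (\<Sum>y\<in>B'. c y *\<^sub>R y)" "finite B'" "B' \<subseteq> B" "\<forall>y\<in>B'. c y \<in> S"
    by (auto simp: span_over_def)
  have "x = (\<Sum>y\<in>B. (if y \<in> B' then c y else 0) *\<^sub>R y)"
    unfolding c(1) by (rule sum.mono_neutral_cong_left) (use assms(1) c(3) in auto)
  then show "\<exists>c. (\<forall>y\<in>B. c y \<in> S) \<and> x = (\<Sum>y\<in>B. c y *\<^sub>R y)"
    using c(4) assms(2) by (intro exI[of _ "\<lambda>y. if y \<in> B' then c y else 0"]) auto
next
  assume "\<exists>c. (\<forall>y\<in>B. c y \<in> S) \<and> x = (\<Sum>y\<in>B. c y *\<^sub>R y)"
  then show "x \<in> span_over S B" using assms(1) unfolding span_over_def by blast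
qed

lemma O_basis:
  obtains B where "finite B" "\<And>x. x \<in> \<O> \<longleftrightarrow> (\<exists>c. (\<forall>y\<in>B. c y \<in> OK) \<and> x = (\<Sum>y\<in>B. c y *\<^sub>R y))"
proof -
  obtain B where B: "finite B" "\<O> = span_over OK B" using order by (auto simp: is_order_def)
  show ?thesis using that[OF B(1)] unfolding B(2) span_over_iff[OF B(1) OK_closed(5)] by blast
qed

lemma O_sub: "subring \<O> (quaternion_algebra K a b)"
  using order by (simp add: is_order_def)

lemma O_A: "x \<in> \<O> \<Longrightarrow> x \<in> A"
  using subringE(1)[OF O_sub] by (auto simp: quaternion_algebra_def)

lemma O_closed: "x \<in> \<O> \<Longrightarrow> y \<in> \<O> \<Longrightarrow> qm x y \<in> \<O>" "x \<in> \<O> \<Longrightarrow> y \<in> \<O> \<Longrightarrow> x + y \<in> \<O>" "(1, 0, 0, 0) \<in> \<O>"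
  using subringE(6)[OF O_sub, of x y] subringE(7)[OF O_sub, of x y] subringE(3)[OF O_sub]
  by (simp_all add: quaternion_algebra_def)

lemma O_scale: "c \<in> OK \<Longrightarrow> x \<in> \<O> \<Longrightarrow> c *\<^sub>R x \<in> \<O>"
proof -
  assume c: "c \<in> OK" and x: "x \<in> \<O>"
  obtain B where B: "finite B" "\<And>x. x \<in> \<O> \<longleftrightarrow> (\<exists>c. (\<forall>y\<in>B. c y \<in> OK) \<and> x = (\<Sum>y\<in>B. c y *\<^sub>R y))"
    using O_basis by blast
  from x B(2) obtain d where d: "\<forall>y\<in>B. d y \<in> OK" "x = (\<Sum>y\<in>B. d y *\<^sub>R y)" by blast
  have "c *\<^sub>R x = (\<Sum>y\<in>B. (c * d y) *\<^sub>R y)" unfolding d(2) by (simp add: scaleR_sum_right)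
  then show ?thesis unfolding B(2) using d(1) c OK_closed(2) by (intro exI[of _ "\<lambda>y. c * d y"]) auto
qed

lemma A_fraction:
  assumes "x \<in> A"
  obtains m :: nat where "m > 0" "real m *\<^sub>R x \<in> \<O>"
proof -
  have "x \<in> span_over K \<O>" using assms order by (simp add: is_order_def quaternion_algebra_def)
  then obtain Y c where Y: "x = (\<Sum>y\<in>Y. c y *\<^sub>R y)" "finite Y" "Y \<subseteq> \<O>" "\<forall>y\<in>Y. c y \<in> K"
    by (auto simp: span_over_def)
  have "\<exists>m::nat. m > 0 \<and> real m *\<^sub>R (\<Sum>y\<in>Y. c y *\<^sub>R y) \<in> \<O>"
    using Y(2,3,4)
  proof (induction Y)
    case empty
    have "0 *\<^sub>R (1, 0, 0, 0) \<in> \<O>" by (rule O_scale[OF OK_closed(5) O_closed(3)])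
    then show ?case by (intro exI[of _ 1]) (simp add: zero_prod_def)
  next
    case (insert y Y)
    then obtain m where m: "m > 0" "real m *\<^sub>R (\<Sum>y\<in>Y. c y *\<^sub>R y) \<in> \<O>" by auto
    have cy: "c y \<in> K" "y \<in> \<O>" using insert.prems by auto
    obtain k :: nat where k: "k > 0" "algebraic_int (real k * c y)" using K_fraction[OF cy(1)] by blast
    have rk: "real k * c y \<in> OK" using k(2) cy(1) real_subfield_nat[OF K] real_subfieldD(4)[OF K] by (simp add: OK_iff)
    have "real m *\<^sub>R ((real k * c y) *\<^sub>R y) + real k *\<^sub>R (real m *\<^sub>R (\<Sum>y\<in>Y. c y *\<^sub>R y)) \<in> \<O>"
      by (rule O_closed(2)[OF O_scale[OF OK_closed(4) O_scale[OF rk cy(2)]] O_scale[OF OK_closed(4) m(2)]])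
    also have "real m *\<^sub>R ((real k * c y) *\<^sub>R y) + real k *\<^sub>R (real m *\<^sub>R (\<Sum>y\<in>Y. c y *\<^sub>R y)) =
      real (m * k) *\<^sub>R (\<Sum>y\<in>insert y Y. c y *\<^sub>R y)"
      using insert.hyps by (simp add: scaleR_add_right mult_ac)
    finally show ?case using m(1) k(1) by (intro exI[of _ "m * k"]) auto
  qed
  with that Y(1) show ?thesis by blast
qed

text \<open>An eigenvalue of \<open>\<psi> 1 \<epsilon>\<close> is an eigenvalue of multiplication by \<open>\<epsilon>\<close> on \<open>\<O>\<close>, hence an algebraic integer.\<close>

lemma hyperbolic_trace_integral:
  assumes e: "\<epsilon> \<in> \<O>" "nrd \<epsilon> = 1" "\<bar>qtr \<epsilon>\<bar> > 2"
  shows "algebraic_int (qtr \<epsilon>)"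
proof -
  have eA: "\<epsilon> \<in> A" by (rule O_A[OF e(1)])
  define M where "M = \<psi> 1 \<epsilon>"
  have tM: "trace M = qtr \<epsilon>" unfolding M_def psi_trace[OF one_r eA] by (rule emb1) (use A_closed(6)[OF eA] in simp)
  have dM: "det M = 1" unfolding M_def psi_det[OF one_r eA] e(2) by (rule emb1[OF real_subfieldD(1)[OF K]])
  obtain S l where S: "det S = 1" "\<bar>l\<bar> > 1" "adj2 S ** M ** S = mat2 l 0 0 (1 / l)"
    using hyperbolic_diagonalize[OF dM] tM e(3) by auto
  \<comment> \<open>The rows of \<open>R\<close> are left eigenvectors of \<open>M\<close>.\<close>
  define R where "R = adj2 S"
  have "R ** M = R ** M ** (S ** R)" using S(1) by (simp add: R_def)
  also have "\<dots> = mat2 l 0 0 (1 / l) ** R" unfolding matrix_mul_assoc using S(3) by (simp add: R_def)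
  finally have RM: "R ** M = mat2 l 0 0 (1 / l) ** R" .
  obtain B where B: "finite B" "\<And>x. x \<in> \<O> \<longleftrightarrow> (\<exists>c. (\<forall>y\<in>B. c y \<in> OK) \<and> x = (\<Sum>y\<in>B. c y *\<^sub>R y))"
    using O_basis by blast
  have BO: "y \<in> \<O>" if "y \<in> B" for y
  proof -
    have "y = (\<Sum>z\<in>B. (if z = y then 1 else 0) *\<^sub>R z)"
      using B(1) that by (subst sum.mono_neutral_right[of B "{y}"]) auto
    then show ?thesis unfolding B(2) using OK_closed(5,6) by (intro exI[of _ "\<lambda>z. if z = y then 1 else 0"]) auto
  qed
  have psi_sum: "\<psi> 1 (\<Sum>y\<in>Y. c y *\<^sub>R y) = (\<Sum>y\<in>Y. c y *\<^sub>R \<psi> 1 y) \<and> (\<Sum>y\<in>Y. c y *\<^sub>R y) \<in> A"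
    if "finite Y" "Y \<subseteq> B" "\<forall>y\<in>B. c y \<in> OK" for Y c
    using that(1,2)
  proof (induction Y)
    case empty
    then show ?case using Q1.psi_zero A_closed(4)[OF real_subfieldD(2)[OF K] A_closed(5)] by (simp add: zero_prod_def)
  next
    case (insert y Y)
    have cy: "c y \<in> K" "y \<in> A" using insert.prems that(3) BO O_A by (auto simp: OK_iff)
    then have yA: "c y *\<^sub>R y \<in> A" by (rule A_closed(4))
    define S where "S = (\<Sum>y\<in>Y. c y *\<^sub>R y)"
    have S: "\<psi> 1 S = (\<Sum>y\<in>Y. c y *\<^sub>R \<psi> 1 y)" "S \<in> A" using insert unfolding S_def by auto
    have e: "(\<Sum>y\<in>insert y Y. c y *\<^sub>R y) = c y *\<^sub>R y + S" using insert.hyps by (simp add: S_def)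
    have "\<psi> 1 (c y *\<^sub>R y + S) = c y *\<^sub>R \<psi> 1 y + \<psi> 1 S"
      unfolding psi_add[OF one_r yA S(2)] psi_scaleR[OF one_r cy] emb1[OF cy(1)] ..
    then show ?case unfolding e using insert.hyps S A_closed(1)[OF yA S(2)] by simp
  qed
  \<comment> \<open>Multiplying \<open>y\<close> by \<open>\<epsilon>\<close> multiplies the entry
    \<open>v y\<close> by \<open>m\<close>. Expanding \<open>\<epsilon> y\<close> over the
    generators \<open>B\<close> of \<open>\<O>\<close> gives an eigenvector equation with
    coefficients in \<open>OK\<close>; the vector is nonzero because the entry belonging to the unit
    of \<open>\<O>\<close> is \<open>R $ j $ k\<close>.\<close>
  have integral: "algebraic_int m"
    if m: "\<And>x. x \<in> \<O> \<Longrightarrow> (R ** \<psi> 1 (qm \<epsilon> x)) $ j $ k = m * (R ** \<psi> 1 x) $ j $ k" and nz: "R $ j $ k \<noteq> 0" for m j k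
  proof -
    define v where "v y = (R ** \<psi> 1 y) $ j $ k" for y
    have v_sum: "v (\<Sum>y\<in>B. c y *\<^sub>R y) = (\<Sum>y\<in>B. c y * v y)" if "\<forall>y\<in>B. c y \<in> OK" for c
      unfolding v_def using psi_sum[OF B(1) subset_refl that] by (simp add: mat2_mult_sum)
    have "\<forall>y\<in>B. \<exists>c. (\<forall>z\<in>B. c z \<in> OK) \<and> qm \<epsilon> y = (\<Sum>z\<in>B. c z *\<^sub>R z)"
    proof
      fix y assume "y \<in> B"
      then have "qm \<epsilon> y \<in> \<O>" by (intro O_closed(1) e BO)
      then show "\<exists>c. (\<forall>z\<in>B. c z \<in> OK) \<and> qm \<epsilon> y = (\<Sum>z\<in>B. c z *\<^sub>R z)" by (rule B(2)[THEN iffD1])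
    qed
    from bchoice[OF this] obtain c
      where c': "\<forall>y\<in>B. (\<forall>z\<in>B. c y z \<in> OK) \<and> qm \<epsilon> y = (\<Sum>z\<in>B. c y z *\<^sub>R z)" ..
    have c: "c y z \<in> OK" if "y \<in> B" "z \<in> B" for y z using c' that by blast
    have c2: "qm \<epsilon> y = (\<Sum>z\<in>B. c y z *\<^sub>R z)" if "y \<in> B" for y using c' that by blast
    have eq: "m * v y = (\<Sum>z\<in>B. c y z * v z)" if "y \<in> B" for y
    proof -
      have "m * v y = v (qm \<epsilon> y)" unfolding v_def using m[OF BO[OF that]] by simp
      also have "\<dots> = (\<Sum>z\<in>B. c y z * v z)" unfolding c2[OF that] by (rule v_sum) (use c[OF that] in blast)
      finally show ?thesis .
    qed
    obtain d where d: "\<forall>y\<in>B. d y \<in> OK" "(1, 0, 0, 0) = (\<Sum>y\<in>B. d y *\<^sub>R y)" using O_closed(3) B(2) by blast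
    have "v (1, 0, 0, 0) = (\<Sum>y\<in>B. d y * v y)" unfolding d(2) by (rule v_sum[OF d(1)])
    moreover have "v (1, 0, 0, 0) \<noteq> 0" unfolding v_def psi_one[OF one_r] using nz by simp
    ultimately have ne: "(\<Sum>y\<in>B. d y * v y) \<noteq> 0" by simp
    have "\<exists>y\<in>B. v y \<noteq> 0"
    proof (rule ccontr)
      assume "\<not> ?thesis"
      then have "(\<Sum>y\<in>B. d y * v y) = 0" by (intro sum.neutral) auto
      with ne show False by simp
    qed
    then obtain y0 where y0: "y0 \<in> B" "v y0 \<noteq> 0" by blast
    show ?thesis
    proof (rule algebraic_int_if_eigenvalue[where I = B and k = y0 and v = v and c = c and l = m])
      show "algebraic_int (c y z)" if "y \<in> B" "z \<in> B" for y z using c[OF that] by (simp add: OK_iff)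
    qed (fact B(1) y0 eq)+
  qed
  have R0: "R$1$1 \<noteq> 0 \<or> R$1$2 \<noteq> 0" "R$2$1 \<noteq> 0 \<or> R$2$2 \<noteq> 0"
    using S(1) by (auto simp: R_def det_2 adj2_def trace2)
  have ev: "R ** \<psi> 1 (qm \<epsilon> x) = mat2 l 0 0 (1 / l) ** (R ** \<psi> 1 x)" if "x \<in> \<O>" for x
  proof -
    have "R ** \<psi> 1 (qm \<epsilon> x) = (R ** M) ** \<psi> 1 x"
      using psi_mult[OF one_r eA O_A[OF that]] by (simp add: M_def matrix_mul_assoc)
    then show ?thesis by (simp add: RM matrix_mul_assoc)
  qed
  have "algebraic_int l"
    using R0(1) by (elim disjE; intro integral[of 1 _ l]) (auto simp: ev mat2_mult_nth)
  moreover have "algebraic_int (1 / l)"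
    using R0(2) by (elim disjE; intro integral[of 2 _ "1 / l"]) (auto simp: ev mat2_mult_nth)
  moreover have "qtr \<epsilon> = l + 1 / l"
  proof -
    have "trace (R ** M ** S) = trace (S ** (R ** M))" by (rule trace2_mult_commute)
    also have "\<dots> = qtr \<epsilon>" using S(1) tM by (simp add: R_def matrix_mul_assoc)
    finally show ?thesis using S(3) by (simp add: R_def trace2)
  qed
  ultimately show ?thesis by (simp add: algebraic_int_add_mult)
qed

text \<open>With \<open>m x\<close> in \<open>\<O>\<close>, the power \<open>x^k\<close>, which is
  \<open>cheb k\<close> times \<open>x\<close> minus \<open>cheb (k - 1)\<close> at the trace of
  \<open>x\<close>, lies in \<open>\<O>\<close> as soon as \<open>m\<close> divides
  \<open>cheb k\<close> among the algebraic integers.\<close>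

lemma power_in_order:
  assumes x: "x \<in> A" "nrd x = 1" "algebraic_int (qtr x)"
  obtains k where "k > 0" "qpow a b x k \<in> \<O>"
proof -
  obtain m :: nat where m: "m > 0" "real m *\<^sub>R x \<in> \<O>" using A_fraction[OF x(1)] .
  obtain k where k: "k > 0" "algebraic_int (cheb (qtr x) k / real m)" using cheb_divisible[OF x(3) m(1)] .
  have chK: "cheb (qtr x) i \<in> K" for i
    by (induction i rule: induct_nat_012) (use A_closed(6)[OF x(1)] real_subfieldD[OF K] in auto)
  obtain j where j: "k = Suc j" using k(1) gr0_conv_Suc by blast
  have 1: "cheb (qtr x) k / real m \<in> OK" using k(2) chK real_subfieldD(8)[OF K chK real_subfield_nat[OF K]] by (simp add: OK_iff)
  have 2: "- cheb (qtr x) j \<in> OK" using algebraic_int_cheb[OF x(3)] chK OK_closed(3) by (auto simp: OK_iff)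
  have "(cheb (qtr x) k / real m) *\<^sub>R (real m *\<^sub>R x) + (- cheb (qtr x) j) *\<^sub>R (1, 0, 0, 0) \<in> \<O>"
    by (intro O_closed(2) O_scale 1 2 m O_closed(3))
  also have "(cheb (qtr x) k / real m) *\<^sub>R (real m *\<^sub>R x) + (- cheb (qtr x) j) *\<^sub>R (1, 0, 0, 0) = qpow a b x k"
    unfolding j qpow_cheb[OF x(2)] using m(1) by simp
  finally show ?thesis using that k(1) by blast
qed

section \<open>The norm one group and its commensurability with \<open>\<Delta>\<close>\<close>

lemma psi_SLr: "x \<in> A \<Longrightarrow> nrd x = 1 \<Longrightarrow> (\<lambda>i. \<psi> i x) \<in> SLr r"
  using psi_det embedding_simps(1)[OF K emb[OF ir]] by (auto simp: SLr_def)

lemma pc_mult: "x \<in> A \<Longrightarrow> y \<in> A \<Longrightarrow> pc x \<otimes>\<^bsub>PSL2R_pow r\<^esub> pc y = pc (qm x y)"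
  unfolding pcls_mult pcls_eq_iff using psi_mult by auto

lemma pc_pow: "x \<in> A \<Longrightarrow> pc x [^]\<^bsub>PSL2R_pow r\<^esub> (k::nat) = pc (qpow a b x k)"
  unfolding pow_PSL2R_pow pcls_eq_iff using psi_qpow by auto

lemma pc_one: "pc (1, 0, 0, 0) = \<one>\<^bsub>PSL2R_pow r\<^esub>"
  unfolding one_PSL2R_pow pcls_eq_iff using psi_one by auto

lemma G1_iff: "g \<in> G1 \<longleftrightarrow> (\<exists>\<epsilon>. \<epsilon> \<in> \<O> \<and> nrd \<epsilon> = 1 \<and> g = pc \<epsilon>)"
  by (auto simp: norm_one_group_def)

text \<open>The closure properties that \<open>power_in_finite_index\<close> asks for.\<close>

lemma G1_group: "G1 \<subseteq> carrier (PSL2R_pow r)" "\<one>\<^bsub>PSL2R_pow r\<^esub> \<in> G1"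
  "g \<in> G1 \<Longrightarrow> g' \<in> G1 \<Longrightarrow> g \<otimes>\<^bsub>PSL2R_pow r\<^esub> g' \<in> G1"
proof -
  show "G1 \<subseteq> carrier (PSL2R_pow r)"
    using psi_SLr O_A by (auto simp: G1_iff carrier_PSL2R_pow)
  show "\<one>\<^bsub>PSL2R_pow r\<^esub> \<in> G1" unfolding G1_iff using pc_one O_closed(3) by (intro exI[of _ "(1,0,0,0)"]) simp
  show "g \<otimes>\<^bsub>PSL2R_pow r\<^esub> g' \<in> G1" if gg: "g \<in> G1" "g' \<in> G1"
  proof -
    obtain e where e: "e \<in> \<O>" "nrd e = 1" "g = pc e" using gg(1) unfolding G1_iff by blast
    obtain e' where e': "e' \<in> \<O>" "nrd e' = 1" "g' = pc e'" using gg(2) unfolding G1_iff by blast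
    have "nrd (qm e e') = 1" unfolding reduced_norm_mult e(2) e'(2) by simp
    moreover have "g \<otimes>\<^bsub>PSL2R_pow r\<^esub> g' = pc (qm e e')"
      unfolding e(3) e'(3) by (rule pc_mult[OF O_A[OF e(1)] O_A[OF e'(1)]])
    ultimately show ?thesis unfolding G1_iff using O_closed(1)[OF e(1) e'(1)] by blast
  qed
qed

lemma power_in_G1:
  assumes "g \<in> \<Delta>"
  obtains k where "k > 0" "g [^]\<^bsub>PSL2R_pow r\<^esub> (k::nat) \<in> G1"
proof -
  interpret group "PSL2R_pow r" by (rule group_PSL2R_pow)
  have fin: "finite (rcosets\<^bsub>PSL2R_pow r\<lparr>carrier := \<Delta>\<rparr>\<^esub> (\<Delta> \<inter> G1))" using comm by (simp add: commensurable_def)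
  show ?thesis
    by (rule power_in_finite_index[OF _ _ _ G1_group(2) fin assms])
      (use that Delta in \<open>auto intro: subgroup.m_closed subgroup.one_closed subgroup.mem_carrier\<close>)
qed

lemma power_in_Delta:
  assumes "\<epsilon> \<in> \<O>" "nrd \<epsilon> = 1"
  obtains k where "k > 0" "pc (qpow a b \<epsilon> k) \<in> \<Delta>"
proof -
  interpret group "PSL2R_pow r" by (rule group_PSL2R_pow)
  have fin: "finite (rcosets\<^bsub>PSL2R_pow r\<lparr>carrier := G1\<rparr>\<^esub> (G1 \<inter> \<Delta>))"
    using comm by (simp add: commensurable_def Int_commute)
  have "pc \<epsilon> \<in> G1" unfolding G1_iff using assms by blast
  from power_in_finite_index[OF G1_group subgroup.one_closed[OF Delta] fin this]
  obtain k where "k > 0" "pc \<epsilon> [^]\<^bsub>PSL2R_pow r\<^esub> (k::nat) \<in> \<Delta>" by auto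
  then show ?thesis using that pc_pow[OF O_A[OF assms(1)]] by simp
qed

lemma lift_of_power:
  assumes "x \<in> lifts r \<Delta>"
  obtains k \<epsilon> where "k > 0" "\<epsilon> \<in> \<O>" "nrd \<epsilon> = 1" "pcls r (\<lambda>i. mpow (x i) k) = pc \<epsilon>"
proof -
  have "pcls r x \<in> \<Delta>" using assms by (simp add: lifts_def)
  then obtain k where "k > 0" "pcls r x [^]\<^bsub>PSL2R_pow r\<^esub> (k::nat) \<in> G1" using power_in_G1 by blast
  then show ?thesis using that unfolding pow_PSL2R_pow G1_iff by blast
qed

end

section \<open>Lifting squares of elements of \<open>\<Delta>\<close> to norm one elements of
  \<open>A\<close>\<close>

lemma intertwine_invariants:
  fixes x P P' :: mat2
  assumes "x ** P = P' ** x" "det x = 1"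
  shows "trace P = trace P'" "det P = det P'"
proof -
  have "P' = P' ** (x ** adj2 x)" using assms(2) by simp
  also have "\<dots> = x ** P ** adj2 x" unfolding matrix_mul_assoc assms(1) ..
  finally have P': "P' = x ** P ** adj2 x" .
  have "trace P' = trace (adj2 x ** (x ** P))" unfolding P' by (rule trace2_mult_commute)
  then show "trace P = trace P'" using assms(2) by (simp add: matrix_mul_assoc)
  show "det P = det P'" unfolding P' by (simp add: det2_mult assms(2))
qed

lemma reduced_norm_scaleR: "reduced_norm a b (c *\<^sub>R x) = c\<^sup>2 * reduced_norm a b x"
  by (cases x) (simp add: power2_eq_square algebra_simps)

lemma tpart_mpow:
  assumes "mpow M n = s *\<^sub>R M + q *\<^sub>R mat 1"
  shows "tpart (mpow M n) = s *\<^sub>R tpart M"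
  unfolding assms by (simp add: mat2_eq_iff trace2 algebra_simps add_divide_distrib)

definition qpure :: "quat4 \<Rightarrow> quat4" where
  "qpure x = x - (qtr x / 2) *\<^sub>R (1, 0, 0, 0)"

lemma qtr_qpure [simp]: "qtr (qpure x) = 0"
  by (simp add: qpure_def qtr_simps del: scaleR_Pair)

context arithmetic_group
begin

lemma qpure_A: "x \<in> A \<Longrightarrow> qpure x \<in> A"
  unfolding qpure_def using A_closed real_subfieldD(8)[OF K] real_subfield_numeral[OF K] by metis

lemma emb_half: "i \<in> {1..r} \<Longrightarrow> c \<in> K \<Longrightarrow> \<phi> i (c / 2) = \<phi> i c / 2"
  using embedding_simps(8)[OF K emb[OF ir], of i c 2] embedding_numeral[OF K emb[OF ir], of i 2]
    real_subfield_numeral[OF K] by simp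

lemma psi_qpure: "i \<in> {1..r} \<Longrightarrow> x \<in> A \<Longrightarrow> \<psi> i (qpure x) = tpart (\<psi> i x)"
proof -
  assume i: "i \<in> {1..r}" and x: "x \<in> A"
  have t: "qtr x \<in> K" "qtr x / 2 \<in> K"
    using A_closed(6)[OF x] real_subfieldD(8)[OF K] real_subfield_numeral[OF K] by auto
  show ?thesis unfolding qpure_def psi_diff[OF i x A_closed(4)[OF t(2) A_closed(5)]]
    psi_scaleR[OF i t(2) A_closed(5)] psi_one[OF i] emb_half[OF i t(1)] psi_trace[OF i x] ..
qed

lemma emb_nonzero: "i \<in> {1..r} \<Longrightarrow> c \<in> K \<Longrightarrow> c \<noteq> 0 \<Longrightarrow> \<phi> i c \<noteq> 0"
  using embedding_eq_0[OF K emb[OF ir]] by blast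

text \<open>A power of \<open>h\<close> and the same power of its conjugate by \<open>x\<close> both
  come from \<open>\<O>\<close> up to signs in the components; doubling the exponent removes the
  signs.\<close>

lemma conj_lift:
  assumes h: "h \<in> lifts r \<Delta>" and x: "x \<in> lifts r \<Delta>"
  obtains M e e' where "M > 0" "e \<in> A" "e' \<in> A" "\<And>i. i \<in> {1..r} \<Longrightarrow> \<psi> i e = mpow (h i) M"
    "\<And>i. i \<in> {1..r} \<Longrightarrow> x i ** \<psi> i e = \<psi> i e' ** x i"
proof -
  obtain k1 e1 where e1: "k1 > 0" "e1 \<in> \<O>" "nrd e1 = 1" "pcls r (\<lambda>i. mpow (h i) k1) = pc e1"
    using lift_of_power[OF h] .
  define y where "y = (\<lambda>i. x i ** h i ** adj2 (x i))"
  have y: "y \<in> lifts r \<Delta>" unfolding y_def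
    using lifts_mult[OF Delta lifts_mult[OF Delta x h] lifts_adj2[OF Delta x]] .
  obtain k2 e2 where e2: "k2 > 0" "e2 \<in> \<O>" "nrd e2 = 1" "pcls r (\<lambda>i. mpow (mpow (y i) k1) k2) = pc e2"
    using lift_of_power[OF lifts_mpow[OF Delta y, of k1]] .
  define N where "N = k1 * k2"
  define E where "E = qpow a b e1 k2"
  have EA: "E \<in> A" "e2 \<in> A" unfolding E_def using O_A e1 e2 Q1.qpow_A by blast+
  have hN: "mpow (h i) N = \<psi> i E \<or> mpow (h i) N = - \<psi> i E" if i: "i \<in> {1..r}" for i
  proof -
    have "mpow (h i) k1 = \<psi> i e1 \<or> mpow (h i) k1 = - \<psi> i e1" using e1(4) i unfolding pcls_eq_iff by blast
    then show ?thesis unfolding N_def E_def mpow_mult psi_qpow[OF i O_A[OF e1(2)]]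
      using mpow_uminus[of "\<psi> i e1" k2] by auto
  qed
  have yN: "mpow (y i) N = \<psi> i e2 \<or> mpow (y i) N = - \<psi> i e2" if i: "i \<in> {1..r}" for i
    using e2(4) i unfolding pcls_eq_iff N_def mpow_mult by blast
  show ?thesis
  proof (rule that[of "N + N" "qm E E" "qm e2 e2"])
    show "N + N > 0" using e1(1) e2(1) by (simp add: N_def)
    show "qm E E \<in> A" "qm e2 e2 \<in> A" by (rule A_closed(3)[OF EA(1) EA(1)], rule A_closed(3)[OF EA(2) EA(2)])
    fix i assume i: "i \<in> {1..r}"
    show 1: "\<psi> i (qm E E) = mpow (h i) (N + N)"
      unfolding psi_mult[OF i EA(1) EA(1)] mpow_add using hN[OF i] by auto
    have 2: "\<psi> i (qm e2 e2) = mpow (y i) (N + N)"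
      unfolding psi_mult[OF i EA(2) EA(2)] mpow_add using yN[OF i] by auto
    have "det (x i) = 1" using x i by (auto simp: lifts_def SLr_def)
    moreover have "y i ** x i = x i ** h i ** (adj2 (x i) ** x i)" by (simp only: y_def matrix_mul_assoc)
    ultimately have "x i ** h i = y i ** x i" by simp
    then show "x i ** \<psi> i (qm E E) = \<psi> i (qm e2 e2) ** x i" unfolding 1 2 by (rule mpow_conj)
  qed
qed

text \<open>The element \<open>x\<close> conjugates \<open>\<psi> u\<close>, \<open>\<psi> v\<close> to \<open>\<psi> u'\<close>, \<open>\<psi> v'\<close>. Averaging over the quaternion basis they
  generate gives \<open>G \<in> A\<close> with \<open>\<psi> i G\<close> proportional to \<open>x i\<close>, and \<open>G\<^sup>2 / nrd G\<close> is the required lift of \<open>x\<^sup>2\<close>.\<close>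

lemma square_lift:
  assumes h: "h \<in> lifts r \<Delta>" "\<bar>trace (h 1)\<bar> > 2" and k: "k \<in> lifts r \<Delta>" "\<bar>trace (k 1)\<bar> > 2"
    and hk: "det (h 1 ** k 1 - k 1 ** h 1) \<noteq> 0" and x: "x \<in> lifts r \<Delta>"
  obtains \<alpha> where "\<alpha> \<in> A" "nrd \<alpha> = 1" "\<And>i. i \<in> {1..r} \<Longrightarrow> \<psi> i \<alpha> = x i ** x i"
proof -
  obtain M1 e1 e1' where e1: "M1 > 0" "e1 \<in> A" "e1' \<in> A" "\<And>i. i \<in> {1..r} \<Longrightarrow> \<psi> i e1 = mpow (h i) M1"
    "\<And>i. i \<in> {1..r} \<Longrightarrow> x i ** \<psi> i e1 = \<psi> i e1' ** x i" using conj_lift[OF h(1) x] by metis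
  obtain M2 e2 e2' where e2: "M2 > 0" "e2 \<in> A" "e2' \<in> A" "\<And>i. i \<in> {1..r} \<Longrightarrow> \<psi> i e2 = mpow (k i) M2"
    "\<And>i. i \<in> {1..r} \<Longrightarrow> x i ** \<psi> i e2 = \<psi> i e2' ** x i" using conj_lift[OF k(1) x] by metis
  have dx: "det (x i) = 1" if "i \<in> {1..r}" for i using x that by (auto simp: lifts_def SLr_def)
  have dh: "det (h 1) = 1" "det (k 1) = 1" using h(1) k(1) one_r by (auto simp: lifts_def SLr_def)
  define u v u' v' where "u = qpure e1" and "v = qpure e2" and "u' = qpure e1'" and "v' = qpure e2'"
  \<comment> \<open>\<open>u\<close> and \<open>w = [u, v]\<close> anticommute and serve as
    quaternion generators; the general position of \<open>h 1\<close> and \<open>k 1\<close> makes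
    the norm of \<open>w\<close> nonzero.\<close>
  define w w' where "w = qm u v - qm v u" and "w' = qm u' v' - qm v' u'"
  have uA: "u \<in> A" "v \<in> A" "u' \<in> A" "v' \<in> A" using qpure_A e1 e2 by (auto simp only: u_def v_def u'_def v'_def)
  then have wA: "w \<in> A" "w' \<in> A" unfolding w_def w'_def using A_closed(2,3) by metis+
  have U: "x i ** \<psi> i u = \<psi> i u' ** x i" and V: "x i ** \<psi> i v = \<psi> i v' ** x i" if i: "i \<in> {1..r}" for i
  proof -
    show "x i ** \<psi> i u = \<psi> i u' ** x i"
      unfolding u_def u'_def psi_qpure[OF i e1(2)] psi_qpure[OF i e1(3)] 
      using e1(5)[OF i] intertwine_invariants(1)[OF e1(5)[OF i] dx[OF i]] by (simp add: mat2_mult_distrib)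
    show "x i ** \<psi> i v = \<psi> i v' ** x i"
      unfolding v_def v'_def psi_qpure[OF i e2(2)] psi_qpure[OF i e2(3)] 
      using e2(5)[OF i] intertwine_invariants(1)[OF e2(5)[OF i] dx[OF i]] by (simp add: mat2_mult_distrib)
  qed
  have psiw: "\<psi> i w = brk (\<psi> i u) (\<psi> i v)" "\<psi> i w' = brk (\<psi> i u') (\<psi> i v')" if i: "i \<in> {1..r}" for i
    unfolding w_def w'_def brk_def
    using psi_diff[OF i A_closed(3)[OF uA(1,2)] A_closed(3)[OF uA(2,1)]] psi_mult[OF i uA(1,2)] psi_mult[OF i uA(2,1)]
      psi_diff[OF i A_closed(3)[OF uA(3,4)] A_closed(3)[OF uA(4,3)]] psi_mult[OF i uA(3,4)] psi_mult[OF i uA(4,3)] by simp_all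
  have W: "x i ** \<psi> i w = \<psi> i w' ** x i" if i: "i \<in> {1..r}" for i
  proof -
    have 1: "x i ** (\<psi> i u ** \<psi> i v) = \<psi> i u' ** \<psi> i v' ** x i"
    proof -
      have "x i ** (\<psi> i u ** \<psi> i v) = (\<psi> i u' ** x i) ** \<psi> i v" by (simp only: matrix_mul_assoc U[OF i])
      also have "\<dots> = \<psi> i u' ** (\<psi> i v' ** x i)" by (simp only: mat2_mult_assoc V[OF i])
      finally show ?thesis by (simp only: matrix_mul_assoc)
    qed
    have 2: "x i ** (\<psi> i v ** \<psi> i u) = \<psi> i v' ** \<psi> i u' ** x i"
    proof -
      have "x i ** (\<psi> i v ** \<psi> i u) = (\<psi> i v' ** x i) ** \<psi> i u" by (simp only: matrix_mul_assoc V[OF i])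
      also have "\<dots> = \<psi> i v' ** (\<psi> i u' ** x i)" by (simp only: mat2_mult_assoc U[OF i])
      finally show ?thesis by (simp only: matrix_mul_assoc)
    qed
    show ?thesis unfolding psiw[OF i] brk_def mat2_mult_distrib 1 2 ..
  qed
  define p q where "p = - nrd u" and "q = - nrd w"
  have pK: "p \<in> K" "q \<in> K" using A_closed(7)[OF uA(1)] A_closed(7)[OF wA(1)] real_subfieldD(5)[OF K] by (auto simp: p_def q_def)
  obtain s1 q1 where s1: "s1 \<noteq> 0" "mpow (h 1) M1 = s1 *\<^sub>R h 1 + q1 *\<^sub>R mat 1"
    using mpow_hyperbolic[OF dh(1) h(2) e1(1)] .
  obtain s2 q2 where s2: "s2 \<noteq> 0" "mpow (k 1) M2 = s2 *\<^sub>R k 1 + q2 *\<^sub>R mat 1"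
    using mpow_hyperbolic[OF dh(2) k(2) e2(1)] .
  have u1: "\<psi> 1 u = s1 *\<^sub>R tpart (h 1)" unfolding u_def psi_qpure[OF one_r e1(2)] e1(4)[OF one_r] by (rule tpart_mpow[OF s1(2)])
  have v1: "\<psi> 1 v = s2 *\<^sub>R tpart (k 1)" unfolding v_def psi_qpure[OF one_r e2(2)] e2(4)[OF one_r] by (rule tpart_mpow[OF s2(2)])
  have "det (\<psi> 1 u) \<noteq> 0" unfolding u1 using s1(1) det_tpart_nonzero[OF dh(1) h(2)] by simp
  then have nu: "nrd u \<noteq> 0" using psi_det[OF one_r uA(1)] embedding_simps(4)[OF K emb[OF ir[OF one_r]]] by auto
  have "\<psi> 1 w = (s1 * s2) *\<^sub>R brk (h 1) (k 1)"
    unfolding psiw(1)[OF one_r] u1 v1 brk_add brk_tpart by simp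
  then have "det (\<psi> 1 w) \<noteq> 0" using hk s1(1) s2(1) by (simp add: brk_def)
  then have nw: "nrd w \<noteq> 0" using psi_det[OF one_r wA(1)] embedding_simps(4)[OF K emb[OF ir[OF one_r]]] by auto
  have pq0: "p \<noteq> 0" "q \<noteq> 0" using nu nw by (simp_all add: p_def q_def)
  have pair: "quaternion_pair (\<psi> i u) (\<psi> i w)" if i: "i \<in> {1..r}" for i
    unfolding psiw(1)[OF i]
  proof (rule commutator_pair)
    show "trace (\<psi> i u) = 0" "trace (\<psi> i v) = 0"
      using psi_trace[OF i uA(1)] psi_trace[OF i uA(2)] embedding_simps(4)[OF K emb[OF ir[OF i]]] by (simp_all add: u_def v_def)
    show "det (\<psi> i u) \<noteq> 0" unfolding psi_det[OF i uA(1)] by (rule emb_nonzero[OF i A_closed(7)[OF uA(1)] nu])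
    show "det (brk (\<psi> i u) (\<psi> i v)) \<noteq> 0"
      unfolding psiw(1)[OF i, symmetric] psi_det[OF i wA(1)] by (rule emb_nonzero[OF i A_closed(7)[OF wA(1)] nw])
  qed
  have pqi: "- det (\<psi> i u) = \<phi> i p" "- det (\<psi> i w) = \<phi> i q" if i: "i \<in> {1..r}" for i
    unfolding p_def q_def psi_det[OF i uA(1)] psi_det[OF i wA(1)]
    using embedding_simps(5)[OF K emb[OF ir[OF i]]] A_closed(7) uA wA by simp_all
  \<comment> \<open>This is \<open>x\<close> times the average of \<open>sandwich\<close> at
    \<open>x^(-1) y\<close>: moving \<open>x\<close> past the left factors \<open>w\<close> and
    \<open>u\<close> turns them into \<open>w'\<close> and \<open>u'\<close>, so the expression lies
    in \<open>A\<close>, and its image is a multiple of \<open>x i\<close>.\<close>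
  define g where "g y = qm w' (qm u' (qm y (qm u w))) + p *\<^sub>R qm w' (qm y w) + q *\<^sub>R qm u' (qm y u) + (p * q) *\<^sub>R y" for y
  have gA: "g y \<in> A" if "y \<in> A" for y
    unfolding g_def by (intro A_closed(1,3,4) that uA wA pK real_subfieldD(4)[OF K])
  have psig: "\<psi> i (g y) = (2 * \<phi> i p * \<phi> i q * trace (adj2 (x i) ** \<psi> i y)) *\<^sub>R x i" if i: "i \<in> {1..r}" and y: "y \<in> A" for i y
  proof -
    interpret quaternion_pair "\<psi> i u" "\<psi> i w" by (rule pair[OF i])
    define z where "z = adj2 (x i) ** \<psi> i y"
    have Y: "\<psi> i y = x i ** z" using dx[OF i] by (simp add: z_def matrix_mul_assoc)
    have cl: "qm u w \<in> A" "qm y (qm u w) \<in> A" "qm u' (qm y (qm u w)) \<in> A" "qm w' (qm u' (qm y (qm u w))) \<in> A"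
      "qm y w \<in> A" "qm w' (qm y w) \<in> A" "qm y u \<in> A" "qm u' (qm y u) \<in> A" "p * q \<in> K"
      "p *\<^sub>R qm w' (qm y w) \<in> A" "q *\<^sub>R qm u' (qm y u) \<in> A" "(p * q) *\<^sub>R y \<in> A"
      by (intro A_closed(3,4) y uA wA pK real_subfieldD(4)[OF K])+
    have cl2: "qm w' (qm u' (qm y (qm u w))) + p *\<^sub>R qm w' (qm y w) \<in> A"
      "qm w' (qm u' (qm y (qm u w))) + p *\<^sub>R qm w' (qm y w) + q *\<^sub>R qm u' (qm y u) \<in> A"
      using A_closed(1) cl by metis+
    have "\<psi> i (g y) = \<psi> i w' ** (\<psi> i u' ** (\<psi> i y ** (\<psi> i u ** \<psi> i w))) + \<phi> i p *\<^sub>R (\<psi> i w' ** (\<psi> i y ** \<psi> i w))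
      + \<phi> i q *\<^sub>R (\<psi> i u' ** (\<psi> i y ** \<psi> i u)) + (\<phi> i p * \<phi> i q) *\<^sub>R \<psi> i y"
      unfolding g_def psi_add[OF i cl2(2) cl(12)] psi_add[OF i cl2(1) cl(11)] psi_add[OF i cl(4) cl(10)]
        psi_scaleR[OF i pK(1) cl(6)] psi_scaleR[OF i pK(2) cl(8)] psi_scaleR[OF i cl(9) y]
        psi_mult[OF i wA(2) cl(3)] psi_mult[OF i uA(3) cl(2)] psi_mult[OF i y cl(1)] psi_mult[OF i uA(1) wA(1)]
        psi_mult[OF i wA(2) cl(5)] psi_mult[OF i y wA(1)] psi_mult[OF i uA(3) cl(7)] psi_mult[OF i y uA(1)]
        embedding_simps(3)[OF K emb[OF ir[OF i]] pK] ..
    also have "\<psi> i w' ** (\<psi> i u' ** (\<psi> i y ** (\<psi> i u ** \<psi> i w))) = x i ** (\<psi> i w ** (\<psi> i u ** (z ** (\<psi> i u ** \<psi> i w))))"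
    proof -
      have "\<psi> i w' ** (\<psi> i u' ** (\<psi> i y ** (\<psi> i u ** \<psi> i w))) = \<psi> i w' ** (\<psi> i u' ** x i) ** (z ** (\<psi> i u ** \<psi> i w))"
        unfolding Y by (simp only: matrix_mul_assoc)
      also have "\<dots> = (\<psi> i w' ** x i) ** (\<psi> i u ** (z ** (\<psi> i u ** \<psi> i w)))"
        unfolding U[OF i, symmetric] by (simp only: matrix_mul_assoc)
      also have "\<dots> = x i ** (\<psi> i w ** (\<psi> i u ** (z ** (\<psi> i u ** \<psi> i w))))"
        unfolding W[OF i, symmetric] by (simp only: matrix_mul_assoc)
      finally show ?thesis .
    qed
    also have "\<psi> i w' ** (\<psi> i y ** \<psi> i w) = x i ** (\<psi> i w ** (z ** \<psi> i w))"
    proof -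
      have "\<psi> i w' ** (\<psi> i y ** \<psi> i w) = (\<psi> i w' ** x i) ** (z ** \<psi> i w)" unfolding Y by (simp only: matrix_mul_assoc)
      then show ?thesis unfolding W[OF i, symmetric] by (simp only: matrix_mul_assoc)
    qed
    also have "\<psi> i u' ** (\<psi> i y ** \<psi> i u) = x i ** (\<psi> i u ** (z ** \<psi> i u))"
    proof -
      have "\<psi> i u' ** (\<psi> i y ** \<psi> i u) = (\<psi> i u' ** x i) ** (z ** \<psi> i u)" unfolding Y by (simp only: matrix_mul_assoc)
      then show ?thesis unfolding U[OF i, symmetric] by (simp only: matrix_mul_assoc)
    qed
    also have "x i ** (\<psi> i w ** (\<psi> i u ** (z ** (\<psi> i u ** \<psi> i w)))) + \<phi> i p *\<^sub>R (x i ** (\<psi> i w ** (z ** \<psi> i w))) +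
        \<phi> i q *\<^sub>R (x i ** (\<psi> i u ** (z ** \<psi> i u))) + (\<phi> i p * \<phi> i q) *\<^sub>R \<psi> i y
      = x i ** (\<psi> i w ** (\<psi> i u ** (z ** (\<psi> i u ** \<psi> i w))) + \<phi> i p *\<^sub>R (\<psi> i w ** (z ** \<psi> i w)) +
        \<phi> i q *\<^sub>R (\<psi> i u ** (z ** \<psi> i u)) + (\<phi> i p * \<phi> i q) *\<^sub>R z)"
      unfolding Y by (simp add: mat2_mult_distrib)
    also have "\<dots> = (2 * \<phi> i p * \<phi> i q * trace z) *\<^sub>R x i"
      using sandwich[of z] unfolding pqi[OF i] by simp
    finally show ?thesis by (simp only: z_def)
  qed
  \<comment> \<open>The images of the quaternion basis detect every nonzero matrix through the trace
    form, so some \<open>y\<close> gives a nonzero multiple.\<close>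
  have "\<exists>y\<in>A. trace (adj2 (x 1) ** \<psi> 1 y) \<noteq> 0"
  proof (rule ccontr)
    assume "\<not> ?thesis"
    then have no: "trace (adj2 (x 1) ** \<psi> 1 y) = 0" if "y \<in> A" for y using that by blast
    interpret quaternion_pair "\<psi> 1 Q1.qi" "\<psi> 1 Q1.qj" by (rule Q1.ij_pair)
    have ijA: "Q1.qi \<in> A" "Q1.qj \<in> A" using real_subfieldD[OF K] by auto
    have "adj2 (x 1) = 0"
    proof (rule orthogonal_zero)
      show "trace (adj2 (x 1)) = 0" using no[OF A_closed(5)] psi_one[OF one_r] by simp
      show "trace (adj2 (x 1) ** \<psi> 1 Q1.qi) = 0" "trace (adj2 (x 1) ** \<psi> 1 Q1.qj) = 0" using no ijA by blast+
      show "trace (adj2 (x 1) ** (\<psi> 1 Q1.qi ** \<psi> 1 Q1.qj)) = 0"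
        using no[OF A_closed(3)[OF ijA]] psi_mult[OF one_r ijA] by simp
    qed
    then have "det (x 1) = 0" using det2_adj2[of "x 1"] by (simp add: det_2)
    then show False using dx[OF one_r] by simp
  qed
  then obtain y where y: "y \<in> A" "trace (adj2 (x 1) ** \<psi> 1 y) \<noteq> 0" by blast
  define G where "G = g y"
  define s where "s i = 2 * \<phi> i p * \<phi> i q * trace (adj2 (x i) ** \<psi> i y)" for i
  have GA: "G \<in> A" and psiG: "\<And>i. i \<in> {1..r} \<Longrightarrow> \<psi> i G = s i *\<^sub>R x i"
    using gA[OF y(1)] psig[OF _ y(1)] by (auto simp only: G_def s_def)
  have x0: "x i \<noteq> 0" if "i \<in> {1..r}" for i using dx[OF that] by (auto simp: det_2)
  have "s 1 \<noteq> 0" unfolding s_def using y(2) emb_nonzero[OF one_r pK(1) pq0(1)] emb_nonzero[OF one_r pK(2) pq0(2)] by simp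
  then have "\<psi> 1 G \<noteq> 0" using psiG[OF one_r] x0[OF one_r] by simp
  then have G0: "G \<noteq> 0" using Q1.psi_zero by auto
  \<comment> \<open>Nonvanishing at the first place carries over to the others through
    \<open>G\<close> itself, since every \<open>\<psi> i\<close> is injective on
    \<open>A\<close>.\<close>
  have s0: "s i \<noteq> 0" if i: "i \<in> {1..r}" for i
  proof
    assume "s i = 0"
    then have "\<psi> i G = 0" using psiG[OF i] by simp
    then have "G = 0" by (rule psi_eq_0[OF i GA])
    with G0 show False by simp
  qed
  have nG: "\<phi> i (nrd G) = (s i)\<^sup>2" if i: "i \<in> {1..r}" for i
    unfolding psi_det[OF i GA, symmetric] psiG[OF i] using dx[OF i] by simp
  have nGK: "nrd G \<in> K" by (rule A_closed(7)[OF GA])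
  have nG0: "nrd G \<noteq> 0" using nG[OF one_r] s0[OF one_r] embedding_simps(4)[OF K emb[OF ir[OF one_r]]] by auto
  have iK: "inverse (nrd G) \<in> K" by (rule real_subfieldD(6)[OF K nGK])
  define \<alpha> where "\<alpha> = inverse (nrd G) *\<^sub>R qm G G"
  have "\<alpha> \<in> A" unfolding \<alpha>_def by (intro A_closed(3,4) GA iK)
  moreover have "nrd \<alpha> = 1" unfolding \<alpha>_def reduced_norm_scaleR reduced_norm_mult
  proof -
    have "(inverse (nrd G))\<^sup>2 * (nrd G * nrd G) = (inverse (nrd G) * nrd G)\<^sup>2" by (simp only: power2_eq_square mult_ac)
    then show "(inverse (nrd G))\<^sup>2 * (nrd G * nrd G) = 1" using nG0 by simp
  qed
  moreover have "\<psi> i \<alpha> = x i ** x i" if i: "i \<in> {1..r}" for i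
    unfolding \<alpha>_def psi_scaleR[OF i iK A_closed(3)[OF GA GA]] psi_mult[OF i GA GA] psiG[OF i]
      embedding_simps(6)[OF K emb[OF ir[OF i]] nGK] nG[OF i]
  proof -
    have "inverse ((s i)\<^sup>2) *\<^sub>R ((s i *\<^sub>R x i) ** (s i *\<^sub>R x i)) = (inverse ((s i)\<^sup>2) * (s i)\<^sup>2) *\<^sub>R (x i ** x i)"
      by (simp only: mat2_mult_scaleR scaleR_scaleR power2_eq_square mult.assoc)
    then show "inverse ((s i)\<^sup>2) *\<^sub>R ((s i *\<^sub>R x i) ** (s i *\<^sub>R x i)) = x i ** x i" using s0[OF i] by simp
  qed
  ultimately show ?thesis by (rule that)
qed

end

text \<open>The pair \<open>h\<close>, \<open>k\<close> is the input of \<open>square_lift\<close>;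
  in the theorem it comes from \<open>\<Gamma>\<close>.\<close>

locale nonelementary_arithmetic = arithmetic_group +
  fixes h k :: "nat \<Rightarrow> mat2"
  assumes h: "h \<in> lifts r \<Delta>" "\<bar>trace (h 1)\<bar> > 2" and k: "k \<in> lifts r \<Delta>" "\<bar>trace (k 1)\<bar> > 2"
    and hk: "det (h 1 ** k 1 - k 1 ** h 1) \<noteq> 0"
begin

text \<open>Lifts to \<open>A\<close> of products of squares. They are exact, since
  \<open>(- x)^2 = x^2\<close>, so traces in \<open>A\<close> carry a sign and can be compared
  between places.\<close>

inductive_set sqs :: "(nat \<Rightarrow> mat2) set \<Rightarrow> quat4 set" for T where
  one: "(1, 0, 0, 0) \<in> sqs T"
| step: "x \<in> T \<Longrightarrow> \<alpha> \<in> A \<Longrightarrow> nrd \<alpha> = 1 \<Longrightarrow> (\<And>i. i \<in> {1..r} \<Longrightarrow> \<psi> i \<alpha> = x i ** x i) \<Longrightarrow> \<beta> \<in> sqs T \<Longrightarrow>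
    qm \<alpha> \<beta> \<in> sqs T"

lemma sqs_A: "\<alpha> \<in> sqs T \<Longrightarrow> \<alpha> \<in> A \<and> nrd \<alpha> = 1"
proof (induction rule: sqs.induct)
  case one
  show ?case using A_closed(5) by simp
next
  case (step x \<alpha> \<beta>)
  then show ?case using A_closed(3)[of \<alpha> \<beta>] by (simp only: reduced_norm_mult) simp
qed

lemma sqs_base: "x \<in> T \<Longrightarrow> \<alpha> \<in> A \<Longrightarrow> nrd \<alpha> = 1 \<Longrightarrow> (\<And>i. i \<in> {1..r} \<Longrightarrow> \<psi> i \<alpha> = x i ** x i) \<Longrightarrow> \<alpha> \<in> sqs T"
  using sqs.step[OF _ _ _ _ sqs.one, of x T \<alpha>] by simp

lemma sqs_mult: "\<alpha> \<in> sqs T \<Longrightarrow> \<beta> \<in> sqs T \<Longrightarrow> qm \<alpha> \<beta> \<in> sqs T"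
  by (induction rule: sqs.induct) (auto simp only: quat_mult_assoc quat_mult_one intro: sqs.step)

lemma sqs_lift: "x \<in> lifts r \<Delta> \<Longrightarrow> \<exists>\<alpha>\<in>A. nrd \<alpha> = 1 \<and> (\<forall>i\<in>{1..r}. \<psi> i \<alpha> = x i ** x i)"
  using square_lift[OF h k hk] by metis

text \<open>The inverse of a square is the square of an inverse, so products alone exhaust the
  generated subgroup.\<close>

lemma squares_subgroup_eq:
  assumes \<Gamma>: "subgroup \<Gamma> (PSL2R_pow r)" "\<Gamma> \<subseteq> \<Delta>"
  shows "squares_subgroup (PSL2R_pow r) \<Gamma> = (\<lambda>\<alpha>. pc \<alpha>) ` sqs (lifts r \<Gamma>)"
proof
  let ?G = "PSL2R_pow r"
  interpret group ?G by (rule group_PSL2R_pow)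
  have lift: "\<exists>x\<in>lifts r \<Gamma>. g = pcls r x" if "g \<in> \<Gamma>" for g
    using subgroup_eq_lifts[of \<Gamma> r] subgroup.subset[OF \<Gamma>(1)] that by blast
  have sub: "lifts r \<Gamma> \<subseteq> lifts r \<Delta>" using \<Gamma>(2) by (auto simp: lifts_def)
  have sq: "g \<otimes>\<^bsub>?G\<^esub> g \<in> (\<lambda>\<alpha>. pc \<alpha>) ` sqs (lifts r \<Gamma>)" if g: "g \<in> \<Gamma>" for g
  proof -
    obtain x where x: "x \<in> lifts r \<Gamma>" "g = pcls r x" using lift[OF g] by blast
    obtain \<alpha> where \<alpha>: "\<alpha> \<in> A" "nrd \<alpha> = 1" "\<And>i. i \<in> {1..r} \<Longrightarrow> \<psi> i \<alpha> = x i ** x i"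
      using sqs_lift[OF subsetD[OF sub x(1)]] by blast
    have "g \<otimes>\<^bsub>?G\<^esub> g = pc \<alpha>" unfolding x(2) pcls_mult pcls_eq_iff using \<alpha>(3) by simp
    moreover have "\<alpha> \<in> sqs (lifts r \<Gamma>)" by (rule sqs_base[OF x(1) \<alpha>])
    ultimately show ?thesis by blast
  qed
  show "squares_subgroup ?G \<Gamma> \<subseteq> (\<lambda>\<alpha>. pc \<alpha>) ` sqs (lifts r \<Gamma>)"
  proof
    fix g assume "g \<in> squares_subgroup ?G \<Gamma>"
    then have "g \<in> generate ?G {g \<otimes>\<^bsub>?G\<^esub> g | g. g \<in> \<Gamma>}" by (simp add: squares_subgroup_def)
    then show "g \<in> (\<lambda>\<alpha>. pc \<alpha>) ` sqs (lifts r \<Gamma>)"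
    proof (induction rule: generate.induct)
      case one
      show ?case using sqs.one pc_one by (metis image_eqI)
    next
      case (incl g)
      then show ?case using sq by blast
    next
      case (inv g)
      then obtain g' where g': "g' \<in> \<Gamma>" "g = g' \<otimes>\<^bsub>?G\<^esub> g'" by blast
      have gc: "g' \<in> carrier ?G" using g'(1) subgroup.mem_carrier[OF \<Gamma>(1)] by blast
      have "inv\<^bsub>?G\<^esub> g = inv\<^bsub>?G\<^esub> g' \<otimes>\<^bsub>?G\<^esub> inv\<^bsub>?G\<^esub> g'" unfolding g'(2) by (rule inv_mult_group[OF gc gc])
      then show ?case using sq[OF subgroup.m_inv_closed[OF \<Gamma>(1) g'(1)]] by simp
    next
      case (eng g1 g2)
      then obtain \<alpha> \<beta> where ab: "g1 = pc \<alpha>" "\<alpha> \<in> sqs (lifts r \<Gamma>)" "g2 = pc \<beta>" "\<beta> \<in> sqs (lifts r \<Gamma>)" by blast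
      have "g1 \<otimes>\<^bsub>?G\<^esub> g2 = pc (qm \<alpha> \<beta>)" unfolding ab(1,3)
        by (rule pc_mult) (use sqs_A ab in blast)+
      then show ?case using sqs_mult[OF ab(2,4)] by (rule image_eqI)
    qed
  qed
  show "(\<lambda>\<alpha>. pc \<alpha>) ` sqs (lifts r \<Gamma>) \<subseteq> squares_subgroup ?G \<Gamma>"
  proof (rule image_subsetI)
    fix \<alpha> assume "\<alpha> \<in> sqs (lifts r \<Gamma>)"
    then show "pc \<alpha> \<in> squares_subgroup ?G \<Gamma>"
    proof (induction rule: sqs.induct)
      case one
      show ?case unfolding pc_one squares_subgroup_def by (rule generate.one)
    next
      case (step x \<alpha> \<beta>)
      have "pc \<alpha> = pcls r x \<otimes>\<^bsub>?G\<^esub> pcls r x" unfolding pcls_mult pcls_eq_iff using step by simp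
      moreover have "pcls r x \<in> \<Gamma>" using step(1) by (simp add: lifts_def)
      ultimately have "pc \<alpha> \<in> squares_subgroup ?G \<Gamma>"
        unfolding squares_subgroup_def by (intro generate.incl) blast
      moreover have "pc (qm \<alpha> \<beta>) = pc \<alpha> \<otimes>\<^bsub>?G\<^esub> pc \<beta>"
        using pc_mult[OF step(2)] sqs_A[OF step(5)] by simp
      ultimately show ?case using step.IH unfolding squares_subgroup_def by (simp only: generate.eng)
    qed
  qed
qed

text \<open>The trace field at the identity place, inside \<open>K\<close>; the other places give
  its images under \<open>\<phi> i\<close>.\<close>

definition LG :: "(nat \<Rightarrow> mat2 set) set \<Rightarrow> real set" where
  "LG \<Gamma> = field_over_Q (qtr ` sqs (lifts r \<Gamma>))"

lemma LG_subfield: "real_subfield (LG \<Gamma>)"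
  unfolding LG_def by (rule field_over_Q_subfield)

lemma qtr_sqs_K: "qtr ` sqs T \<subseteq> K"
  using sqs_A A_closed(6) by blast

lemma LG_K: "LG \<Gamma> \<subseteq> K"
  unfolding LG_def by (rule field_over_Q_least[OF K qtr_sqs_K])

lemma trace_field_eq:
  assumes \<Gamma>: "subgroup \<Gamma> (PSL2R_pow r)" "\<Gamma> \<subseteq> \<Delta>" and i: "i \<in> {1..r}"
  shows "field_over_Q (Tr (proj_set i (squares_subgroup (PSL2R_pow r) \<Gamma>))) = \<phi> i ` LG \<Gamma>"
proof -
  have "Tr (proj_set i (squares_subgroup (PSL2R_pow r) \<Gamma>)) = (\<lambda>\<alpha>. \<bar>\<phi> i (qtr \<alpha>)\<bar>) ` sqs (lifts r \<Gamma>)"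
    unfolding Tr_def proj_set_def squares_subgroup_eq[OF \<Gamma>] image_image
  proof (rule image_cong[OF refl])
    fix \<alpha> assume "\<alpha> \<in> sqs (lifts r \<Gamma>)"
    then have "\<alpha> \<in> A" using sqs_A by blast
    then show "tr_abs (pc \<alpha> i) = \<bar>\<phi> i (qtr \<alpha>)\<bar>"
      unfolding pcls_nth[OF i] tr_abs_cls using psi_trace[OF i] by simp
  qed
  also have "\<dots> = (\<lambda>x. \<bar>x\<bar>) ` \<phi> i ` qtr ` sqs (lifts r \<Gamma>)" by (simp add: image_image)
  finally show ?thesis
    unfolding LG_def embedding_field_over_Q[OF K emb[OF ir[OF i]] qtr_sqs_K]
    by (simp only: field_over_Q_abs)
qed

text \<open>Injectivity of \<open>\<phi> i\<close> on \<open>K\<close> makes the right-hand side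
  independent of \<open>i\<close>.\<close>

lemma same_trace_field_iff:
  assumes \<Gamma>: "subgroup \<Gamma> (PSL2R_pow r)" "\<Gamma> \<subseteq> \<Delta>" and i: "i \<in> {1..r}"
  shows "same_trace_field r i \<Gamma> \<Delta> \<longleftrightarrow> LG \<Gamma> = LG \<Delta>"
  unfolding same_trace_field_def trace_field_eq[OF \<Gamma> i] trace_field_eq[OF Delta subset_refl i]
  by (rule inj_on_image_eq_iff[OF embedding_inj[OF K emb[OF ir[OF i]]] LG_K LG_K])

lemma Delta_qpow:
  assumes x: "x \<in> A" and d: "pc (qpow a b x m) \<in> \<Delta>"
  shows "pc (qpow a b x (m * j)) \<in> \<Delta>"
proof -
  interpret group "PSL2R_pow r" by (rule group_PSL2R_pow)
  have "pc (qpow a b x m) [^]\<^bsub>PSL2R_pow r\<^esub> j \<in> \<Delta>"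
    by (induction j) (use d Delta in \<open>auto intro: subgroup.m_closed subgroup.one_closed\<close>)
  then show ?thesis unfolding pc_pow[OF Q1.qpow_A[OF x]] qpow_mult .
qed

lemma qpow_sqs:
  assumes x: "x \<in> A" "nrd x = 1" and d: "pc (qpow a b x N) \<in> \<Delta>"
  shows "qpow a b x (N + N) \<in> sqs (lifts r \<Delta>)"
proof (rule sqs_base[where x = "\<lambda>i. \<psi> i (qpow a b x N)"])
  have A: "qpow a b x N \<in> A" by (rule Q1.qpow_A[OF x(1)])
  show "(\<lambda>i. \<psi> i (qpow a b x N)) \<in> lifts r \<Delta>"
    using psi_SLr[OF A reduced_norm_qpow[OF x(2)]] d by (simp add: lifts_def)
  show "qpow a b x (N + N) \<in> A" by (rule Q1.qpow_A[OF x(1)])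
  show "nrd (qpow a b x (N + N)) = 1" by (rule reduced_norm_qpow[OF x(2)])
  show "\<psi> i (qpow a b x (N + N)) = \<psi> i (qpow a b x N) ** \<psi> i (qpow a b x N)" if i: "i \<in> {1..r}" for i
    unfolding qpow_add by (rule psi_mult[OF i A A])
qed

text \<open>The candidates are, up to sign and a factor 2, the commutators of \<open>i\<close>,
  \<open>j\<close>, \<open>ij\<close> with the given element, hence orthogonal to it. If all three
  had norm 0, that element would be 0.\<close>

lemma orthogonal_pure:
  assumes "(0, e1, e2, e3) \<in> A" "(0, e1, e2, e3) \<noteq> (0::quat4)"
  obtains \<delta> where "\<delta> \<in> A" "qtr \<delta> = 0" "fst (qm (0, e1, e2, e3) \<delta>) = 0" "nrd \<delta> \<noteq> 0"
proof -
  have e: "e1 \<in> K" "e2 \<in> K" "e3 \<in> K" using assms(1) by auto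
  have ab0: "a \<noteq> 0" "b \<noteq> 0" "a \<in> K" "b \<in> K" using a b by auto
  have cl: "(0, 0, a * e3, e2) \<in> A" "(0, b * e3, 0, e1) \<in> A" "(0, - (b * e2), a * e1, 0) \<in> A"
    using e ab0 real_subfieldD[OF K] by auto
  consider "nrd (0, 0, a * e3, e2) \<noteq> 0" | "nrd (0, b * e3, 0, e1) \<noteq> 0" | "nrd (0, - (b * e2), a * e1, 0) \<noteq> 0"
    | "nrd (0, 0, a * e3, e2) = 0" "nrd (0, b * e3, 0, e1) = 0" "nrd (0, - (b * e2), a * e1, 0) = 0" by blast
  then show ?thesis
  proof cases
    case 1
    then show ?thesis by (intro that[OF cl(1)]) (simp_all add: qtr_def)
  next
    case 2
    then show ?thesis by (intro that[OF cl(2)]) (simp_all add: qtr_def)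
  next
    case 3
    then show ?thesis by (intro that[OF cl(3)]) (simp_all add: qtr_def)
  next
    case 4
    have "nrd (0, 0, a * e3, e2) = (a * b) * (e2\<^sup>2 - a * e3\<^sup>2)" by (simp add: power2_eq_square algebra_simps)
    then have 1: "e2\<^sup>2 = a * e3\<^sup>2" using 4(1) ab0 by simp
    have "nrd (0, b * e3, 0, e1) = (a * b) * (e1\<^sup>2 - b * e3\<^sup>2)" by (simp add: power2_eq_square algebra_simps)
    then have 2: "e1\<^sup>2 = b * e3\<^sup>2" using 4(2) ab0 by simp
    have "nrd (0, - (b * e2), a * e1, 0) = - (a * b) * (b * e2\<^sup>2 + a * e1\<^sup>2)" by (simp add: power2_eq_square algebra_simps)
    then have "b * e2\<^sup>2 + a * e1\<^sup>2 = 0" using 4(3) ab0 by simp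
    then have "e3 = 0" unfolding 1 2 using ab0 by simp
    then have "(0, e1, e2, e3) = (0::quat4)" using 1 2 by (simp add: zero_prod_def)
    with assms(2) show ?thesis by simp
  qed
qed

text \<open>Conjugates \<open>\<epsilon>'\<close> of \<open>\<epsilon>\<close> have powers in \<open>\<O>\<close>. Rotating \<open>\<epsilon>\<close> by \<open>1 + s \<delta>\<close>, where \<open>\<delta>\<close> anticommutes with
  the pure part of \<open>\<epsilon>\<close> and \<open>d = \<delta>\<^sup>2\<close>, forces \<open>s\<^sup>2 d\<close> into the trace field for every \<open>s \<in> K\<close>.\<close>

lemma rotation_in_trace_field:
  assumes e: "\<epsilon> \<in> \<O>" "nrd \<epsilon> = 1" "\<bar>qtr \<epsilon>\<bar> > 2" and d: "\<delta> \<in> A" "qtr \<delta> = 0" "fst (qm (qpure \<epsilon>) \<delta>) = 0"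
    and s: "s \<in> K"
  shows "s\<^sup>2 * (- nrd \<delta>) \<in> LG \<Delta>"
\<comment> \<open>In this case \<open>1 + s \<delta>\<close> has norm 0 and cannot be used for
  conjugation.\<close>
proof (cases "s\<^sup>2 * (- nrd \<delta>) = 1")
  case True
  then show ?thesis using real_subfieldD(1)[OF LG_subfield] by simp
next
  case False
  note L = real_subfieldD[OF LG_subfield[of \<Delta>]]
  define t where "t = qtr \<epsilon>"
  define q where "q = s\<^sup>2 * (- nrd \<delta>)"
  have q1: "1 - q \<noteq> 0" using False by (simp add: q_def)
  define e0 where "e0 = qpure \<epsilon>"
  define \<rho> where "\<rho> = qm \<delta> e0"
  have eA: "\<epsilon> \<in> A" by (rule O_A[OF e(1)])
  have e0A: "e0 \<in> A" unfolding e0_def by (rule qpure_A[OF eA])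
  have \<rho>A: "\<rho> \<in> A" unfolding \<rho>_def by (rule A_closed(3)[OF d(1) e0A])
  have pure: "\<exists>x1 x2 x3. x = (0, x1, x2, x3)" if "qtr x = 0" for x
    using that by (cases x) (simp add: qtr_def)
  obtain a1 a2 a3 where e0': "e0 = (0, a1, a2, a3)" using pure[of e0] by (auto simp: e0_def)
  obtain d1 d2 d3 where d': "\<delta> = (0, d1, d2, d3)" using pure[OF d(2)] by auto
  have orth: "a * a1 * d1 + b * a2 * d2 - a * b * a3 * d3 = 0"
    using d(3) unfolding e0_def[symmetric] e0' d' by simp
  have r1: "qtr \<rho> = 0" using orth unfolding \<rho>_def e0' d' by (simp add: qtr_def algebra_simps)
  have r2: "fst (qm e0 \<rho>) = 0" unfolding \<rho>_def e0' d' by (simp add: algebra_simps)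
  have r3: "nrd \<rho> = nrd \<delta> * nrd e0" unfolding \<rho>_def by (rule reduced_norm_mult)
  obtain b1 b2 b3 where \<rho>': "\<rho> = (0, b1, b2, b3)" using pure[OF r1] by auto
  \<comment> \<open>As \<open>\<delta>\<close> anticommutes with \<open>e0\<close>, conjugation by
    \<open>1 + s \<delta>\<close> maps \<open>e0\<close> to
    \<open>(1 + s \<delta>)^2 e0 / (1 - q)\<close>, which expands to \<open>e0r\<close>. Instead of
    conjugating, trace and norm of \<open>e0r\<close> are computed directly.\<close>
  define R where "R = (1 + q) / (1 - q)"
  define e0r where "e0r = R *\<^sub>R e0 + (2 * s / (1 - q)) *\<^sub>R \<rho>"
  have qK: "q \<in> K" unfolding q_def power2_eq_square using s A_closed(7)[OF d(1)] by (intro real_subfieldD(4,5)[OF K])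
  have RK: "R \<in> K" "2 * s / (1 - q) \<in> K"
    unfolding R_def using qK s real_subfieldD(1)[OF K] real_subfield_numeral[OF K, of "num.Bit0 num.One"]
    by (auto intro!: real_subfieldD(8)[OF K] real_subfieldD(3)[OF K] real_subfieldD(7)[OF K] real_subfieldD(4)[OF K])
  have e0rA: "e0r \<in> A" unfolding e0r_def by (intro A_closed(1,4) RK e0A \<rho>A)
  have tr0: "qtr e0r = 0" using r1 by (simp add: e0r_def qtr_simps e0_def)
  have ortho_norm: "nrd (x *\<^sub>R e0 + y *\<^sub>R \<rho>) = x\<^sup>2 * nrd e0 + y\<^sup>2 * nrd \<rho>" for x y
  proof -
    have "nrd (x *\<^sub>R e0 + y *\<^sub>R \<rho>) = x\<^sup>2 * nrd e0 + y\<^sup>2 * nrd \<rho> - 2 * x * y * fst (qm e0 \<rho>)"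
      unfolding e0' \<rho>' by (simp add: power2_eq_square algebra_simps)
    then show ?thesis using r2 by simp
  qed
  have n0: "nrd e0r = nrd e0"
  proof -
    have "nrd e0r = (R\<^sup>2 + (2 * s / (1 - q))\<^sup>2 * nrd \<delta>) * nrd e0"
      unfolding e0r_def ortho_norm r3 by (simp add: algebra_simps)
    also have "(2 * s / (1 - q))\<^sup>2 * nrd \<delta> = - 4 * q / (1 - q)\<^sup>2"
      by (simp add: q_def power_divide power_mult_distrib)
    also have "R\<^sup>2 + - 4 * q / (1 - q)\<^sup>2 = ((1 + q)\<^sup>2 - 4 * q) / (1 - q)\<^sup>2"
      by (simp add: R_def power_divide diff_divide_distrib)
    also have "(1 + q)\<^sup>2 - 4 * q = (1 - q)\<^sup>2" by (simp add: power2_eq_square algebra_simps)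
    finally show ?thesis using q1 by simp
  qed
  have inner: "fst (qm e0 e0r) = - R * nrd e0"
  proof -
    have "fst (qm e0 e0r) = R * fst (qm e0 e0) + (2 * s / (1 - q)) * fst (qm e0 \<rho>)"
      unfolding e0r_def quat_mult_distrib quat_mult_scaleR by simp
    moreover have "fst (qm e0 e0) = - nrd e0" unfolding e0' by (simp add: power2_eq_square)
    ultimately show ?thesis using r2 by simp
  qed
  have shift: "nrd (x *\<^sub>R y + c *\<^sub>R (1, 0, 0, 0)) = x\<^sup>2 * nrd y + c\<^sup>2" if y: "qtr y = 0" for x y c
    using pure[OF y] by (auto simp: power2_eq_square algebra_simps)
  define \<epsilon>r where "\<epsilon>r = 1 *\<^sub>R e0r + (t / 2) *\<^sub>R (1, 0, 0, 0)"
  have e_eq: "\<epsilon> = 1 *\<^sub>R e0 + (t / 2) *\<^sub>R (1, 0, 0, 0)" by (simp add: e0_def qpure_def t_def del: scaleR_Pair)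
  have t2: "t / 2 \<in> K" unfolding t_def using A_closed(6)[OF eA] real_subfield_numeral[OF K] by (rule real_subfieldD(8)[OF K])
  have erA: "\<epsilon>r \<in> A" unfolding \<epsilon>r_def by (intro A_closed(1,4,5) t2 e0rA real_subfieldD(1)[OF K])
  have tr_e0: "qtr e0 = 0" by (simp add: e0_def)
  have er: "qtr \<epsilon>r = t" "nrd \<epsilon>r = 1"
  proof -
    show "qtr \<epsilon>r = t" unfolding \<epsilon>r_def qtr_simps tr0 by simp
    have "nrd \<epsilon>r = nrd (1 *\<^sub>R e0 + (t / 2) *\<^sub>R (1, 0, 0, 0))"
      unfolding \<epsilon>r_def shift[OF tr0] shift[OF tr_e0] n0 ..
    then show "nrd \<epsilon>r = 1" unfolding e_eq[symmetric] e(2) .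
  qed
  have talg: "algebraic_int t" unfolding t_def by (rule hyperbolic_trace_integral[OF e])
  obtain k1 where k1: "k1 > 0" "qpow a b \<epsilon>r k1 \<in> \<O>" using power_in_order[OF erA er(2)] talg er(1) by blast
  obtain k2 where k2: "k2 > 0" "pc (qpow a b (qpow a b \<epsilon>r k1) k2) \<in> \<Delta>"
    using power_in_Delta[OF k1(2) reduced_norm_qpow[OF er(2)]] .
  obtain k3 where k3: "k3 > 0" "pc (qpow a b \<epsilon> k3) \<in> \<Delta>" using power_in_Delta[OF e(1,2)] .
  \<comment> \<open>A common exponent; it is doubled below to land in \<open>sqs\<close>.\<close>
  define N where "N = (k1 * k2) * k3"
  have 1: "pc (qpow a b \<epsilon>r N) \<in> \<Delta>" unfolding N_def by (rule Delta_qpow[OF erA]) (use k2(2) in \<open>simp only: qpow_mult\<close>)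
  have "pc (qpow a b \<epsilon> (k3 * (k1 * k2))) \<in> \<Delta>" by (rule Delta_qpow[OF eA k3(2)])
  then have 2: "pc (qpow a b \<epsilon> N) \<in> \<Delta>" by (simp only: N_def mult.commute)
  have s1: "qpow a b \<epsilon>r (N + N) \<in> sqs (lifts r \<Delta>)" by (rule qpow_sqs[OF erA er(2) 1])
  have s2: "qpow a b \<epsilon> (N + N) \<in> sqs (lifts r \<Delta>)" by (rule qpow_sqs[OF eA e(2) 2])
  have "N + N > 0" using k1(1) k2(1) k3(1) by (simp add: N_def)
  then obtain m where m: "N + N = Suc m" using gr0_conv_Suc by blast
  \<comment> \<open>Equal traces give the powers of \<open>\<epsilon>\<close> and
    \<open>\<epsilon>r\<close> the same two coefficients.\<close>
  define \<sigma> c where "\<sigma> = cheb t (Suc m)" and "c = \<sigma> * (t / 2) - cheb t m"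
  have \<sigma>0: "\<sigma> \<noteq> 0" unfolding \<sigma>_def by (rule cheb_nonzero) (use e(3) in \<open>simp_all add: t_def\<close>)
  have p1: "qpow a b \<epsilon> (N + N) = \<sigma> *\<^sub>R e0 + c *\<^sub>R (1, 0, 0, 0)"
    unfolding m qpow_cheb[OF e(2)] t_def[symmetric] \<sigma>_def[symmetric] c_def
    by (subst (1) e_eq) (simp add: algebra_simps del: scaleR_Pair)
  have p2: "qpow a b \<epsilon>r (N + N) = \<sigma> *\<^sub>R e0r + c *\<^sub>R (1, 0, 0, 0)"
    unfolding m qpow_cheb[OF er(2)] er(1) \<sigma>_def[symmetric] c_def
    by (subst (1) \<epsilon>r_def) (simp add: algebra_simps del: scaleR_Pair)
  have "qtr (qpow a b \<epsilon> (N + N)) \<in> LG \<Delta>" unfolding LG_def by (rule field_over_Q_incl[OF imageI[OF s2]])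
  then have "2 * c \<in> LG \<Delta>" unfolding p1 qtr_simps tr_e0 by (simp add: mult.commute)
  then have "2 * c / 2 \<in> LG \<Delta>" using real_subfield_numeral[OF LG_subfield] by (rule L(8))
  then have cL: "c \<in> LG \<Delta>" by simp
  have norm: "\<sigma>\<^sup>2 * nrd e0 = 1 - c\<^sup>2"
    using reduced_norm_qpow[OF e(2), of "N + N"] unfolding p1 shift[OF tr_e0] by simp
  \<comment> \<open>The trace of the product sees the inner product of \<open>e0\<close> and
    \<open>e0r\<close>, and with it \<open>R\<close>, from which \<open>q\<close> is
    recovered.\<close>
  have "qtr (qm (qpow a b \<epsilon> (N + N)) (qpow a b \<epsilon>r (N + N))) \<in> LG \<Delta>"
    unfolding LG_def by (rule field_over_Q_incl[OF imageI[OF sqs_mult[OF s2 s1]]])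
  also have "qtr (qm (qpow a b \<epsilon> (N + N)) (qpow a b \<epsilon>r (N + N))) = 2 * (c * c - R * (1 - c\<^sup>2))"
  proof -
    have "qtr (qm (qpow a b \<epsilon> (N + N)) (qpow a b \<epsilon>r (N + N))) = 2 * (\<sigma>\<^sup>2 * fst (qm e0 e0r) + c * c) + c * \<sigma> * (qtr e0 + qtr e0r)"
      unfolding p1 p2 quat_mult_distrib quat_mult_scaleR quat_mult_one
      by (simp add: qtr_def power2_eq_square algebra_simps del: scaleR_Pair)
    then show ?thesis unfolding inner tr_e0 tr0 norm[symmetric] by (simp add: algebra_simps)
  qed
  finally have "2 * (c * c - R * (1 - c\<^sup>2)) / 2 \<in> LG \<Delta>" using real_subfield_numeral[OF LG_subfield] by (rule L(8))
  then have "c * c - R * (1 - c\<^sup>2) \<in> LG \<Delta>" by simp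
  from L(7)[OF L(4)[OF cL cL] this] have "c * c - (c * c - R * (1 - c\<^sup>2)) \<in> LG \<Delta>" .
  then have RcL: "R * (1 - c\<^sup>2) \<in> LG \<Delta>" by simp
  have c2L: "1 - c\<^sup>2 \<in> LG \<Delta>" unfolding power2_eq_square by (intro L cL)
  have "nrd e0 \<noteq> 0"
  proof
    assume "nrd e0 = 0"
    moreover have "nrd \<epsilon> = 1\<^sup>2 * nrd e0 + (t / 2)\<^sup>2" by (subst e_eq) (rule shift[OF tr_e0])
    ultimately have "(t / 2)\<^sup>2 = 1" using e(2) by simp
    then have "t / 2 = 1 \<or> t / 2 = - 1" by (simp only: power2_eq_1_iff)
    then show False using e(3) by (auto simp: t_def)
  qed
  then have "\<sigma>\<^sup>2 * nrd e0 \<noteq> 0" using \<sigma>0 by simp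
  then have "1 - c\<^sup>2 \<noteq> 0" unfolding norm .
  then have RL: "R \<in> LG \<Delta>" using L(8)[OF RcL c2L] by simp
  have Rq: "R * (1 - q) = 1 + q" using q1 by (simp add: R_def)
  have "R + 1 \<noteq> 0"
  proof
    assume "R + 1 = 0"
    then have "R = - 1" by simp
    with Rq show False by simp
  qed
  then have "q = (R - 1) / (R + 1)" using Rq by (simp add: nonzero_eq_divide_eq algebra_simps)
  also have "\<dots> \<in> LG \<Delta>" by (intro L RL)
  finally show ?thesis by (simp add: q_def)
qed

text \<open>\<open>rotation_in_trace_field\<close> at \<open>s = 1\<close> gives
  \<open>- nrd \<delta>\<close>, so division gives every square \<open>s^2\<close>, and
  \<open>2 s = (s + 1)^2 - s^2 - 1\<close>.\<close>

lemma LG_Delta: "LG \<Delta> = K"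
proof
  note L = real_subfieldD[OF LG_subfield[of \<Delta>]]
  show "LG \<Delta> \<subseteq> K" by (rule LG_K)
  obtain m \<epsilon> where e: "m > 0" "\<epsilon> \<in> \<O>" "nrd \<epsilon> = 1" "pcls r (\<lambda>i. mpow (h i) m) = pc \<epsilon>"
    using lift_of_power[OF h(1)] .
  have eA: "\<epsilon> \<in> A" by (rule O_A[OF e(2)])
  have dh: "det (h 1) = 1" using h(1) one_r by (auto simp: lifts_def SLr_def)
  have "mpow (h 1) m = \<psi> 1 \<epsilon> \<or> mpow (h 1) m = - \<psi> 1 \<epsilon>" using e(4) one_r unfolding pcls_eq_iff by blast
  then have "\<bar>trace (mpow (h 1) m)\<bar> = \<bar>trace (\<psi> 1 \<epsilon>)\<bar>" by auto
  also have "trace (\<psi> 1 \<epsilon>) = qtr \<epsilon>" unfolding psi_trace[OF one_r eA] by (rule emb1[OF A_closed(6)[OF eA]])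
  finally have tr: "\<bar>trace (mpow (h 1) m)\<bar> = \<bar>qtr \<epsilon>\<bar>" .
  obtain s q where s: "s \<noteq> 0" "mpow (h 1) m = s *\<^sub>R h 1 + q *\<^sub>R mat 1" using mpow_hyperbolic[OF dh h(2) e(1)] .
  have "(trace (h 1))\<^sup>2 > 4" using h(2) abs_le_square_iff[of 2 "trace (h 1)"] power2_eq_iff[of "trace (h 1)" 2]
    by (cases "(trace (h 1))\<^sup>2 = 4") auto
  \<comment> \<open>For determinant 1 this sign characterizes hyperbolic elements; passing to a
    power only multiplies the determinant by a nonzero square.\<close>
  then have "det (tpart (h 1)) < 0" using det_tpart[of "h 1"] dh by simp
  then have "det (tpart (mpow (h 1) m)) < 0" unfolding tpart_mpow[OF s(2)] using s(1) by (simp add: mult_pos_neg)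
  then have "(trace (mpow (h 1) m))\<^sup>2 > 4" using det_tpart[of "mpow (h 1) m"] det_mpow[OF dh] by simp
  then have "(qtr \<epsilon>)\<^sup>2 > 4" using tr by (metis power2_abs)
  then have e3: "\<bar>qtr \<epsilon>\<bar> > 2" using abs_le_square_iff[of "qtr \<epsilon>" 2] by simp
  define e0 where "e0 = qpure \<epsilon>"
  have e0A: "e0 \<in> A" unfolding e0_def by (rule qpure_A[OF eA])
  obtain e1 e2 e3' where e0: "e0 = (0, e1, e2, e3')"
    using qtr_qpure[of \<epsilon>] by (cases e0) (auto simp: e0_def qtr_def)
  have "e0 \<noteq> 0"
  proof
    assume "e0 = 0"
    then have "\<epsilon> = (qtr \<epsilon> / 2) *\<^sub>R (1, 0, 0, 0)" by (simp add: e0_def qpure_def del: scaleR_Pair)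
    then have "nrd \<epsilon> = (qtr \<epsilon> / 2)\<^sup>2 * nrd (1, 0, 0, 0)" by (metis reduced_norm_scaleR)
    then have "(qtr \<epsilon>)\<^sup>2 = 4" using e(3) by (simp add: power_divide)
    with \<open>(qtr \<epsilon>)\<^sup>2 > 4\<close> show False by simp
  qed
  then obtain \<delta> where d: "\<delta> \<in> A" "qtr \<delta> = 0" "fst (qm e0 \<delta>) = 0" "nrd \<delta> \<noteq> 0"
    using orthogonal_pure[of e1 e2 e3'] e0A unfolding e0 by blast
  have sq: "s\<^sup>2 * (- nrd \<delta>) \<in> LG \<Delta>" if "s \<in> K" for s
    by (rule rotation_in_trace_field[OF e(2,3) e3 d(1,2) _ that]) (use d(3) in \<open>simp only: e0_def\<close>)
  have "- nrd \<delta> \<in> LG \<Delta>" using sq[OF real_subfieldD(1)[OF K]] by simp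
  then have sqL: "s\<^sup>2 \<in> LG \<Delta>" if "s \<in> K" for s using L(8)[OF sq[OF that]] d(4) by fastforce
  show "K \<subseteq> LG \<Delta>"
  proof
    fix s assume s: "s \<in> K"
    have "((s + 1)\<^sup>2 - s\<^sup>2 - 1) / 2 \<in> LG \<Delta>"
      by (rule L(8)[OF L(7)[OF L(7)[OF sqL sqL] L(1)] real_subfield_numeral[OF LG_subfield]])
        (use s real_subfieldD(1,3)[OF K] in auto)
    also have "((s + 1)\<^sup>2 - s\<^sup>2 - 1) / 2 = s" by (simp add: power2_eq_square algebra_simps)
    finally show "s \<in> LG \<Delta>" .
  qed
qed

end

section \<open>Zariski density\<close>

lemma carrier_SL2R_pow: "x \<in> carrier (SL2R_pow r) \<longleftrightarrow> x \<in> SLr r \<and> x \<in> extensional {1..r}"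
  by (auto simp: SL2R_pow_def SLr_def PiE_def Pi_def)

lemma pcls_cong: "(\<And>i. i \<in> {1..r} \<Longrightarrow> x i = y i) \<Longrightarrow> pcls r x = pcls r y"
  by (simp add: pcls_eq_iff)

lemma pcls_eq_square:
  assumes "pcls r x = pcls r y" "i \<in> {1..r}"
  shows "x i ** x i = y i ** y i"
proof -
  have "x i = y i \<or> x i = - y i" using assms unfolding pcls_eq_iff by blast
  then show ?thesis by (elim disjE) (simp_all add: mat2_mult_uminus)
qed

lemma zariski_closed_hypersurface:
  assumes f: "entry_polynomial r f"
    and inv: "\<And>x y. pcls r x = pcls r y \<Longrightarrow> f x = 0 \<Longrightarrow> f y = 0"
  shows "zariski_closed r (pcls r ` {x \<in> SLr r. f x = 0})"
  unfolding zariski_closed_def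
proof (intro conjI exI[of _ "{f}"] ballI)
  show "pcls r ` {x \<in> SLr r. f x = 0} \<subseteq> carrier (PSL2R_pow r)"
    unfolding carrier_PSL2R_pow by blast
  show "{x \<in> carrier (SL2R_pow r). pcls r x \<in> pcls r ` {x \<in> SLr r. f x = 0}} =
      {x \<in> carrier (SL2R_pow r). \<forall>f\<in>{f}. f x = 0}"
  proof (intro Collect_cong conj_cong refl)
    fix x assume "x \<in> carrier (SL2R_pow r)"
    then have x: "x \<in> SLr r" by (simp add: carrier_SL2R_pow)
    show "pcls r x \<in> pcls r ` {x \<in> SLr r. f x = 0} \<longleftrightarrow> (\<forall>f\<in>{f}. f x = 0)"
    proof
      assume "pcls r x \<in> pcls r ` {x \<in> SLr r. f x = 0}"
      then obtain y where y: "pcls r x = pcls r y" "f y = 0" by blast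
      show "\<forall>f\<in>{f}. f x = 0" using inv[OF y(1)[symmetric] y(2)] by simp
    qed (use x in blast)
  qed
qed (use f in simp)

text \<open>Equations of a closed set containing \<open>\<Gamma>\<close> belong to
  \<open>Van\<close> when read on lifts.\<close>

lemma (in tangent) zariski_dense_if_vanishing:
  assumes T: "T = lifts r \<Gamma>" and \<Gamma>: "\<Gamma> \<subseteq> carrier (PSL2R_pow r)" and van: "\<forall>f\<in>Van. \<forall>x\<in>SLr r. f x = 0"
  shows "zariski_dense r \<Gamma>"
  unfolding zariski_dense_def
proof (intro allI impI)
  fix Z assume Z: "zariski_closed r Z \<and> \<Gamma> \<subseteq> Z"
  then obtain P where P: "\<forall>f\<in>P. entry_polynomial r f" and ZP: "{x \<in> carrier (SL2R_pow r). pcls r x \<in> Z} =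
        {x \<in> carrier (SL2R_pow r). \<forall>f\<in>P. f x = 0}" and Zc: "Z \<subseteq> carrier (PSL2R_pow r)"
    unfolding zariski_closed_def by blast
  have PV: "f \<in> Van" if f: "f \<in> P" for f
    unfolding Van_def
  proof (intro CollectI conjI ballI)
    show fE: "entry_polynomial r f" using P f by blast
    fix x assume "x \<in> T"
    then have x: "x \<in> SLr r" "pcls r x \<in> Z" using Z by (auto simp: T lifts_def)
    define x' where "x' = restrict x {1..r}"
    have "x' \<in> carrier (SL2R_pow r)" using x(1) by (auto simp: x'_def carrier_SL2R_pow SLr_def)
    moreover have "pcls r x' = pcls r x" by (rule pcls_cong) (simp add: x'_def)
    ultimately have "f x' = 0" using ZP x(2) f by auto
    moreover have "f x' = f x" by (rule entry_polynomial_cong[OF fE]) (simp add: x'_def)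
    ultimately show "f x = 0" by simp
  qed
  show "Z = carrier (PSL2R_pow r)"
  proof
    show "Z \<subseteq> carrier (PSL2R_pow r)" by (rule Zc)
    show "carrier (PSL2R_pow r) \<subseteq> Z"
    proof
      fix g assume "g \<in> carrier (PSL2R_pow r)"
      then obtain x where x: "x \<in> SLr r" "g = pcls r x" by (auto simp: carrier_PSL2R_pow)
      define x' where "x' = restrict x {1..r}"
      have x': "x' \<in> carrier (SL2R_pow r)" "x' \<in> SLr r" using x(1) by (auto simp: x'_def carrier_SL2R_pow SLr_def)
      have "\<forall>f\<in>P. f x' = 0" using van PV x'(2) by blast
      then have "pcls r x' \<in> Z" using ZP x'(1) by auto
      moreover have "pcls r x' = pcls r x" by (rule pcls_cong) (simp add: x'_def)
      ultimately show "g \<in> Z" using x(2) by simp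
    qed
  qed
qed

text \<open>A scalar square kills the products of the real part with the imaginary components. As
  \<open>u\<close> is not scalar, it is purely imaginary, and its square is minus its length
  squared.\<close>

lemma hamilton_negative:
  assumes u: "quat_mult (-1) (-1) u u = c *\<^sub>R (1, 0, 0, 0)" and n: "\<And>d. u \<noteq> d *\<^sub>R (1, 0, 0, 0)"
  shows "c < 0"
proof -
  obtain x0 x1 x2 x3 where u': "u = (x0, x1, x2, x3)" by (cases u)
  have n': "\<not> (x1 = 0 \<and> x2 = 0 \<and> x3 = 0)" using n[of x0] u' by auto
  have e: "x0 * x0 - x1 * x1 - x2 * x2 - x3 * x3 = c" "x0 * x1 = 0" "x0 * x2 = 0" "x0 * x3 = 0"
    using u unfolding u' by auto
  have "x0 = 0" using e n' by auto
  then have "c = - (x1\<^sup>2 + x2\<^sup>2 + x3\<^sup>2)" using e(1) by (simp add: power2_eq_square)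
  moreover have "x1\<^sup>2 + x2\<^sup>2 + x3\<^sup>2 > 0" using n' by (smt (verit) zero_le_power2 zero_less_power2)
  ultimately show ?thesis by simp
qed

text \<open>The generators go to nonscalar Hamilton quaternions with squares \<open>f a\<close> and
  \<open>f b\<close>.\<close>

lemma ramified_negative:
  assumes "ramified_at a b f"
  shows "f a < 0" "f b < 0"
proof -
  obtain h where h: "h \<in> ring_iso (quaternion_algebra UNIV (f a) (f b)) hamilton_quaternions" and lin: "linear h"
    using assms by (auto simp: ramified_at_def R_algebra_isomorphic_def)
  have hom: "h \<in> ring_hom (quaternion_algebra UNIV (f a) (f b)) hamilton_quaternions"
    and bij: "bij_betw h (carrier (quaternion_algebra UNIV (f a) (f b))) (carrier hamilton_quaternions)"
    using h by (auto simp: ring_iso_def)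
  have inj: "inj h" using bij by (simp add: bij_betw_def quaternion_algebra_def)
  have mult: "h (quat_mult (f a) (f b) x y) = quat_mult (-1) (-1) (h x) (h y)" for x y
    using ring_hom_mult[OF hom, of x y] by (simp add: quaternion_algebra_def hamilton_quaternions_def)
  have one: "h (1, 0, 0, 0) = (1, 0, 0, 0)"
    using ring_hom_one[OF hom] by (simp add: quaternion_algebra_def hamilton_quaternions_def)
  have sc: "h (c *\<^sub>R (1, 0, 0, 0)) = c *\<^sub>R (1, 0, 0, 0)" for c
    using linear_cmul[OF lin, of c "(1, 0, 0, 0)"] one by simp
  have neg: "c < 0" if u: "quat_mult (f a) (f b) u u = c *\<^sub>R (1, 0, 0, 0)" and n: "\<And>d. u \<noteq> d *\<^sub>R (1, 0, 0, 0)" for u c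
  proof (rule hamilton_negative[of "h u"])
    show "quat_mult (-1) (-1) (h u) (h u) = c *\<^sub>R (1, 0, 0, 0)" unfolding mult[symmetric] u by (rule sc)
    show "h u \<noteq> d *\<^sub>R (1, 0, 0, 0)" for d using n[of d] inj sc[of d] by (metis injD)
  qed
  show "f a < 0" by (rule neg[of "(0, 1, 0, 0)"]) auto
  show "f b < 0" by (rule neg[of "(0, 0, 1, 0)"]) auto
qed

section \<open>The two implications and the theorem\<close>

context nonelementary_arithmetic
begin

text \<open>The equalizer of two embeddings is a subfield of \<open>K\<close>.\<close>

lemma equal_on_LG:
  assumes ij: "i \<in> {1..n}" "j \<in> {1..n}" and eq: "\<And>\<alpha>. \<alpha> \<in> sqs (lifts r \<Gamma>) \<Longrightarrow> \<phi> i (qtr \<alpha>) = \<phi> j (qtr \<alpha>)"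
    and x: "x \<in> LG \<Gamma>"
  shows "\<phi> i x = \<phi> j x"
proof -
  have "real_subfield {x \<in> K. \<phi> i x = \<phi> j x}"
    unfolding real_subfield_def
    using real_subfieldD[OF K] embedding_simps[OF K emb[OF ij(1)]] embedding_simps[OF K emb[OF ij(2)]] by auto
  then have "LG \<Gamma> \<subseteq> {x \<in> K. \<phi> i x = \<phi> j x}"
    unfolding LG_def by (rule field_over_Q_least) (use eq qtr_sqs_K in blast)
  with x show ?thesis by blast
qed

lemma dense_imp_full:
  assumes \<Gamma>: "subgroup \<Gamma> (PSL2R_pow r)" "\<Gamma> \<subseteq> \<Delta>" and dense: "zariski_dense r \<Gamma>"
    and g: "g \<in> lifts r \<Gamma>" "\<bar>trace (g 1)\<bar> > 2"
  shows "LG \<Gamma> = K"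
proof (rule ccontr)
  assume ne: "LG \<Gamma> \<noteq> K"
  obtain j where j: "j \<in> {1..n}" "j \<noteq> 1" "\<And>x. x \<in> LG \<Gamma> \<Longrightarrow> \<phi> j x = x"
    using embedding_trivial_on_subfield[OF LG_subfield LG_K ne ir[OF one_r]] by metis
  have lift: "\<exists>\<alpha>. \<alpha> \<in> A \<and> nrd \<alpha> = 1 \<and> (\<forall>i\<in>{1..r}. \<psi> i \<alpha> = x i ** x i) \<and> qtr \<alpha> \<in> LG \<Gamma>" if x: "x \<in> lifts r \<Gamma>" for x
  proof -
    have "x \<in> lifts r \<Delta>" using x \<Gamma>(2) by (auto simp: lifts_def)
    from sqs_lift[OF this] obtain \<alpha> where \<alpha>: "\<alpha> \<in> A" "nrd \<alpha> = 1" "\<And>i. i \<in> {1..r} \<Longrightarrow> \<psi> i \<alpha> = x i ** x i" by blast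
    have "\<alpha> \<in> sqs (lifts r \<Gamma>)" by (rule sqs_base[OF x \<alpha>])
    then have "qtr \<alpha> \<in> LG \<Gamma>" unfolding LG_def by (intro field_over_Q_incl imageI)
    with \<alpha> show ?thesis by blast
  qed
  show False
  proof (cases "j \<le> r")
    case False
    then have "ramified_at a b (\<phi> j)" using j(1) by (intro ram) auto
    note neg = ramified_negative[OF this]
    obtain \<alpha> where \<alpha>: "\<alpha> \<in> A" "nrd \<alpha> = 1" "\<forall>i\<in>{1..r}. \<psi> i \<alpha> = g i ** g i" "qtr \<alpha> \<in> LG \<Gamma>" using lift[OF g(1)] by blast
    have dg: "det (g 1) = 1" using g(1) one_r by (auto simp: lifts_def SLr_def)
    have "qtr \<alpha> = trace (g 1 ** g 1)"
      using psi_trace[OF one_r \<alpha>(1)] emb1[OF A_closed(6)[OF \<alpha>(1)]] \<alpha>(3) one_r by simp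
    also have "\<dots> = (trace (g 1))\<^sup>2 - 2 * det (g 1)" by (simp add: mat2_simps power2_eq_square algebra_simps)
    finally have q: "qtr \<alpha> = (trace (g 1))\<^sup>2 - 2" using dg by simp
    have "(trace (g 1))\<^sup>2 > 4" using g(2) abs_le_square_iff[of 2 "trace (g 1)"] power2_eq_iff[of "trace (g 1)" 2]
      by (cases "(trace (g 1))\<^sup>2 = 4") auto
    then have q2: "qtr \<alpha> > 2" using q by simp
    obtain x0 x1 x2 x3 where x: "\<alpha> = (x0, x1, x2, x3)" "x0 \<in> K" "x1 \<in> K" "x2 \<in> K" "x3 \<in> K" using \<alpha>(1) by auto
    note E = embedding_simps[OF K emb[OF j(1)]]
    note Kc = real_subfieldD(3,4,7)[OF K]
    have abK: "a \<in> K" "b \<in> K" using a b by auto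
    have "\<phi> j (nrd \<alpha>) = (\<phi> j x0)\<^sup>2 - \<phi> j a * (\<phi> j x1)\<^sup>2 - \<phi> j b * (\<phi> j x2)\<^sup>2 + \<phi> j a * \<phi> j b * (\<phi> j x3)\<^sup>2"
      unfolding x(1) reduced_norm.simps power2_eq_square
      using x abK by (simp add: E(2,3,7) Kc)
    then have 1: "1 = (\<phi> j x0)\<^sup>2 - \<phi> j a * (\<phi> j x1)\<^sup>2 - \<phi> j b * (\<phi> j x2)\<^sup>2 + \<phi> j a * \<phi> j b * (\<phi> j x3)\<^sup>2"
      using \<alpha>(2) E(1) by simp
    \<comment> \<open>With \<open>\<phi> j a\<close> and \<open>\<phi> j b\<close> negative the norm
      form is a sum of nonnegative terms, so norm 1 bounds \<open>\<phi> j x0\<close> by 1, although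
      \<open>\<phi> j\<close> fixes the trace, which exceeds 2.\<close>
    have p: "\<phi> j a * (\<phi> j x1)\<^sup>2 \<le> 0" "\<phi> j b * (\<phi> j x2)\<^sup>2 \<le> 0" "\<phi> j a * \<phi> j b * (\<phi> j x3)\<^sup>2 \<ge> 0"
      using neg by (simp_all add: mult_nonpos_nonneg mult_nonpos_nonpos)
    have le1: "(\<phi> j x0)\<^sup>2 \<le> 1" using 1 p by linarith
    have "x0 + x0 \<in> LG \<Gamma>" using \<alpha>(4) by (simp add: qtr_def x(1))
    then have "\<phi> j x0 + \<phi> j x0 = x0 + x0" using j(3)[of "x0 + x0"] E(2)[OF x(2,2)] by simp
    then have "\<phi> j x0 > 1" using q2 by (simp add: qtr_def x(1))
    then have "(\<phi> j x0)\<^sup>2 > 1" by (simp add: one_less_power)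
    with le1 show False by simp
  next
    case True
    then have jr: "j \<in> {1..r}" using j(1) by auto
    define f where "f x = (trace (x 1 ** x 1) + trace (x j ** x j)) * (trace (x 1 ** x 1) + (-1) * trace (x j ** x j))" for x :: "nat \<Rightarrow> mat2"
    have E: "entry_polynomial r (\<lambda>x. trace (x i ** x i))" if "i \<in> {1..r}" for i
      unfolding trace2 mat2_mult_nth using that by (intro entry_polynomial.intros)
    have fE: "entry_polynomial r f" unfolding f_def by (intro entry_polynomial.intros E one_r jr)
    have closed: "zariski_closed r (pcls r ` {x \<in> SLr r. f x = 0})"
    proof (rule zariski_closed_hypersurface[OF fE])
      fix x y assume xy: "pcls r x = pcls r y" and fx: "f x = 0"
      have "x i ** x i = y i ** y i" if "i \<in> {1..r}" for i
        by (rule pcls_eq_square[OF xy that])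
      then have "f x = f y" using one_r jr by (simp add: f_def)
      with fx show "f y = 0" by simp
    qed
    have "\<Gamma> \<subseteq> pcls r ` {x \<in> SLr r. f x = 0}"
    proof
      fix \<gamma> assume "\<gamma> \<in> \<Gamma>"
      then obtain x where x: "x \<in> lifts r \<Gamma>" "\<gamma> = pcls r x"
        using subgroup_eq_lifts[of \<Gamma> r] subgroup.subset[OF \<Gamma>(1)] by blast
      obtain \<alpha> where \<alpha>: "\<alpha> \<in> A" "\<forall>i\<in>{1..r}. \<psi> i \<alpha> = x i ** x i" "qtr \<alpha> \<in> LG \<Gamma>" using lift[OF x(1)] by blast
      have "trace (x 1 ** x 1) = qtr \<alpha>"
        using psi_trace[OF one_r \<alpha>(1)] emb1[OF A_closed(6)[OF \<alpha>(1)]] \<alpha>(2) one_r by simp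
      moreover have "trace (x j ** x j) = qtr \<alpha>"
        using psi_trace[OF jr \<alpha>(1)] j(3)[OF \<alpha>(3)] \<alpha>(2) jr by simp
      ultimately have "f x = 0" by (simp add: f_def)
      then show "\<gamma> \<in> pcls r ` {x \<in> SLr r. f x = 0}" using x by (auto simp: lifts_def)
    qed
    then have all: "pcls r ` {x \<in> SLr r. f x = 0} = carrier (PSL2R_pow r)"
      using dense closed unfolding zariski_dense_def by blast
    \<comment> \<open>A point off the hypersurface: the squares have trace 2 in component 1 and
      \<open>4 + 1/4\<close> in component \<open>j\<close>.\<close>
    define y where "y = (\<lambda>i. if i = j then mat2 2 0 0 (1/2) else mat 1)"
    have "y \<in> SLr r" by (auto simp: y_def SLr_def det_2)
    then have "pcls r y \<in> pcls r ` {x \<in> SLr r. f x = 0}" unfolding all carrier_PSL2R_pow by blast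
    then obtain x where x: "pcls r y = pcls r x" "f x = 0" by blast
    have "x i ** x i = y i ** y i" if "i \<in> {1..r}" for i
      by (rule pcls_eq_square[OF x(1) that, symmetric])
    then have "f y = 0" using x(2) one_r jr by (simp add: f_def)
    then show False using j(2) by (simp add: f_def y_def trace2 mat2_mult_nth)
  qed
qed

lemma full_imp_dense:
  assumes \<Gamma>: "subgroup \<Gamma> (PSL2R_pow r)" "\<Gamma> \<subseteq> \<Delta>" and full: "LG \<Gamma> = K"
    and hyp: "\<And>i. i \<in> {1..r} \<Longrightarrow> \<exists>h\<in>lifts r \<Gamma>. \<exists>k\<in>lifts r \<Gamma>. \<bar>trace (h i)\<bar> > 2 \<and> \<bar>trace (k i)\<bar> > 2 \<and> det (h i ** k i - k i ** h i) \<noteq> 0"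
    and reg: "\<And>x i j. x \<in> lifts r \<Gamma> \<Longrightarrow> i \<in> {1..r} \<Longrightarrow> j \<in> {1..r} \<Longrightarrow> \<bar>trace (x i)\<bar> > 2 \<Longrightarrow> \<bar>trace (x j)\<bar> \<noteq> 2"
  shows "zariski_dense r \<Gamma>"
proof (rule ccontr)
  assume not_dense: "\<not> zariski_dense r \<Gamma>"
  interpret T: tangent r "lifts r \<Gamma>"
  proof
    show "lifts r \<Gamma> \<subseteq> SLr r" by (auto simp: lifts_def)
  qed (fact lifts_mult[OF \<Gamma>(1)] lifts_one[OF \<Gamma>(1)] lifts_adj2[OF \<Gamma>(1)])+
  have nv: "\<not> (\<forall>f\<in>T.Van. \<forall>x\<in>SLr r. f x = 0)"
    using T.zariski_dense_if_vanishing[OF refl subgroup.subset[OF \<Gamma>(1)]] not_dense by blast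
  obtain i j \<theta> where ij: "i \<in> {1..r}" "j \<in> {1..r}" "i \<noteq> j" and \<theta>: "\<And>A B. \<theta> (A ** B) = \<theta> A ** \<theta> B" "\<And>A. trace (\<theta> A) = trace A"
    "\<And>x. x \<in> lifts r \<Gamma> \<Longrightarrow> \<theta> (x i) = x j \<or> \<theta> (x i) = - x j"
  proof (rule T.dichotomy)
    show "\<exists>h\<in>lifts r \<Gamma>. \<exists>k\<in>lifts r \<Gamma>. \<bar>trace (h i)\<bar> > 2 \<and> \<bar>trace (k i)\<bar> > 2 \<and> det (h i ** k i - k i ** h i) \<noteq> 0"
      if "i \<in> {1..r}" for i using hyp[OF that] .
    show "\<bar>trace (x j)\<bar> \<noteq> 2"
      if "x \<in> lifts r \<Gamma>" "i \<in> {1..r}" "j \<in> {1..r}" "\<bar>trace (x i)\<bar> > 2" for x i j using reg[OF that] .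
  qed (use nv in blast)+
  have \<theta>1: "\<theta> (mat 1) = mat 1"
    using \<theta>(3)[OF lifts_one[OF \<Gamma>(1)]] \<theta>(2)[of "mat 1"] by auto
  \<comment> \<open>On squares the sign ambiguity between \<open>\<theta> (x i)\<close> and
    \<open>x j\<close> disappears.\<close>
  have \<psi>: "\<theta> (\<psi> i \<alpha>) = \<psi> j \<alpha>" if "\<alpha> \<in> sqs (lifts r \<Gamma>)" for \<alpha>
    using that
  proof (induction rule: sqs.induct)
    case one
    show ?case unfolding psi_one[OF ij(1)] psi_one[OF ij(2)] by (rule \<theta>1)
  next
    case (step x \<alpha> \<beta>)
    have \<beta>: "\<beta> \<in> A" using sqs_A step.hyps(5) by blast
    have "\<theta> (\<psi> i \<alpha>) = \<psi> j \<alpha>" unfolding step.hyps(4)[OF ij(1)] step.hyps(4)[OF ij(2)] \<theta>(1)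
      using \<theta>(3)[OF step.hyps(1)] by auto
    then show ?case
      unfolding psi_mult[OF ij(1) step.hyps(2) \<beta>] psi_mult[OF ij(2) step.hyps(2) \<beta>] \<theta>(1) step.IH by simp
  qed
  have "\<phi> i (qtr \<alpha>) = \<phi> j (qtr \<alpha>)" if \<alpha>: "\<alpha> \<in> sqs (lifts r \<Gamma>)" for \<alpha>
  proof -
    have "\<alpha> \<in> A" using sqs_A \<alpha> by blast
    then show ?thesis using psi_trace[OF ij(1)] psi_trace[OF ij(2)] \<theta>(2)[of "\<psi> i \<alpha>"] \<psi>[OF \<alpha>] by simp
  qed
  then have "\<phi> i x = \<phi> j x" if "x \<in> K" for x
    using equal_on_LG[OF ir[OF ij(1)] ir[OF ij(2)], of \<Gamma> x] that full by blast
  then show False using emb_distinct[OF ir[OF ij(1)] ir[OF ij(2)] ij(3)] by blast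
qed

end

theorem corollary2:
  fixes r :: nat and \<Gamma> \<Delta> :: "(nat \<Rightarrow> mat2 set) set"
  assumes "r \<ge> 1"
    and "irreducible_arithmetic r \<Delta>"
    and "subgroup \<Gamma> (PSL2R_pow r)" and "\<Gamma> \<subseteq> \<Delta>"
    and "nonelementary r \<Gamma>"
  shows "(zariski_dense r \<Gamma> \<longleftrightarrow> (\<exists>i\<in>{1..r}. same_trace_field r i \<Gamma> \<Delta>)) \<and>
         (zariski_dense r \<Gamma> \<longleftrightarrow> (\<forall>i\<in>{1..r}. same_trace_field r i \<Gamma> \<Delta>))"
proof -
  note \<Gamma> = assms(3,4)
  have "subgroup \<Delta> (PSL2R_pow r)" using assms(2) by (simp add: irreducible_arithmetic_def)
  obtain n K \<phi> a b \<psi> \<O> where ar: "totally_real_number_field n K \<phi>" "r \<le> n" "a \<in> K - {0}" "b \<in> K - {0}"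
    "\<forall>i\<in>{r+1..n}. ramified_at a b (\<phi> i)" "\<forall>i\<in>{1..r}. extends_embedding K a b (\<phi> i) (\<psi> i)"
    "is_order K a b \<O>" "commensurable (PSL2R_pow r) \<Delta> (norm_one_group r a b \<psi> \<O>)"
    using assms(2) unfolding irreducible_arithmetic_def by metis
  have hyp: "\<exists>h\<in>lifts r \<Gamma>. \<exists>k\<in>lifts r \<Gamma>. \<bar>trace (h i)\<bar> > 2 \<and> \<bar>trace (k i)\<bar> > 2 \<and> det (h i ** k i - k i ** h i) \<noteq> 0"
    if i: "i \<in> {1..r}" for i
  proof -
    define H where "H = (\<lambda>x. x i) ` lifts r \<Gamma>"
    have pj: "proj_set i \<Gamma> = cls ` H"
    proof -
      have "proj_set i \<Gamma> = (\<lambda>g. g i) ` pcls r ` lifts r \<Gamma>"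
        unfolding proj_set_def using subgroup_eq_lifts[OF subgroup.subset[OF \<Gamma>(1)]] by simp
      then show ?thesis using i by (simp add: H_def image_image)
    qed
    have ne: "\<not> elementary (cls ` H)" unfolding pj[symmetric] using assms(5) i unfolding nonelementary_def by blast
    obtain h k where "h \<in> H" "k \<in> H" "\<bar>trace h\<bar> > 2" "\<bar>trace k\<bar> > 2" "det (h ** k - k ** h) \<noteq> 0"
    proof (rule hyperbolic_pair[OF _ _ _ _ ne])
      show "det M = 1" if "M \<in> H" for M using that i by (auto simp: H_def lifts_def SLr_def)
      show "M ** N \<in> H" if MN: "M \<in> H" "N \<in> H" for M N
      proof -
        obtain x y where x: "x \<in> lifts r \<Gamma>" "M = x i" and y: "y \<in> lifts r \<Gamma>" "N = y i" using MN unfolding H_def by blast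
        show ?thesis unfolding H_def x(2) y(2) by (rule image_eqI[OF _ lifts_mult[OF \<Gamma>(1) x(1) y(1)]]) simp
      qed
      show "mat 1 \<in> H" unfolding H_def by (rule image_eqI[OF _ lifts_one[OF \<Gamma>(1)]]) simp
      show "adj2 M \<in> H" if M: "M \<in> H" for M
      proof -
        obtain x where x: "x \<in> lifts r \<Gamma>" "M = x i" using M unfolding H_def by blast
        show ?thesis unfolding H_def x(2) by (rule image_eqI[OF _ lifts_adj2[OF \<Gamma>(1) x(1)]]) simp
      qed
    qed blast
    then show ?thesis unfolding H_def by blast
  qed
  \<comment> \<open>A component of trace 2 or -2 next to a hyperbolic one would make the element
    mixed, with a component that is neither hyperbolic nor elliptic.\<close>
  have reg: "\<bar>trace (x j)\<bar> \<noteq> 2" if x: "x \<in> lifts r \<Gamma>" "i \<in> {1..r}" "j \<in> {1..r}" "\<bar>trace (x i)\<bar> > 2" for x i j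
  proof
    assume par: "\<bar>trace (x j)\<bar> = 2"
    have g: "pcls r x \<in> \<Gamma>" using x(1) by (simp add: lifts_def)
    have ti: "tr_abs (pcls r x i) > 2" and tj: "tr_abs (pcls r x j) = 2"
      using x(2,3,4) par by (simp_all add: tr_abs_cls del: One_nat_def)
    have "pcls r x \<noteq> \<one>\<^bsub>PSL2R_pow r\<^esub>"
    proof
      assume "pcls r x = \<one>\<^bsub>PSL2R_pow r\<^esub>"
      then have "x i = mat 1 \<or> x i = - mat 1" unfolding one_PSL2R_pow pcls_eq_iff using x(2) by blast
      with x(4) show False by auto
    qed
    moreover have "\<not> elliptic (pcls r x i)" "\<not> parabolic (pcls r x i)" using ti by (simp_all add: elliptic_def parabolic_def)
    moreover have nh: "\<not> hyperbolic (pcls r x j)" using tj by (simp add: hyperbolic_def)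
    ultimately have "mixed r (pcls r x)" unfolding mixed_def using x(2,3) by blast
    then have "hyperbolic (pcls r x j) \<or> elliptic (pcls r x j)"
      using assms(5) g x(3) unfolding nonelementary_def by blast
    with nh tj show False by (simp add: elliptic_def)
  qed
  have one: "1 \<in> {1..r}" using assms(1) by auto
  obtain h k where pair: "h \<in> lifts r \<Gamma>" "k \<in> lifts r \<Gamma>" "\<bar>trace (h 1)\<bar> > 2" "\<bar>trace (k 1)\<bar> > 2" "det (h 1 ** k 1 - k 1 ** h 1) \<noteq> 0"
    using hyp[OF one] by blast
  have sub: "lifts r \<Gamma> \<subseteq> lifts r \<Delta>" using assms(4) by (auto simp: lifts_def)
  interpret nonelementary_arithmetic n K \<phi> r a b \<psi> \<O> \<Delta> h k
  proof (intro nonelementary_arithmetic.intro arithmetic_group.intro arithmetic_group_axioms.intro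
      nonelementary_arithmetic_axioms.intro totally_real.intro)
    show "subgroup \<Delta> (PSL2R_pow r)" by fact
    show "ramified_at a b (\<phi> j)" if "j \<in> {r+1..n}" for j using ar(5) that by blast
    show "extends_embedding K a b (\<phi> i) (\<psi> i)" if "i \<in> {1..r}" for i using ar(6) that by blast
    show "h \<in> lifts r \<Delta>" "k \<in> lifts r \<Delta>" using pair(1,2) sub by blast+
  qed (fact ar pair assms(1))+
  have "zariski_dense r \<Gamma> \<longleftrightarrow> LG \<Gamma> = K"
  proof
    assume "zariski_dense r \<Gamma>"
    then show "LG \<Gamma> = K" using dense_imp_full[OF \<Gamma> _ pair(1,3)] by blast
  next
    assume full: "LG \<Gamma> = K"
    show "zariski_dense r \<Gamma>"
    proof (rule full_imp_dense[OF \<Gamma> full])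
      show "\<exists>h\<in>lifts r \<Gamma>. \<exists>k\<in>lifts r \<Gamma>. \<bar>trace (h i)\<bar> > 2 \<and> \<bar>trace (k i)\<bar> > 2 \<and> det (h i ** k i - k i ** h i) \<noteq> 0"
        if "i \<in> {1..r}" for i using hyp[OF that] .
      show "\<bar>trace (x j)\<bar> \<noteq> 2"
        if "x \<in> lifts r \<Gamma>" "i \<in> {1..r}" "j \<in> {1..r}" "\<bar>trace (x i)\<bar> > 2" for x i j using reg[OF that] .
    qed
  qed
  then have "zariski_dense r \<Gamma> \<longleftrightarrow> same_trace_field r i \<Gamma> \<Delta>" if "i \<in> {1..r}" for i
    unfolding same_trace_field_iff[OF \<Gamma> that] LG_Delta .
  with one_r show ?thesis by blast
qed

end
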